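(* Let $(\tau_1,\tau_2,\tau_3)=(0,1,0)$. Let $N,\ell$ be positive integers with $\ell\le N$, let $U_0\in H^N(\mathbb{R})\cap L^1(\mathbb{R})$, and let $U$ be the solution of the Cauchy problem (S) (described in the context) with initial datum $U_0$. Then, for any $j\in\{0,\dots,N-\ell\}$, there exist $c_0,\tilde c_0>0$ such that, for any $t\ge 0$, the following holds. Case $\epsilon_0=1$: if $k_1=k_2=k_3$, then $$\|\partial_x^jU(\cdot,t)\|_{L^2(\mathbb{R})}\le c_0(1+t)^{-1/12-j/6}\|U_0\|_{L^1(\mathbb{R})}+c_0e^{-\tilde c_0t}\|\partial_x^{j+\ell}U_0\|_{L^2(\mathbb{R})},$$ and if $k_1=k_2=k_3$ does not hold, then $$\|\partial_x^jU(\cdot,t)\|_{L^2(\mathbb{R})}\le c_0(1+t)^{-1/12-j/6}\|U_0\|_{L^1(\mathbb{R})}+c_0(1+t)^{-\ell/4}\|\partial_x^{j+\ell}U_0\|_{L^2(\mathbb{R})}.$$ Case $\epsilon_0=0$: if $k_1=k_2=k_3$, then $$\|\partial_x^jU(\cdot,t)\|_{L^2(\mathbb{R})}\le c_0(1+t)^{-1/8-j/4}\|U_0\|_{L^1(\mathbb{R})}+c_0(1+t)^{-\ell/2}\|\partial_x^{j+\ell}U_0\|_{L^2(\mathbb{R})},$$ and if $k_1=k_2=k_3$ does not hold, then $$\|\partial_x^jU(\cdot,t)\|_{L^2(\mathbb{R})}\le c_0(1+t)^{-1/8-j/4}\|U_0\|_{L^1(\mathbb{R})}+c_0(1+t)^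{-\ell/4}\|\partial_x^{j+\ell}U_0\|_{L^2(\mathbb{R})}.$$
   Context: Constants: $k_1,k_2,k_3,k_4,k_5>0$, $\gamma\in\mathbb{R}\setminus\{0\}$, $(\tau_1,\tau_2,\tau_3)\in\{(1,0,0),(0,1,0),(0,0,1)\}$, $\epsilon_0\in\{0,1\}$. Cauchy problem (S): for $x\in\mathbb{R}$, $t>0$, the unknown is $U=(v,u,z,y,\phi,\theta,\sigma,\eta)^T$, with $U(\cdot,0)=U_0$ and $$\begin{cases} v_t-u_x-y-\theta=0,\\ u_t-k_1v_x+\tau_1\gamma\eta_x=0,\\ z_t-y_x=0,\\ y_t-k_2z_x+k_1v+\tau_2\gamma\eta_x=0,\\ \phi_t-\theta_x=0,\\ \theta_t-k_3\phi_x+k_1v+\tau_3\gamma\eta_x=0,\\ \sigma_t-\eta_x=0,\\ \eta_t-k_4\sigma_x+(-1)^{\epsilon_0}k_5\partial_x^{2\epsilon_0}\eta+\gamma(\tau_1u_x+\tau_2y_x+\tau_3\theta_x)=0. \end{cases}$$ So the dissipation term is $-k_5\eta_{xx}$ if $\epsilon_0=1$ and $k_5\eta$ if $\epsilon_0=0$. (It arises from a laminated Timoshenko beam $(\varphi,\psi,w)$ coupled to a temperature variable $q$ by $u=\varphi_t$, $y=\psi_t$, $\theta=w_t$, $\eta=q_t$, $v=\varphi_x+\psi+w$, $z=\psi_x$, $\phi=w_x$, $\sigma=q_x$.) Taking the Fourier transform $\widehat{\cdot}$ in $x$ (so $\partial_x$ becomes multiplication by $i\xi$), (S) becomes for each $\xi\in\mathbb{R}$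 a linear constant-coefficient ODE system $\widehat U_t(\xi,t)=A(\xi)\widehat U(\xi,t)$ in $\mathbb{C}^8$, and the solution $U$ of (S) is the one given by $\widehat U(\xi,t)=e^{tA(\xi)}\widehat U_0(\xi)$. Norms of vector-valued functions are the usual ones (built from the Euclidean norm on $\mathbb{C}^8$). *)

theory Defs
  imports "HOL-Analysis.Analysis"
begin

section \<open>Function spaces on the real line\<close>

definition square_integrable :: "(real \<Rightarrow> 'a::euclidean_space) \<Rightarrow> bool" where
  "square_integrable f \<longleftrightarrow>
     f \<in> borel_measurable lborel \<and> integrable lborel (\<lambda>x. (norm (f x))\<^sup>2)"

definition L1_norm :: "(real \<Rightarrow> 'a::euclidean_space) \<Rightarrow> real" where
  "L1_norm f = (LINT x|lborel. norm (f x))"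

text \<open>The Bochner integral of a non-integrable function is 0, so \<open>L2_norm\<close> is meaningful only
  for square-integrable functions.\<close>

definition L2_norm :: "(real \<Rightarrow> 'a::euclidean_space) \<Rightarrow> real" where
  "L2_norm f = sqrt (LINT x|lborel. (norm (f x))\<^sup>2)"

definition locally_integrable :: "(real \<Rightarrow> 'a::euclidean_space) \<Rightarrow> bool" where
  "locally_integrable f \<longleftrightarrow> (\<forall>a b. set_integrable lborel {a..b} f)"

definition test_function :: "(real \<Rightarrow> real) \<Rightarrow> bool" where
  "test_function p \<longleftrightarrow>
     (\<forall>k x. ((deriv ^^ k) p) field_differentiable (at x)) \<and>
     (\<exists>R. \<forall>x. \<bar>x\<bar> > R \<longrightarrow> p x = 0)"

definition has_weak_deriv ::
    "nat \<Rightarrow> (real \<Rightarrow> 'a::euclidean_space) \<Rightarrow> (real \<Rightarrow> 'a) \<Rightarrow> bool" where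
  "has_weak_deriv k f g \<longleftrightarrow> locally_integrable f \<and> locally_integrable g \<and>
     (\<forall>p. test_function p \<longrightarrow>
        (LINT x|lborel. (deriv ^^ k) p x *\<^sub>R f x) =
        (-1) ^ k *\<^sub>R (LINT x|lborel. p x *\<^sub>R g x))"

text \<open>A weak derivative is unique almost everywhere; \<open>weak_deriv\<close> chooses a representative, so
  that its \<open>L2_norm\<close> does not depend on the choice. It is meaningful only if a weak derivative
  exists.\<close>

definition weak_deriv :: "nat \<Rightarrow> (real \<Rightarrow> 'a::euclidean_space) \<Rightarrow> real \<Rightarrow> 'a" where
  "weak_deriv k f = (SOME g. has_weak_deriv k f g)"

definition sobolev_H :: "nat \<Rightarrow> (real \<Rightarrow> 'a::euclidean_space) set" where
  "sobolev_H N = {f. square_integrable f \<and>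
     (\<forall>k\<le>N. \<exists>g. has_weak_deriv k f g \<and> square_integrable g)}"


section \<open>Fourier transform\<close>

definition fourier :: "(real \<Rightarrow> complex ^ 'n) \<Rightarrow> real \<Rightarrow> complex ^ 'n" where
  "fourier f \<xi> = (LINT x|lborel. cis (- (\<xi> * x)) *s f x)"

text \<open>The Fourier--Plancherel transform of a function in \<open>L\<^sup>2\<close>: \<open>g\<close> is the \<open>L\<^sup>2\<close>-limit, as
  \<open>R \<rightarrow> \<infinity>\<close>, of the transforms of the truncations of \<open>f\<close> to \<open>[-R, R]\<close>. Convergence is expressed
  with the extended nonnegative integral, which is \<open>\<infinity>\<close> where the squared norm is not integrable.\<close>

definition has_fourier_L2 :: "(real \<Rightarrow> complex ^ 'n) \<Rightarrow> (real \<Rightarrow> complex ^ 'n) \<Rightarrow> bool" where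
  "has_fourier_L2 f g \<longleftrightarrow> square_integrable f \<and> square_integrable g \<and>
     ((\<lambda>R. \<integral>\<^sup>+ \<xi>. ennreal ((norm (fourier (\<lambda>x. indicator {-R..R} x *\<^sub>R f x) \<xi> - g \<xi>))\<^sup>2) \<partial>lborel)
        \<longlongrightarrow> 0) at_top"


section \<open>Matrix exponential\<close>

definition mat_exp :: "complex ^ 'n ^ 'n \<Rightarrow> complex ^ 'n ^ 'n" where
  "mat_exp A = (\<Sum>k. (1 / fact k) *\<^sub>R (((**) A ^^ k) (mat 1)))"


section \<open>The laminated beam system\<close>

text \<open>The components of the unknown are, in this order, \<open>v, u, z, y, \<phi>, \<theta>, \<sigma>, \<eta>\<close>.
  \<open>beam_rhs\<close> is the system solved for the time derivatives, with \<open>\<partial>\<^sub>x\<close> replaced by multiplication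
  by \<open>D = \<i> \<xi>\<close>. The argument order is \<open>k\<^sub>1, \<dots>, k\<^sub>5, \<gamma>, \<tau>\<^sub>1, \<tau>\<^sub>2, \<tau>\<^sub>3, \<epsilon>\<^sub>0\<close>, then \<open>\<xi>\<close> and the state.\<close>

definition beam_rhs ::
    "real \<Rightarrow> real \<Rightarrow> real \<Rightarrow> real \<Rightarrow> real \<Rightarrow> real \<Rightarrow> real \<Rightarrow> real \<Rightarrow> real \<Rightarrow> nat \<Rightarrow>
     real \<Rightarrow> complex ^ 8 \<Rightarrow> complex ^ 8" where
  "beam_rhs k1 k2 k3 k4 k5 \<gamma> \<tau>1 \<tau>2 \<tau>3 \<epsilon>0 \<xi> U =
    (let D = \<i> * complex_of_real \<xi>;
         v = U $ 1; u = U $ 2; z = U $ 3; y = U $ 4;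
         \<phi> = U $ 5; \<theta> = U $ 6; \<sigma> = U $ 7; \<eta> = U $ 8
     in vector
      [D * u + y + \<theta>,
       k1 * (D * v) - \<tau>1 * \<gamma> * (D * \<eta>),
       D * y,
       k2 * (D * z) - k1 * v - \<tau>2 * \<gamma> * (D * \<eta>),
       D * \<theta>,
       k3 * (D * \<phi>) - k1 * v - \<tau>3 * \<gamma> * (D * \<eta>),
       D * \<eta>,
       k4 * (D * \<sigma>) - (-1) ^ \<epsilon>0 * k5 * (D ^ (2 * \<epsilon>0) * \<eta>)
         - \<gamma> * (\<tau>1 * (D * u) + \<tau>2 * (D * y) + \<tau>3 * (D * \<theta>))])"

definition beam_matrix ::
    "real \<Rightarrow> real \<Rightarrow> real \<Rightarrow> real \<Rightarrow> real \<Rightarrow> real \<Rightarrow> real \<Rightarrow> real \<Rightarrow> real \<Rightarrow> nat \<Rightarrow>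
     real \<Rightarrow> complex ^ 8 ^ 8" where
  "beam_matrix k1 k2 k3 k4 k5 \<gamma> \<tau>1 \<tau>2 \<tau>3 \<epsilon>0 \<xi> = matrix (beam_rhs k1 k2 k3 k4 k5 \<gamma> \<tau>1 \<tau>2 \<tau>3 \<epsilon>0 \<xi>)"

definition beam_solution ::
    "real \<Rightarrow> real \<Rightarrow> real \<Rightarrow> real \<Rightarrow> real \<Rightarrow> real \<Rightarrow> real \<Rightarrow> real \<Rightarrow> real \<Rightarrow> nat \<Rightarrow>
     (real \<Rightarrow> complex ^ 8) \<Rightarrow> (real \<Rightarrow> real \<Rightarrow> complex ^ 8) \<Rightarrow> bool" where
  "beam_solution k1 k2 k3 k4 k5 \<gamma> \<tau>1 \<tau>2 \<tau>3 \<epsilon>0 U0 U \<longleftrightarrow>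
     (\<forall>t\<ge>0. has_fourier_L2 (\<lambda>x. U x t)
        (\<lambda>\<xi>. mat_exp (t *\<^sub>R beam_matrix k1 k2 k3 k4 k5 \<gamma> \<tau>1 \<tau>2 \<tau>3 \<epsilon>0 \<xi>) *v fourier U0 \<xi>))"

lemma vector_8:
  fixes a b c d e f g h :: "'a::zero"
  defines "w \<equiv> (vector [a, b, c, d, e, f, g, h] :: 'a ^ 8)"
  shows "w $ 1 = a" "w $ 2 = b" "w $ 3 = c" "w $ 4 = d"
    "w $ 5 = e" "w $ 6 = f" "w $ 7 = g" "w $ 8 = h"
  unfolding w_def vector_def by simp_all

lemma exhaust_8:
  fixes x :: 8
  shows "x = 1 \<or> x = 2 \<or> x = 3 \<or> x = 4 \<or> x = 5 \<or> x = 6 \<or> x = 7 \<or> x = 8"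
proof (induct x)
  case (of_int z)
  then have "z = 0 \<or> z = 1 \<or> z = 2 \<or> z = 3 \<or> z = 4 \<or> z = 5 \<or> z = 6 \<or> z = 7"
    by fastforce
  then show ?case by auto
qed

lemma forall_8:
  "(\<forall>i::8. P i) \<longleftrightarrow> P 1 \<and> P 2 \<and> P 3 \<and> P 4 \<and> P 5 \<and> P 6 \<and> P 7 \<and> P 8"
  by (metis exhaust_8)

lemma linear_beam_rhs:
  "Vector_Spaces.linear (*s) (*s) (beam_rhs k1 k2 k3 k4 k5 \<gamma> \<tau>1 \<tau>2 \<tau>3 \<epsilon>0 \<xi>)"
  by unfold_locales
     (simp_all add: vec_eq_iff forall_8 beam_rhs_def Let_def vector_8 algebra_simps)

lemma beam_matrix_mult:
  "beam_matrix k1 k2 k3 k4 k5 \<gamma> \<tau>1 \<tau>2 \<tau>3 \<epsilon>0 \<xi> *v U = beam_rhs k1 k2 k3 k4 k5 \<gamma> \<tau>1 \<tau>2 \<tau>3 \<epsilon>0 \<xi> U"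
  unfolding beam_matrix_def by (rule matrix_works[OF linear_beam_rhs])

end

(* The decay rates are read off from a pointwise bound on exp (t A(xi)). The energy
   k1 |v|^2 + |u|^2 + k2 |z|^2 + |y|^2 + k3 |phi|^2 + |theta|^2 + k4 |sigma|^2 + |eta|^2 does not
   increase along solutions of the transformed system. If |x| <= M |(i omega - A(xi)) x| for all
   omega, then Plancherel's identity in time, applied to the solution cut off to an interval of
   length T, shows that the energy drops by a factor 4 over a time T proportional to M, so it decays
   like exp (-c t / M).

   The resolvent bound comes from the dissipation identity, which controls eta, and from solving
   the resolvent equation successively for the other components. This gives M ~ |xi|^-(4 + 2 eps0)
   for |xi| <= 1; for |xi| >= 1 it gives M ~ |xi|^4 in general, M ~ |xi|^2 if k1 = k3, and M ~ 1 if
   k1 = k2 = k3 and eps0 = 1.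

   Splitting the norm of the transform of the solution at |xi| = 1, the low frequencies are
   bounded by the L1 norm of the datum and the high frequencies by its weak derivative of order
   j + l, which is where l derivatives are traded for decay. *)

theory Submission
  imports Defs "HOL-Probability.Characteristic_Functions" "HOL-Probability.Sinc_Integral"
    "HOL-Computational_Algebra.Polynomial"
begin

section \<open>The scalar Fourier transform\<close>

text \<open>The exponents come from squares. The resolvent equation bounds the solution by a
  multiple \<open>a\<close> of |eta| plus data, while the dissipation controls only d |eta|^2, by
  the product of solution and data; absorbing the solution therefore produces a^2 / d. At low
  frequency a ~ |xi|^-2 and d ~ |xi|^(2 eps0), hence |xi|^-(4 + 2 eps0). At high frequency a ~ (|xi|
  + d) s with s = |xi|, 1 or 1 / |xi| in the three cases, and (|xi| + d)^2 / d is at most of order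
  |xi|^2 for both kinds of damping, hence the powers 4, 2 and 0. The squared L2 norm of |xi|^j exp
  (- c t |xi|^q) decays like t^-((2 j + 1) / q); its root with q = 6 and q = 4 is the first rate of
  each estimate. The solution is given only through its transform, so its weak derivatives have to
  be constructed, by inverting transforms against test functions. Conversely, weak derivatives of
  the datum have to bound its transform. Both directions need only inequalities. Plancherel's
  identity in time also needs a lower bound, proved for bounded continuous integrable functions,
  which is one reason why the time cutoff vanishes at both ends.\<close>

definition ft :: "(real \<Rightarrow> complex) \<Rightarrow> real \<Rightarrow> complex" where
  "ft f \<xi> = (LINT x|lborel. cis (- (\<xi> * x)) * f x)"

lemma borel_measurable_cis [measurable]: "cis \<in> borel_measurable borel"
  by (intro borel_measurable_continuous_onI continuous_intros)

lemma borel_measurable_cnj [measurable]: "cnj \<in> borel_measurable borel"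
  by (intro borel_measurable_continuous_onI continuous_intros)

lemma integrable_cis_mult:
  fixes f :: "real \<Rightarrow> complex"
  assumes "integrable lborel f" "g \<in> borel_measurable borel"
  shows "integrable lborel (\<lambda>x. cis (g x) * f x)"
proof (rule Bochner_Integration.integrable_bound[OF assms(1)])
  show "(\<lambda>x. cis (g x) * f x) \<in> borel_measurable lborel"
    using assms by measurable
qed (simp add: norm_mult)

lemma borel_measurable_ft [measurable]:
  assumes [measurable]: "f \<in> borel_measurable borel"
  shows "ft f \<in> borel_measurable borel"
  unfolding ft_def[abs_def] by measurable

lemma norm_ft_le: "norm (ft f \<xi>) \<le> (LINT x|lborel. norm (f x))"
  unfolding ft_def by (rule order_trans[OF integral_norm_bound]) (simp add: norm_mult)

text \<open>Fubini's theorem for the kernel \<open>cis (- (x * y))\<close>, which is symmetric in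
  its two variables.\<close>

lemma ft_multiplication:
  assumes f: "integrable lborel f" and g: "integrable lborel g"
  shows "(LINT x|lborel. ft f x * g x) = (LINT x|lborel. f x * ft g x)"
proof -
  have [measurable]: "f \<in> borel_measurable borel" and [measurable]: "g \<in> borel_measurable borel"
    using f g by auto
  have *: "integrable (lborel \<Otimes>\<^sub>M lborel) (\<lambda>(x, y). cis (- (x * y)) * f y * g x)"
  proof (rule lborel_pair.Fubini_integrable)
    show "(\<lambda>(x, y). cis (- (x * y)) * f y * g x) \<in> borel_measurable (lborel \<Otimes>\<^sub>M lborel)"
      by measurable
    have "(\<lambda>x. LINT y|lborel. norm (case (x, y) of (x, y) \<Rightarrow> cis (- (x * y)) * f y * g x))
        = (\<lambda>x. (LINT y|lborel. norm (f y)) * norm (g x))"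
      by (simp add: norm_mult)
    then show "integrable lborel (\<lambda>x. LINT y|lborel. norm (case (x, y) of (x, y) \<Rightarrow> cis (- (x * y)) * f y * g x))"
      using g by simp
    show "AE x in lborel. integrable lborel (\<lambda>y. case (x, y) of (x, y) \<Rightarrow> cis (- (x * y)) * f y * g x)"
    proof (rule AE_I2)
      fix x
      show "integrable lborel (\<lambda>y. case (x, y) of (x, y) \<Rightarrow> cis (- (x * y)) * f y * g x)"
        using integrable_mult_left[OF integrable_cis_mult[OF f, of "\<lambda>y. - (x * y)"], of "g x"] by simp
    qed
  qed
  have "(LINT x|lborel. ft f x * g x) = (LINT x|lborel. LINT y|lborel. cis (- (x * y)) * f y * g x)"
    by (simp add: ft_def)
  also have "\<dots> = (LINT y|lborel. LINT x|lborel. cis (- (x * y)) * f y * g x)"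
    using lborel_pair.Fubini_integral[OF *] by simp
  also have "\<dots> = (LINT x|lborel. f x * ft g x)"
  proof (rule Bochner_Integration.integral_cong[OF refl])
    fix y
    have "(LINT x|lborel. cis (- (x * y)) * f y * g x) = (LINT x|lborel. f y * (cis (- (y * x)) * g x))"
      by (simp add: mult_ac)
    then show "(LINT x|lborel. cis (- (x * y)) * f y * g x) = f y * ft g y"
      unfolding ft_def by (simp only: integral_mult_right_zero)
  qed
  finally show ?thesis .
qed

section \<open>Gaussians and regularized inversion\<close>

lemma ft_cis_mult: "ft (\<lambda>x. f x * cis (a * x)) \<xi> = ft f (\<xi> - a)"
  unfolding ft_def by (rule Bochner_Integration.integral_cong[OF refl])
     (simp add: cis_mult mult_ac algebra_simps flip: mult.assoc)

text \<open>The characteristic function of the standard normal law; \<open>char\<close> carries the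
  opposite sign in the phase.\<close>

lemma ft_std_normal_density:
  "ft (\<lambda>x. of_real (std_normal_density x)) t = of_real (exp (- t\<^sup>2 / 2))"
proof -
  have "char std_normal_distribution (- t) = ft (\<lambda>x. of_real (std_normal_density x)) t"
    unfolding char_def ft_def
    by (subst integral_density) (auto simp: scaleR_conv_of_real mult.commute cis_conv_exp)
  then show ?thesis by (simp add: char_std_normal_distribution)
qed

text \<open>Normalized to the value 1 at 0 and not to mass 1: it serves as an integrable multiplier
  that tends to 1 as the width \<open>s\<close> grows.\<close>

definition gauss :: "real \<Rightarrow> real \<Rightarrow> real" where
  "gauss s \<xi> = exp (- (\<xi> / s)\<^sup>2 / 2)"

lemma gauss_eq: "gauss s \<xi> = sqrt (2 * pi) * std_normal_density (\<xi> / s)"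
  by (simp add: gauss_def std_normal_density_def)

lemma borel_measurable_gauss [measurable]: "gauss s \<in> borel_measurable borel"
  unfolding gauss_def[abs_def] by measurable

lemma integrable_std_normal: "integrable lborel std_normal_density"
  using integrable_std_normal_moment[of 0] by simp

lemma integral_std_normal: "(LINT x|lborel. std_normal_density x) = 1"
  using integral_std_normal_moment_even[of 0] by simp

lemma integrable_gauss:
  assumes "s > 0" shows "integrable lborel (gauss s)"
  using lborel_integrable_real_affine[OF integrable_std_normal, of "1/s" 0] assms
  unfolding gauss_eq[abs_def] by (simp add: divide_inverse mult.commute)

text \<open>Scaling of the standard normal case. Written with the density, the right-hand side shows
  its total mass \<open>2 * pi\<close> and its width \<open>1 / s\<close>.\<close>

lemma ft_gauss:
  assumes "s > 0"
  shows "ft (\<lambda>x. of_real (gauss s x)) \<xi> = of_real (2 * pi * s * std_normal_density (s * \<xi>))"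
proof -
  have "ft (\<lambda>x. of_real (gauss s x)) \<xi>
      = (LINT x|lborel. cis (- (\<xi> * x)) * of_real (sqrt (2 * pi) * std_normal_density (x / s)))"
    unfolding ft_def gauss_eq ..
  also have "\<dots> = s *\<^sub>R (LINT x|lborel. cis (- (\<xi> * (s * x))) * of_real (sqrt (2 * pi) * std_normal_density x))"
    using assms by (subst lborel_integral_real_affine[where c=s and t=0]) auto
  also have "\<dots> = s *\<^sub>R (LINT x|lborel. of_real (sqrt (2 * pi)) * (cis (- ((s * \<xi>) * x)) * of_real (std_normal_density x)))"
    by (simp add: mult_ac)
  also have "\<dots> = of_real (s * sqrt (2 * pi)) * ft (\<lambda>x. of_real (std_normal_density x)) (s * \<xi>)"
    unfolding ft_def by (simp only: integral_mult_right_zero scaleR_conv_of_real of_real_mult mult.assoc)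
  also have "\<dots> = of_real (2 * pi * s * std_normal_density (s * \<xi>))"
    unfolding ft_std_normal_density of_real_mult[symmetric]
    by (rule arg_cong[where f = of_real])
      (simp add: std_normal_density_def power_mult_distrib real_sqrt_mult field_simps)
  finally show ?thesis .
qed

text \<open>The multiplication formula moves the transform from \<open>f\<close> to the modulated
  Gaussian, whose transform is a narrow Gaussian centred at \<open>x\<close>. Substituting
  \<open>x + u / s\<close> for the variable leaves an average of \<open>f\<close> under the normal
  law.\<close>

lemma ft_regularized_inversion:
  fixes f :: "real \<Rightarrow> complex"
  assumes f: "integrable lborel f" and s: "s > 0"
  shows "(LINT \<xi>|lborel. ft f \<xi> * (of_real (gauss s \<xi>) * cis (\<xi> * x)))
       = of_real (2 * pi) * (LINT u|lborel. f (x + u / s) * of_real (std_normal_density u))"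
proof -
  have g: "integrable lborel (\<lambda>\<xi>. complex_of_real (gauss s \<xi>) * cis (x * \<xi>))"
    using integrable_cis_mult[of "\<lambda>x. complex_of_real (gauss s x)" "\<lambda>\<xi>. x * \<xi>"] integrable_gauss[OF s]
    by (simp add: mult.commute)
  have "(LINT \<xi>|lborel. ft f \<xi> * (of_real (gauss s \<xi>) * cis (x * \<xi>)))
      = (LINT y|lborel. f y * of_real (2 * pi * s * std_normal_density (s * (y - x))))"
    unfolding ft_multiplication[OF f g] ft_cis_mult ft_gauss[OF s] ..
  also have "\<dots> = (1 / s) *\<^sub>R (LINT u|lborel. f (x + u / s) * of_real (2 * pi * s * std_normal_density u))"
    using s by (subst lborel_integral_real_affine[where c="1/s" and t=x]) (auto simp: field_simps)
  also have "\<dots> = (LINT u|lborel. of_real (2 * pi) * (f (x + u / s) * of_real (std_normal_density u)))"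
    using s unfolding integral_scaleR_right[symmetric]
    by (intro Bochner_Integration.integral_cong refl) (simp add: scaleR_conv_of_real)
  also have "\<dots> = of_real (2 * pi) * (LINT u|lborel. f (x + u / s) * of_real (std_normal_density u))"
    by (rule integral_mult_right_zero)
  finally show ?thesis by (simp add: mult.commute)
qed

section \<open>Plancherel's identity and Fourier inversion\<close>

lemma gauss_le_1: "gauss s \<xi> \<le> 1" and gauss_nonneg: "0 \<le> gauss s \<xi>"
  by (auto simp: gauss_def)

text \<open>Damping by a Gaussian turns the energy of the transform into an autocorrelation of \<open>f\<close>;
  letting the Gaussian tend to 1 gives the two halves of Plancherel's identity.\<close>

lemma ft_regularized_energy:
  fixes f :: "real \<Rightarrow> complex"
  assumes f: "integrable lborel f" and s: "s > 0"
  shows "(LINT \<xi>|lborel. of_real ((norm (ft f \<xi>))\<^sup>2 * gauss s \<xi>))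
      = of_real (2 * pi) * (LINT x|lborel. f x * cnj (LINT u|lborel. f (x + u / s) * of_real (std_normal_density u)))"
proof -
  define B where "B = (LINT x|lborel. norm (f x))"
  have [measurable]: "f \<in> borel_measurable borel" using f by auto
  have g: "integrable lborel (\<lambda>\<xi>. cnj (ft f \<xi>) * of_real (gauss s \<xi>))"
  proof (rule Bochner_Integration.integrable_bound)
    show "integrable lborel (\<lambda>\<xi>. B * gauss s \<xi>)" using integrable_gauss[OF s] by simp
    show "AE x in lborel. norm (cnj (ft f x) * complex_of_real (gauss s x)) \<le> norm (B * gauss s x)"
      using norm_ft_le[of f] unfolding B_def
      by (auto simp: norm_mult abs_mult gauss_nonneg intro!: mult_right_mono order_trans[OF _ abs_ge_self])
  qed measurable
  have "(LINT \<xi>|lborel. of_real ((norm (ft f \<xi>))\<^sup>2 * gauss s \<xi>))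
     = (LINT \<xi>|lborel. ft f \<xi> * (cnj (ft f \<xi>) * of_real (gauss s \<xi>)))"
    by (simp only: of_real_mult complex_norm_square mult.assoc)
  also have "\<dots> = (LINT x|lborel. f x * ft (\<lambda>\<xi>. cnj (ft f \<xi>) * of_real (gauss s \<xi>)) x)"
    by (rule ft_multiplication[OF f g])
  also have "\<dots> = (LINT x|lborel. f x * cnj (LINT \<xi>|lborel. ft f \<xi> * (of_real (gauss s \<xi>) * cis (\<xi> * x))))"
  proof -
    have "ft (\<lambda>\<xi>. cnj (ft f \<xi>) * of_real (gauss s \<xi>)) x
      = (LINT \<xi>|lborel. cnj (ft f \<xi> * (of_real (gauss s \<xi>) * cis (\<xi> * x))))" for x
      unfolding ft_def[of "\<lambda>\<xi>. cnj (ft f \<xi>) * of_real (gauss s \<xi>)"] by (simp add: cis_cnj mult_ac)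
    then show ?thesis by (simp only: Bochner_Integration.integral_cnj)
  qed
  also have "\<dots> = (LINT x|lborel. of_real (2 * pi) * (f x * cnj (LINT u|lborel. f (x + u / s) * of_real (std_normal_density u))))"
    unfolding ft_regularized_inversion[OF f s] by (simp add: mult_ac)
  also have "\<dots> = of_real (2 * pi) * (LINT x|lborel. f x * cnj (LINT u|lborel. f (x + u / s) * of_real (std_normal_density u)))"
    by (rule integral_mult_right_zero)
  finally show ?thesis .
qed

text \<open>Holds also for non-integrable \<open>f\<close>, whose Bochner integral is 0.\<close>

lemma ennreal_norm_integral_le:
  fixes f :: "'a \<Rightarrow> 'b::{banach, second_countable_topology}"
  shows "ennreal (norm (integral\<^sup>L M f)) \<le> (\<integral>\<^sup>+x. ennreal (norm (f x)) \<partial>M)"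
proof (cases "integrable M f")
  case True then show ?thesis by (rule integral_norm_bound_ennreal)
next
  case False then show ?thesis by (simp add: not_integrable_integral_eq)
qed

lemma nn_integral_std_normal: "(\<integral>\<^sup>+u. ennreal (std_normal_density u) \<partial>lborel) = 1"
  by (subst nn_integral_eq_integral[OF integrable_std_normal]) (auto simp: integral_std_normal)

lemma integrable_ft_gauss:
  assumes f: "integrable lborel f" and s: "s > 0"
  shows "integrable lborel (\<lambda>\<xi>. (norm (ft f \<xi>))\<^sup>2 * gauss s \<xi>)"
proof (rule Bochner_Integration.integrable_bound)
  define B where "B = (LINT x|lborel. norm (f x))"
  have [measurable]: "f \<in> borel_measurable borel" using f by auto
  show "integrable lborel (\<lambda>\<xi>. B\<^sup>2 * gauss s \<xi>)" using integrable_gauss[OF s] by simp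
  show "AE x in lborel. norm ((norm (ft f x))\<^sup>2 * gauss s x) \<le> norm (B\<^sup>2 * gauss s x)"
    using norm_ft_le[of f] unfolding B_def
    by (auto simp: norm_mult abs_mult gauss_nonneg intro!: mult_right_mono power_mono)
  show "(\<lambda>\<xi>. (norm (ft f \<xi>))\<^sup>2 * gauss s \<xi>) \<in> borel_measurable lborel" by measurable
qed

text \<open>The inner integral averages translates of \<open>f\<close>. After the integrals are
  exchanged, a b <= (a^2 + b^2) / 2 and translation invariance give the same bound for every
  translate. The extended integral lets this bound be infinite, as \<open>f\<close> is not assumed
  square-integrable.\<close>

lemma nn_integral_autocorrelation_le:
  fixes f :: "real \<Rightarrow> complex"
  assumes [measurable]: "f \<in> borel_measurable borel" and s: "s > 0"
  shows "(\<integral>\<^sup>+x. ennreal (norm (f x * cnj (LINT u|lborel. f (x + u / s) * of_real (std_normal_density u)))) \<partial>lborel)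
    \<le> (\<integral>\<^sup>+x. ennreal ((norm (f x))\<^sup>2) \<partial>lborel)"
proof -
  let ?F = "\<integral>\<^sup>+x. ennreal ((norm (f x))\<^sup>2) \<partial>lborel"
  let ?\<phi> = std_normal_density
  have shift: "(\<integral>\<^sup>+x. ennreal ((norm (f (x + a)))\<^sup>2) \<partial>lborel) = ?F" for a
    using nn_integral_real_affine[of "\<lambda>x. ennreal ((norm (f x))\<^sup>2)" 1 a] by (simp add: add.commute)
  have "(\<integral>\<^sup>+x. ennreal (norm (f x * cnj (LINT u|lborel. f (x + u / s) * of_real (?\<phi> u)))) \<partial>lborel)
    \<le> (\<integral>\<^sup>+x. (\<integral>\<^sup>+u. ennreal (?\<phi> u) * ennreal (norm (f x) * norm (f (x + u / s))) \<partial>lborel) \<partial>lborel)"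
  proof (rule nn_integral_mono)
    fix x
    have "ennreal (norm (f x * cnj (LINT u|lborel. f (x + u / s) * of_real (?\<phi> u))))
      = ennreal (norm (f x)) * ennreal (norm (LINT u|lborel. f (x + u / s) * of_real (?\<phi> u)))"
      by (simp add: norm_mult ennreal_mult)
    also have "\<dots> \<le> ennreal (norm (f x)) * (\<integral>\<^sup>+u. ennreal (norm (f (x + u / s) * of_real (?\<phi> u))) \<partial>lborel)"
      by (intro mult_left_mono ennreal_norm_integral_le) auto
    also have "\<dots> = (\<integral>\<^sup>+u. ennreal (norm (f x)) * ennreal (norm (f (x + u / s) * of_real (?\<phi> u))) \<partial>lborel)"
      by (rule nn_integral_cmult[symmetric]) measurable
    also have "\<dots> = (\<integral>\<^sup>+u. ennreal (?\<phi> u) * ennreal (norm (f x) * norm (f (x + u / s))) \<partial>lborel)"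
    proof (rule nn_integral_cong)
      fix u
      have "norm (f (x + u / s) * of_real (?\<phi> u)) = norm (f (x + u / s)) * ?\<phi> u"
        by (simp add: norm_mult)
      then show "ennreal (norm (f x)) * ennreal (norm (f (x + u / s) * of_real (?\<phi> u)))
          = ennreal (?\<phi> u) * ennreal (norm (f x) * norm (f (x + u / s)))"
        by (simp add: ennreal_mult mult.assoc mult.commute mult.left_commute)
    qed
    finally show "ennreal (norm (f x * cnj (LINT u|lborel. f (x + u / s) * of_real (?\<phi> u)))) \<le> \<dots>" .
  qed
  also have "\<dots> = (\<integral>\<^sup>+u. (\<integral>\<^sup>+x. ennreal (?\<phi> u) * ennreal (norm (f x) * norm (f (x + u / s))) \<partial>lborel) \<partial>lborel)"
    by (rule lborel_pair.Fubini') measurable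
  also have "\<dots> \<le> (\<integral>\<^sup>+u. ennreal (?\<phi> u) * ?F \<partial>lborel)"
  proof (rule nn_integral_mono)
    fix u
    have "(\<integral>\<^sup>+x. ennreal (norm (f x) * norm (f (x + u / s))) \<partial>lborel)
       \<le> (\<integral>\<^sup>+x. ennreal (1/2) * (ennreal ((norm (f x))\<^sup>2) + ennreal ((norm (f (x + u / s)))\<^sup>2)) \<partial>lborel)"
    proof (rule nn_integral_mono)
      fix x
      have "0 \<le> (norm (f x) - norm (f (x + u / s)))\<^sup>2" by simp
      then have "norm (f x) * norm (f (x + u / s)) \<le> 1/2 * ((norm (f x))\<^sup>2 + (norm (f (x + u / s)))\<^sup>2)"
        unfolding power2_diff by simp
      then show "ennreal (norm (f x) * norm (f (x + u / s)))
          \<le> ennreal (1/2) * (ennreal ((norm (f x))\<^sup>2) + ennreal ((norm (f (x + u / s)))\<^sup>2))"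
        unfolding ennreal_plus[symmetric, OF zero_le_power2 zero_le_power2]
        by (subst ennreal_mult[symmetric]) (auto intro!: ennreal_leI)
    qed
    also have "\<dots> = ennreal (1/2) * (?F + ?F)"
      by (subst nn_integral_cmult, measurable, subst nn_integral_add) (auto simp: shift)
    also have "\<dots> = ?F"
    proof -
      have "ennreal (1/2) * (?F + ?F) = ennreal (1/2) * ennreal 2 * ?F"
        by (simp add: mult_2[symmetric] mult.assoc)
      also have "ennreal (1/2) * ennreal 2 = 1"
        by (subst ennreal_mult[symmetric]) auto
      finally show ?thesis by simp
    qed
    finally show "(\<integral>\<^sup>+x. ennreal (?\<phi> u) * ennreal (norm (f x) * norm (f (x + u / s))) \<partial>lborel)
      \<le> ennreal (?\<phi> u) * ?F"
      by (subst nn_integral_cmult) (auto intro: mult_left_mono)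
  qed
  also have "\<dots> = ?F"
    by (subst nn_integral_multc) (auto simp: nn_integral_std_normal)
  finally show ?thesis .
qed

lemma gauss_tendsto_1: "(\<lambda>n. gauss (real (Suc n)) \<xi>) \<longlonglongrightarrow> 1"
proof -
  have "(\<lambda>n. exp (- (\<xi> * inverse (real (Suc n)))\<^sup>2 / 2)) \<longlonglongrightarrow> exp (- (\<xi> * 0)\<^sup>2 / 2)"
    by (intro tendsto_exp tendsto_divide tendsto_minus tendsto_power tendsto_mult tendsto_const
        LIMSEQ_inverse_real_of_nat) simp
  then show ?thesis unfolding gauss_def divide_inverse[of \<xi>] by simp
qed

text \<open>Fatou's lemma along Gaussians of growing width. This half uses a bound on the
  autocorrelations and not their limit, so it covers every integrable \<open>f\<close>, with an
  infinite right-hand side allowed.\<close>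

lemma plancherel_le:
  assumes f: "integrable lborel f"
  shows "(\<integral>\<^sup>+\<xi>. ennreal ((norm (ft f \<xi>))\<^sup>2) \<partial>lborel)
    \<le> ennreal (2 * pi) * (\<integral>\<^sup>+x. ennreal ((norm (f x))\<^sup>2) \<partial>lborel)"
proof -
  have [measurable]: "f \<in> borel_measurable borel" using f by auto
  let ?C = "ennreal (2 * pi) * (\<integral>\<^sup>+x. ennreal ((norm (f x))\<^sup>2) \<partial>lborel)"
  have le: "(\<integral>\<^sup>+\<xi>. ennreal ((norm (ft f \<xi>))\<^sup>2 * gauss s \<xi>) \<partial>lborel) \<le> ?C" if s: "s > 0" for s
  proof -
    have "(\<integral>\<^sup>+\<xi>. ennreal ((norm (ft f \<xi>))\<^sup>2 * gauss s \<xi>) \<partial>lborel)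
      = ennreal (LINT \<xi>|lborel. (norm (ft f \<xi>))\<^sup>2 * gauss s \<xi>)"
      using integrable_ft_gauss[OF f s] by (rule nn_integral_eq_integral) (auto simp: gauss_nonneg)
    also have "(LINT \<xi>|lborel. (norm (ft f \<xi>))\<^sup>2 * gauss s \<xi>)
       = norm (complex_of_real (LINT \<xi>|lborel. (norm (ft f \<xi>))\<^sup>2 * gauss s \<xi>))"
      unfolding norm_of_real by (intro abs_of_nonneg[symmetric] integral_nonneg) (auto simp: gauss_nonneg)
    also have "\<dots> = 2 * pi * norm (LINT x|lborel. f x * cnj (LINT u|lborel. f (x + u / s) * of_real (std_normal_density u)))"
      unfolding integral_complex_of_real[symmetric] ft_regularized_energy[OF f s]
      by (simp only: norm_mult norm_of_real) simp
    also have "ennreal \<dots> \<le> ?C"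
    proof (subst ennreal_mult)
      show "ennreal (2 * pi) * ennreal (norm (LINT x|lborel. f x * cnj (LINT u|lborel. f (x + u / s) * of_real (std_normal_density u)))) \<le> ?C"
        by (rule mult_left_mono[OF order_trans[OF ennreal_norm_integral_le nn_integral_autocorrelation_le[OF _ s]]]) simp_all
    qed simp_all
    finally show ?thesis .
  qed
  have "(\<integral>\<^sup>+\<xi>. ennreal ((norm (ft f \<xi>))\<^sup>2) \<partial>lborel)
      = (\<integral>\<^sup>+\<xi>. liminf (\<lambda>n. ennreal ((norm (ft f \<xi>))\<^sup>2 * gauss (real (Suc n)) \<xi>)) \<partial>lborel)"
  proof (rule nn_integral_cong)
    fix \<xi>
    have "(\<lambda>n. ennreal ((norm (ft f \<xi>))\<^sup>2 * gauss (real (Suc n)) \<xi>)) \<longlonglongrightarrow> ennreal ((norm (ft f \<xi>))\<^sup>2 * 1)"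
      by (intro tendsto_ennrealI tendsto_intros gauss_tendsto_1)
    then show "ennreal ((norm (ft f \<xi>))\<^sup>2) = liminf (\<lambda>n. ennreal ((norm (ft f \<xi>))\<^sup>2 * gauss (real (Suc n)) \<xi>))"
      by (intro lim_imp_Liminf[symmetric]) auto
  qed
  also have "\<dots> \<le> liminf (\<lambda>n. \<integral>\<^sup>+\<xi>. ennreal ((norm (ft f \<xi>))\<^sup>2 * gauss (real (Suc n)) \<xi>) \<partial>lborel)"
    by (rule nn_integral_liminf) measurable
  also have "\<dots> \<le> ?C"
  proof -
    have "liminf (\<lambda>n. \<integral>\<^sup>+\<xi>. ennreal ((norm (ft f \<xi>))\<^sup>2 * gauss (real (Suc n)) \<xi>) \<partial>lborel) \<le> liminf (\<lambda>n::nat. ?C)"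
      by (intro Liminf_mono always_eventually allI le) simp
    then show ?thesis by (simp add: Liminf_const)
  qed
  finally show ?thesis .
qed

text \<open>Continuity gives convergence under the integral, and boundedness gives the dominating
  function.\<close>

lemma gaussian_average_tendsto:
  fixes f :: "real \<Rightarrow> complex"
  assumes c: "continuous_on UNIV f" and B: "\<And>x. norm (f x) \<le> B"
  shows "(\<lambda>n. LINT u|lborel. f (x + u / real (Suc n)) * of_real (std_normal_density u)) \<longlonglongrightarrow> f x"
proof -
  have [measurable]: "f \<in> borel_measurable borel" by (rule borel_measurable_continuous_onI[OF c])
  have "(\<lambda>n. LINT u|lborel. f (x + u / real (Suc n)) * of_real (std_normal_density u))
     \<longlonglongrightarrow> (LINT u|lborel. f x * of_real (std_normal_density u))"
  proof (rule integral_dominated_convergence[where w = "\<lambda>u. B * std_normal_density u"])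
    show "integrable lborel (\<lambda>u. B * std_normal_density u)" using integrable_std_normal by simp
    show "AE u in lborel. (\<lambda>n. f (x + u / real (Suc n)) * of_real (std_normal_density u))
        \<longlonglongrightarrow> f x * of_real (std_normal_density u)"
    proof (intro AE_I2 tendsto_intros)
      fix u
      have "(\<lambda>n. x + u * inverse (real (Suc n))) \<longlonglongrightarrow> x + u * 0"
        by (intro tendsto_intros LIMSEQ_inverse_real_of_nat)
      then show "(\<lambda>n. f (x + u / real (Suc n))) \<longlonglongrightarrow> f x"
        using c by (intro continuous_on_tendsto_compose[OF c]) (auto simp: divide_inverse)
    qed
    show "AE u in lborel. norm (f (x + u / real (Suc n)) * of_real (std_normal_density u)) \<le> B * std_normal_density u" for n
      using B by (intro AE_I2) (auto simp: norm_mult intro!: mult_right_mono)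
  qed measurable
  also have "(LINT u|lborel. f x * of_real (std_normal_density u)) = f x"
    by (simp add: integral_std_normal)
  finally show ?thesis .
qed

text \<open>The reverse half requires the autocorrelations to converge to the energy; continuity and
  boundedness of \<open>f\<close> give this by dominated convergence. It will be applied to
  solutions cut off in time, which have both properties.\<close>

lemma plancherel_ge:
  fixes f :: "real \<Rightarrow> complex"
  assumes f: "integrable lborel f" and c: "continuous_on UNIV f" and B: "\<And>x. norm (f x) \<le> B"
  shows "ennreal (2 * pi) * (\<integral>\<^sup>+x. ennreal ((norm (f x))\<^sup>2) \<partial>lborel)
     \<le> (\<integral>\<^sup>+\<xi>. ennreal ((norm (ft f \<xi>))\<^sup>2) \<partial>lborel)"
proof -
  have [measurable]: "f \<in> borel_measurable borel" using f by auto
  have B0: "0 \<le> B" using B[of 0] norm_ge_zero order_trans by blast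
  let ?a = "\<lambda>n. LINT \<xi>|lborel. (norm (ft f \<xi>))\<^sup>2 * gauss (real (Suc n)) \<xi>"
  let ?h = "\<lambda>n x. LINT u|lborel. f (x + u / real (Suc n)) * of_real (std_normal_density u)"
  have hb: "norm (?h n x) \<le> B" for n x
  proof -
    have "norm (?h n x) \<le> (LINT u|lborel. B * std_normal_density u)"
    proof (rule order_trans[OF integral_norm_bound integral_mono])
      show int: "integrable lborel (\<lambda>u. B * std_normal_density u)" using integrable_std_normal by simp
      show le: "norm (f (x + u / real (Suc n)) * of_real (std_normal_density u)) \<le> B * std_normal_density u" for u
        using B by (auto simp: norm_mult intro!: mult_right_mono simp del: of_nat_Suc)
      show "integrable lborel (\<lambda>u. norm (f (x + u / real (Suc n)) * of_real (std_normal_density u)))"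
      proof (rule integrable_norm, rule Bochner_Integration.integrable_bound[OF int])
        show "AE u in lborel. norm (f (x + u / real (Suc n)) * of_real (std_normal_density u)) \<le> norm (B * std_normal_density u)"
          using order_trans[OF le abs_ge_self] by auto
      qed measurable
    qed
    then show ?thesis by (simp add: integral_std_normal)
  qed
  have int2: "integrable lborel (\<lambda>x. (norm (f x))\<^sup>2)"
  proof (rule Bochner_Integration.integrable_bound)
    show "integrable lborel (\<lambda>x. B * norm (f x))" using f by simp
    show "AE x in lborel. norm ((norm (f x))\<^sup>2) \<le> norm (B * norm (f x))"
      using B B0 by (auto simp: power2_eq_square intro!: mult_right_mono)
  qed measurable
  have eq: "of_real (2 * pi) * (LINT x|lborel. f x * cnj (?h n x)) = complex_of_real (?a n)" for n
    using ft_regularized_energy[OF f, of "real (Suc n)"] by (simp only: integral_complex_of_real)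
  have eq2: "of_real (2 * pi) * (LINT x|lborel. f x * cnj (f x))
      = complex_of_real (2 * pi * (LINT x|lborel. (norm (f x))\<^sup>2))"
    by (simp only: of_real_mult integral_complex_of_real[symmetric] complex_norm_square)
  have "(\<lambda>n. LINT x|lborel. f x * cnj (?h n x)) \<longlonglongrightarrow> (LINT x|lborel. f x * cnj (f x))"
  proof (rule integral_dominated_convergence[where w = "\<lambda>x. norm (f x) * B"])
    show "integrable lborel (\<lambda>x. norm (f x) * B)" using f by simp
    show "AE x in lborel. (\<lambda>n. f x * cnj (?h n x)) \<longlonglongrightarrow> f x * cnj (f x)"
      by (intro AE_I2 tendsto_intros gaussian_average_tendsto[OF c B])
    show "AE x in lborel. norm (f x * cnj (?h n x)) \<le> norm (f x) * B" for n
      using hb by (intro AE_I2) (auto simp: norm_mult intro!: mult_left_mono simp del: of_nat_Suc)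
  qed measurable
  then have "(\<lambda>n. of_real (2 * pi) * (LINT x|lborel. f x * cnj (?h n x)))
      \<longlonglongrightarrow> of_real (2 * pi) * (LINT x|lborel. f x * cnj (f x))"
    by (intro tendsto_intros)
  then have "(\<lambda>n. complex_of_real (?a n)) \<longlonglongrightarrow> complex_of_real (2 * pi * (LINT x|lborel. (norm (f x))\<^sup>2))"
    unfolding eq eq2 .
  then have "?a \<longlonglongrightarrow> 2 * pi * (LINT x|lborel. (norm (f x))\<^sup>2)"
    by (simp only: tendsto_of_real_iff)
  then have lim: "(\<lambda>n. ennreal (?a n)) \<longlonglongrightarrow> ennreal (2 * pi * (LINT x|lborel. (norm (f x))\<^sup>2))"
    by (rule tendsto_ennrealI)
  have "ennreal (2 * pi * (LINT x|lborel. (norm (f x))\<^sup>2)) \<le> (\<integral>\<^sup>+\<xi>. ennreal ((norm (ft f \<xi>))\<^sup>2) \<partial>lborel)"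
  proof (rule LIMSEQ_le_const2[OF lim], intro exI allI impI)
    fix n :: nat
    have "ennreal (?a n) = (\<integral>\<^sup>+\<xi>. ennreal ((norm (ft f \<xi>))\<^sup>2 * gauss (real (Suc n)) \<xi>) \<partial>lborel)"
      using integrable_ft_gauss[OF f, of "real (Suc n)"]
      by (intro nn_integral_eq_integral[symmetric]) (auto simp: gauss_nonneg)
    also have "\<dots> \<le> (\<integral>\<^sup>+\<xi>. ennreal ((norm (ft f \<xi>))\<^sup>2) \<partial>lborel)"
      by (intro nn_integral_mono ennreal_leI mult_left_le gauss_le_1) auto
    finally show "ennreal (?a n) \<le> (\<integral>\<^sup>+\<xi>. ennreal ((norm (ft f \<xi>))\<^sup>2) \<partial>lborel)" .
  qed
  then show ?thesis
    by (subst nn_integral_eq_integral[OF int2]) (auto simp: ennreal_mult)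
qed

text \<open>Two limits of the damped integral \<open>?r\<close> are compared: by dominated
  convergence it tends to the undamped inversion integral, and as a Gaussian average it tends to a
  multiple of \<open>f x\<close>.\<close>

lemma fourier_inversion:
  fixes f :: "real \<Rightarrow> complex"
  assumes f: "integrable lborel f" and c: "continuous_on UNIV f" and B: "\<And>x. norm (f x) \<le> B"
    and ff: "integrable lborel (ft f)"
  shows "ft (ft f) (- x) = of_real (2 * pi) * f x"
proof (rule LIMSEQ_unique)
  have [measurable]: "f \<in> borel_measurable borel" using f by auto
  let ?r = "\<lambda>n. LINT \<xi>|lborel. ft f \<xi> * (of_real (gauss (real (Suc n)) \<xi>) * cis (\<xi> * x))"
  have eq: "of_real (2 * pi) * (LINT u|lborel. f (x + u / real (Suc n)) * of_real (std_normal_density u)) = ?r n" for n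
    by (rule ft_regularized_inversion[OF f, symmetric]) simp
  have "?r \<longlonglongrightarrow> (LINT \<xi>|lborel. ft f \<xi> * (of_real 1 * cis (\<xi> * x)))"
  proof (rule integral_dominated_convergence[where w = "\<lambda>\<xi>. norm (ft f \<xi>)"])
    show "integrable lborel (\<lambda>\<xi>. norm (ft f \<xi>))" using ff by simp
    show "AE \<xi> in lborel. (\<lambda>n. ft f \<xi> * (of_real (gauss (real (Suc n)) \<xi>) * cis (\<xi> * x)))
        \<longlonglongrightarrow> ft f \<xi> * (of_real 1 * cis (\<xi> * x))"
      by (intro AE_I2 tendsto_intros gauss_tendsto_1)
    show "AE \<xi> in lborel. norm (ft f \<xi> * (of_real (gauss (real (Suc n)) \<xi>) * cis (\<xi> * x))) \<le> norm (ft f \<xi>)" for n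
      by (intro AE_I2) (auto simp: norm_mult abs_of_nonneg gauss_nonneg intro!: mult_left_le gauss_le_1 simp del: of_nat_Suc)
  qed measurable
  then show "?r \<longlonglongrightarrow> ft (ft f) (- x)"
    unfolding ft_def[of "ft f"] by (simp add: mult.commute)
  have "(\<lambda>n. of_real (2 * pi) * (LINT u|lborel. f (x + u / real (Suc n)) * of_real (std_normal_density u)))
      \<longlonglongrightarrow> of_real (2 * pi) * f x"
    by (intro tendsto_intros gaussian_average_tendsto[OF c B])
  then show "?r \<longlonglongrightarrow> of_real (2 * pi) * f x"
    unfolding eq .
qed

section \<open>Test functions and weak derivatives\<close>

definition smooth :: "(real \<Rightarrow> real) \<Rightarrow> bool" where
  "smooth p \<longleftrightarrow> (\<forall>k x. ((deriv ^^ k) p) field_differentiable (at x))"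

lemma test_function_iff: "test_function p \<longleftrightarrow> smooth p \<and> (\<exists>R. \<forall>x. \<bar>x\<bar> > R \<longrightarrow> p x = 0)"
  by (simp add: test_function_def smooth_def)

lemma smooth_has_field_derivative:
  "smooth p \<Longrightarrow> ((deriv ^^ k) p has_field_derivative (deriv ^^ Suc k) p x) (at x)"
  by (simp add: smooth_def DERIV_deriv_iff_field_differentiable)

text \<open>\<open>deriv\<close> has a meaningful value only at points of differentiability, so the
  formula for the derivatives and smoothness have to be proved together. Guessing all derivatives at
  once, as a sequence in which each member differentiates to the next, achieves this.\<close>

lemma deriv_family:
  fixes F :: "nat \<Rightarrow> real \<Rightarrow> real"
  assumes "\<And>k x. (F k has_field_derivative F (Suc k) x) (at x)"
  shows "(deriv ^^ k) (F 0) = F k" and "smooth (F 0)"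
proof -
  show *: "(deriv ^^ k) (F 0) = F k" for k
    by (induction k) (use assms in \<open>auto intro!: ext DERIV_imp_deriv\<close>)
  show "smooth (F 0)"
    unfolding smooth_def * using assms by (auto simp: field_differentiable_def)
qed

text \<open>Pascal's rule, in the form of the step from one Leibniz sum to the next.\<close>

lemma Leibniz_sum:
  fixes a b :: "nat \<Rightarrow> real"
  shows "(\<Sum>i\<le>k. of_nat (k choose i) * (a (Suc i) * b (k - i) + a i * b (Suc (k - i))))
    = (\<Sum>i\<le>Suc k. of_nat (Suc k choose i) * (a i * b (Suc k - i)))"
proof -
  have "(\<Sum>i\<le>Suc k. of_nat (Suc k choose i) * (a i * b (Suc k - i)))
     = a 0 * b (Suc k) + (\<Sum>i\<le>k. of_nat (k choose i) * (a (Suc i) * b (k - i)))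
       + (\<Sum>i\<le>k. of_nat (k choose Suc i) * (a (Suc i) * b (Suc k - Suc i)))"
    by (subst sum.atMost_Suc_shift) (simp add: algebra_simps sum.distrib)
  also have "a 0 * b (Suc k) + (\<Sum>i\<le>k. of_nat (k choose i) * (a (Suc i) * b (k - i)))
       + (\<Sum>i\<le>k. of_nat (k choose Suc i) * (a (Suc i) * b (Suc k - Suc i)))
     = (\<Sum>i\<le>k. of_nat (k choose i) * (a (Suc i) * b (k - i)))
       + (\<Sum>i\<le>Suc k. of_nat (k choose i) * (a i * b (Suc k - i)))"
    by (subst sum.atMost_Suc_shift) simp
  also have "(\<Sum>i\<le>Suc k. of_nat (k choose i) * (a i * b (Suc k - i)))
     = (\<Sum>i\<le>k. of_nat (k choose i) * (a i * b (Suc (k - i))))"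
    by (simp add: Suc_diff_le)
  finally show ?thesis by (simp add: algebra_simps sum.distrib)
qed

lemma
  assumes f: "smooth f" and g: "smooth g"
  shows higher_deriv_mult_real: "(deriv ^^ k) (\<lambda>x. f x * g x)
      = (\<lambda>x. \<Sum>i\<le>k. of_nat (k choose i) * ((deriv ^^ i) f x * (deriv ^^ (k - i)) g x))"
    and smooth_mult: "smooth (\<lambda>x. f x * g x)"
proof -
  define F where "F k x = (\<Sum>i\<le>k. of_nat (k choose i) * ((deriv ^^ i) f x * (deriv ^^ (k - i)) g x))" for k x
  have F: "(F k has_field_derivative F (Suc k) x) (at x)" for k x
  proof -
    have "(F k has_field_derivative (\<Sum>i\<le>k. of_nat (k choose i) * ((deriv ^^ Suc i) f x * (deriv ^^ (k - i)) g x
        + (deriv ^^ i) f x * (deriv ^^ Suc (k - i)) g x))) (at x)"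
      unfolding F_def
      by (rule DERIV_sum, rule DERIV_cmult, rule DERIV_cong[OF DERIV_mult])
        (auto intro!: smooth_has_field_derivative f g simp del: funpow.simps)
    then show ?thesis
      unfolding F_def Leibniz_sum[of k "\<lambda>i. (deriv ^^ i) f x" "\<lambda>i. (deriv ^^ i) g x"] .
  qed
  have F0: "F 0 = (\<lambda>x. f x * g x)" by (simp add: F_def fun_eq_iff)
  show "(deriv ^^ k) (\<lambda>x. f x * g x)
      = (\<lambda>x. \<Sum>i\<le>k. of_nat (k choose i) * ((deriv ^^ i) f x * (deriv ^^ (k - i)) g x))"
    using deriv_family(1)[of F k, OF F] unfolding F0 by (simp add: F_def fun_eq_iff)
  show "smooth (\<lambda>x. f x * g x)"
    using deriv_family(2)[of F, OF F] unfolding F0 .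
qed

lemma
  assumes f: "smooth f"
  shows higher_deriv_affine: "(deriv ^^ k) (\<lambda>x. f (a * x + b)) = (\<lambda>x. a ^ k * (deriv ^^ k) f (a * x + b))"
    and smooth_affine: "smooth (\<lambda>x. f (a * x + b))"
proof -
  define F where "F k x = a ^ k * (deriv ^^ k) f (a * x + b)" for k x
  have F: "(F k has_field_derivative F (Suc k) x) (at x)" for k x
    unfolding F_def
    by (rule DERIV_cong[OF DERIV_cmult[OF DERIV_chain2[OF smooth_has_field_derivative[OF f]]]])
      (auto intro!: derivative_eq_intros simp del: funpow.simps)
  have F0: "F 0 = (\<lambda>x. f (a * x + b))" by (simp add: F_def fun_eq_iff)
  show "(deriv ^^ k) (\<lambda>x. f (a * x + b)) = (\<lambda>x. a ^ k * (deriv ^^ k) f (a * x + b))"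
    using deriv_family(1)[of F k, OF F] unfolding F0 by (simp add: F_def fun_eq_iff)
  show "smooth (\<lambda>x. f (a * x + b))"
    using deriv_family(2)[of F, OF F] unfolding F0 .
qed

text \<open>Differentiation multiplies by \<open>a\<close> and advances the phase by
  \<open>pi / 2\<close>, so the family is closed under it, and the pair of phases 0 and
  \<open>pi / 2\<close> still encodes a complex exponential after any number of derivatives.\<close>

lemma
  shows higher_deriv_cos: "(deriv ^^ k) (\<lambda>x. cos (a * x + c)) = (\<lambda>x. a ^ k * cos (a * x + c + k * (pi / 2)))"
    and smooth_cos: "smooth (\<lambda>x. cos (a * x + c))"
proof -
  define F where "F k x = a ^ k * cos (a * x + c + real k * (pi / 2))" for k x
  have F: "(F k has_field_derivative F (Suc k) x) (at x)" for k x
  proof -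
    have "cos (a * x + c + real (Suc k) * (pi / 2)) = cos ((a * x + c + real k * (pi / 2)) + pi / 2)"
      by (rule arg_cong[where f = cos]) (simp add: field_simps)
    also have "\<dots> = - sin (a * x + c + real k * (pi / 2))"
      by (simp only: cos_add) simp
    finally show ?thesis
      unfolding F_def by (auto intro!: derivative_eq_intros)
  qed
  have F0: "F 0 = (\<lambda>x. cos (a * x + c))" by (simp add: F_def fun_eq_iff)
  show "(deriv ^^ k) (\<lambda>x. cos (a * x + c)) = (\<lambda>x. a ^ k * cos (a * x + c + k * (pi / 2)))"
    using deriv_family(1)[of F k, OF F] unfolding F0 by (simp add: F_def fun_eq_iff)
  show "smooth (\<lambda>x. cos (a * x + c))"
    using deriv_family(2)[of F, OF F] unfolding F0 .
qed

section \<open>A flat function\<close>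

lemma poly_exp_tendsto_0: "((\<lambda>s. poly P s * exp (- s)) \<longlongrightarrow> (0::real)) at_top"
proof -
  have "((\<lambda>s. \<Sum>i\<le>degree P. coeff P i * (s ^ i / exp s)) \<longlongrightarrow> (\<Sum>i\<le>degree P. coeff P i * 0)) at_top"
    by (intro tendsto_sum tendsto_mult tendsto_const tendsto_power_div_exp_0)
  moreover have "(\<lambda>s. poly P s * exp (- s)) = (\<lambda>s. \<Sum>i\<le>degree P. coeff P i * (s ^ i / exp s))"
    unfolding poly_altdef sum_distrib_right by (simp add: exp_minus divide_inverse mult_ac)
  ultimately show ?thesis by simp
qed

text \<open>The classical smooth function whose derivatives all vanish at the origin. A product of
  two copies, one of them reflected, is a bump with compact support.\<close>

definition flat :: "real \<Rightarrow> real" where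
  "flat x = (if x > 0 then exp (- (1 / x)) else 0)"

text \<open>Functions of the form P(1 / x) exp (- 1 / x) are closed under differentiation: the
  exponential contributes \<open>P\<close>, the polynomial contributes \<open>- pderiv P\<close>,
  and \<open>[:0, 0, 1:]\<close> is the factor 1 / x^2 of the chain rule.\<close>

lemma flat_poly_deriv:
  fixes P :: "real poly"
  shows "((\<lambda>x. if x > 0 then poly P (1 / x) * exp (- (1 / x)) else 0) has_field_derivative
     (if x > 0 then poly ([:0, 0, 1:] * (P - pderiv P)) (1 / x) * exp (- (1 / x)) else 0)) (at x)"
    (is "(?f has_field_derivative _) _")
proof (rule linorder_cases[of x 0])
  assume x: "x > 0"
  have "((\<lambda>x. poly P (1 / x) * exp (- (1 / x))) has_field_derivative
     poly ([:0, 0, 1:] * (P - pderiv P)) (1 / x) * exp (- (1 / x))) (at x)"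
    using x by (auto intro!: derivative_eq_intros DERIV_chain2[OF poly_DERIV]
        simp: field_simps power2_eq_square)
  then show ?thesis
    using x by (subst DERIV_cong_ev[OF refl _ refl]) (auto intro: eventually_mono[OF eventually_gt_at_top] 
        eventually_nhds_in_open[of "{0<..}", THEN eventually_mono])
next
  assume x: "x < 0"
  have "eventually (\<lambda>y. ?f y = 0) (nhds x)"
    using x eventually_nhds_in_open[of "{..<0}" x] by (auto elim!: eventually_mono)
  then show ?thesis
    using x by (subst DERIV_cong_ev[OF refl _ refl, of _ "\<lambda>_. 0"]) auto
next
  assume x: "x = 0"
  have "((\<lambda>h. ?f h / h) \<longlongrightarrow> 0) (at 0)"
  proof (rule filterlim_split_at)
    show "((\<lambda>h. ?f h / h) \<longlongrightarrow> 0) (at_left 0)"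
      by (rule tendsto_eventually) (auto simp: eventually_at_filter)
    \<comment> \<open>In the variable 1 / h, the division by \<open>h\<close> in the difference
      quotient multiplies the polynomial by its variable, hence \<open>[:0, 1:]\<close>.\<close>
    have "((\<lambda>h. poly ([:0, 1:] * P) (inverse h) * exp (- inverse h)) \<longlongrightarrow> 0) (at_right (0::real))"
      by (rule filterlim_compose[OF poly_exp_tendsto_0 filterlim_inverse_at_top_right])
    then show "((\<lambda>h. ?f h / h) \<longlongrightarrow> 0) (at_right 0)"
      by (rule Lim_transform_eventually)
        (auto simp: eventually_at_filter divide_inverse intro!: always_eventually)
  qed
  then show ?thesis
    unfolding DERIV_def x add_0_left by simp
qed

lemma smooth_flat: "smooth flat"
proof -
  define P where "P k = ((\<lambda>P. [:0, 0, 1:] * (P - pderiv P)) ^^ k) (1 :: real poly)" for k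
  define F where "F k x = (if x > 0 then poly (P k) (1 / x) * exp (- (1 / x)) else 0)" for k and x :: real
  have "(F k has_field_derivative F (Suc k) x) (at x)" for k x
    using flat_poly_deriv[of "P k" x] unfolding F_def P_def funpow.simps comp_def .
  then have "smooth (F 0)" by (rule deriv_family)
  also have "F 0 = flat" by (auto simp: F_def flat_def P_def)
  finally show ?thesis .
qed

lemma flat_nonneg: "0 \<le> flat x" and flat_le_1: "flat x \<le> 1"
  and flat_pos: "0 < x \<Longrightarrow> 0 < flat x" and flat_zero: "x \<le> 0 \<Longrightarrow> flat x = 0"
  by (auto simp: flat_def)

lemma flat_tendsto_1: "0 < x \<Longrightarrow> (\<lambda>n. flat (real (Suc n) * x)) \<longlonglongrightarrow> 1"
proof -
  assume x: "0 < x"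
  have "(\<lambda>n. exp (- (inverse (real (Suc n)) * (1 / x)))) \<longlonglongrightarrow> exp (- (0 * (1 / x)))"
    by (intro tendsto_exp tendsto_minus tendsto_mult tendsto_const LIMSEQ_inverse_real_of_nat)
  moreover have "flat (real (Suc n) * x) = exp (- (inverse (real (Suc n)) * (1 / x)))" for n
    using x by (simp add: flat_def field_simps del: of_nat_Suc)
  ultimately show ?thesis by simp
qed

section \<open>Test functions and their transforms\<close>

lemma test_function_deriv1:
  assumes "test_function p" shows "test_function (deriv p)"
proof -
  from assms obtain R where R: "\<And>x. \<bar>x\<bar> > R \<Longrightarrow> p x = 0" and s: "smooth p"
    by (auto simp: test_function_iff)
  have "deriv p x = 0" if "\<bar>x\<bar> > R" for x
  proof -
    have "open {x::real. R < \<bar>x\<bar>}" by (intro open_Collect_less continuous_intros)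
    then have "eventually (\<lambda>y. p y = 0) (nhds x)"
      using eventually_nhds_in_open[of "{x. \<bar>x\<bar> > R}" x] that R by (auto elim!: eventually_mono)
    then have "deriv p x = deriv (\<lambda>_. 0) x" by (intro deriv_cong_ev) auto
    then show ?thesis by simp
  qed
  moreover have "smooth (deriv p)"
    unfolding smooth_def
  proof (intro allI)
    fix k x show "(deriv ^^ k) (deriv p) field_differentiable at x"
      using s unfolding smooth_def by (metis funpow_Suc_right comp_apply)
  qed
  ultimately show ?thesis unfolding test_function_iff by blast
qed

lemma test_function_higher_deriv:
  assumes "test_function p" shows "test_function ((deriv ^^ k) p)"
proof (induction k)
  case (Suc k)
  then show ?case using test_function_deriv1[OF Suc.IH] by simp
qed (use assms in simp)

lemma smooth_continuous:
  assumes "smooth p" shows "continuous_on UNIV p"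
proof (rule DERIV_continuous_on)
  show "(p has_field_derivative deriv p x) (at x within UNIV)" for x
    using smooth_has_field_derivative[OF assms, of 0 x] by simp
qed

text \<open>Combines bounded values and compact support in one inequality, the form in which
  dominating functions are needed.\<close>

lemma test_function_bound:
  assumes "test_function p"
  obtains R B where "R > 0" "B > 0" "\<And>x. \<bar>p x\<bar> \<le> B * indicator {-R..R} x"
proof -
  from assms obtain R0 where R: "\<And>x. \<bar>x\<bar> > R0 \<Longrightarrow> p x = 0" and s: "smooth p"
    by (auto simp: test_function_iff)
  define R where "R = max R0 1"
  have "compact (p ` {-R..R})"
    by (intro compact_continuous_image continuous_on_subset[OF smooth_continuous[OF s]]) auto
  then have "bounded (p ` {-R..R})" by (rule compact_imp_bounded)
  then obtain B where B: "B > 0" "\<And>x. x \<in> {-R..R} \<Longrightarrow> \<bar>p x\<bar> \<le> B"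
    unfolding bounded_pos by auto
  have "\<bar>p x\<bar> \<le> B * indicator {-R..R} x" for x
    using B(2)[of x] R[of x] by (auto simp: indicator_def R_def)
  with B(1) show thesis by (intro that[of R B]) (auto simp: R_def)
qed

lemma test_function_measurable: "test_function p \<Longrightarrow> p \<in> borel_measurable borel"
  by (rule borel_measurable_continuous_onI[OF smooth_continuous]) (simp add: test_function_iff)

lemma integrable_indicator_Icc: "integrable lborel (indicator {a..b} :: real \<Rightarrow> real)"
  by (rule integrable_real_indicator) (auto simp: emeasure_lborel_Icc_eq)

lemma test_function_integrable: 
  assumes "test_function p" shows "integrable lborel p"
proof -
  obtain R B where B: "R > 0" "B > 0" "\<And>x. \<bar>p x\<bar> \<le> B * indicator {-R..R} x"
    by (rule test_function_bound[OF assms]) blast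
  show ?thesis
  proof (rule Bochner_Integration.integrable_bound)
    show "integrable lborel (\<lambda>x. B * indicator {-R..R} x)" by (simp add: integrable_indicator_Icc)
    show "p \<in> borel_measurable lborel" using test_function_measurable[OF assms] by simp
    show "AE x in lborel. norm (p x) \<le> norm (B * indicator {-R..R} x)"
      using B by (auto intro: order_trans[OF _ abs_ge_self])
  qed
qed

lemma integral_derivative_compact_support:
  fixes F :: "real \<Rightarrow> 'a::euclidean_space"
  assumes F: "\<And>x. (F has_vector_derivative F' x) (at x)" and c: "continuous_on UNIV F'"
    and z: "\<And>x. R < \<bar>x\<bar> \<Longrightarrow> F x = 0" "\<And>x. R < \<bar>x\<bar> \<Longrightarrow> F' x = 0" and R: "0 < R"
  shows "(LINT x|lborel. F' x) = 0"
proof -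
  \<comment> \<open>The interval extends one unit beyond \<open>R\<close> on each side, because
    \<open>F\<close> is known to vanish only where \<bar>x\<bar> exceeds \<open>R\<close>, not at
    the endpoints.\<close>
  have "(LINT x|lborel. F' x) = (LINT x|lborel. indicator {-(R+1)..R+1} x *\<^sub>R F' x)"
    using z(2) by (intro Bochner_Integration.integral_cong) (auto simp: indicator_def)
  also have "\<dots> = F (R + 1) - F (- (R + 1))"
    using R F by (intro integral_FTC_Icc) (auto intro: has_vector_derivative_at_within continuous_on_subset[OF c])
  also have "\<dots> = 0" using z(1) R by simp
  finally show ?thesis .
qed

text \<open>Integration by parts with both terms kept under one integral: \<open>?F'\<close> is the
  derivative of a compactly supported product.\<close>

lemma ft_deriv1:
  assumes p: "test_function p"
  shows "ft (\<lambda>x. of_real (deriv p x)) \<xi> = \<i> * \<xi> * ft (\<lambda>x. of_real (p x)) \<xi>"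
proof -
  have p': "test_function (deriv p)" by (rule test_function_deriv1[OF p])
  obtain R B where B: "R > 0" "B > 0" "\<And>x. \<bar>p x\<bar> \<le> B * indicator {-R..R} x"
    by (rule test_function_bound[OF p]) blast
  obtain R' B' where B': "R' > 0" "B' > 0" "\<And>x. \<bar>deriv p x\<bar> \<le> B' * indicator {-R'..R'} x"
    by (rule test_function_bound[OF p']) blast
  have c: "continuous_on UNIV p" "continuous_on UNIV (deriv p)"
    using p p' by (auto simp: test_function_iff smooth_continuous)
  have z: "p x = 0" "deriv p x = 0" if "max R R' < \<bar>x\<bar>" for x
  proof -
    have "indicator {-R..R} x = (0::real)" "indicator {-R'..R'} x = (0::real)"
      using that by (auto simp: indicator_def)
    with B(3)[of x] B'(3)[of x] show "p x = 0" "deriv p x = 0" by auto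
  qed
  let ?F' = "\<lambda>x. cis (- (\<xi> * x)) * of_real (deriv p x) + - (\<i> * \<xi>) * (cis (- (\<xi> * x)) * of_real (p x))"
  have "(LINT x|lborel. ?F' x) = 0"
  proof (rule integral_derivative_compact_support[where F = "\<lambda>x. cis (- (\<xi> * x)) * of_real (p x)" and R = "max R R'"])
    fix x
    have dp: "(p has_field_derivative deriv p x) (at x)"
      using smooth_has_field_derivative[of p 0 x] p by (simp add: test_function_iff)
    have dp': "((\<lambda>x. complex_of_real (p x)) has_vector_derivative of_real (deriv p x)) (at x)"
      using dp unfolding has_real_derivative_iff_has_vector_derivative
      by (rule bounded_linear.has_vector_derivative[OF bounded_linear_of_real])
    have "((\<lambda>x. cis (- (\<xi> * x))) has_vector_derivative - (\<i> * \<xi>) * cis (- (\<xi> * x))) (at x)"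
      unfolding cis_conv_exp
      by (auto intro!: derivative_eq_intros has_vector_derivative_real_field simp: field_simps)
    from has_vector_derivative_mult[OF this dp']
    show "((\<lambda>x. cis (- (\<xi> * x)) * of_real (p x)) has_vector_derivative ?F' x) (at x)"
      by (simp add: mult_ac)
  next
    show "continuous_on UNIV ?F'" by (intro continuous_intros c)
    show "cis (- (\<xi> * x)) * of_real (p x) = 0" if "max R R' < \<bar>x\<bar>" for x
      using z(1)[OF that] by simp
    show "?F' x = 0" if "max R R' < \<bar>x\<bar>" for x
      using z[OF that] by simp
  qed (use B in auto)
  moreover have "(LINT x|lborel. ?F' x) = ft (\<lambda>x. of_real (deriv p x)) \<xi> + - (\<i> * \<xi>) * ft (\<lambda>x. of_real (p x)) \<xi>"
    unfolding ft_def
    by (subst Bochner_Integration.integral_add)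
      (auto intro!: integrable_mult_right integrable_cis_mult integrable_of_real test_function_integrable p p'
        simp del: integrable_mult_right_iff)
  ultimately show ?thesis by (simp add: algebra_simps)
qed

lemma ft_higher_deriv:
  assumes p: "test_function p"
  shows "ft (\<lambda>x. of_real ((deriv ^^ k) p x)) \<xi> = (\<i> * \<xi>) ^ k * ft (\<lambda>x. of_real (p x)) \<xi>"
proof (induction k)
  case (Suc k)
  then show ?case using ft_deriv1[OF test_function_higher_deriv[OF p], of k \<xi>] by simp
qed simp

lemma integrable_inverse_1_plus_square': "integrable lborel (\<lambda>x::real. inverse (1 + x\<^sup>2))"
proof -
  have "einterval (-\<infinity>) \<infinity> = UNIV" by (auto simp: einterval_def)
  then show ?thesis
    using integrable_inverse_1_plus_square unfolding set_integrable_def by simp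
qed

text \<open>Two derivatives of \<open>p\<close> give decay like 1 / \<xi>^2, and the trivial bound
  covers small \<xi>. Added up, they yield the integrable majorant 1 / (1 + \<xi>^2).\<close>

lemma integrable_ft_test_function:
  assumes p: "test_function p"
  shows "integrable lborel (ft (\<lambda>x. of_real (p x)))"
proof -
  define C where "C = (LINT x|lborel. norm (complex_of_real (p x))) + (LINT x|lborel. norm (complex_of_real ((deriv ^^ 2) p x)))"
  have [measurable]: "p \<in> borel_measurable borel" by (rule test_function_measurable[OF p])
  show ?thesis
  proof (rule Bochner_Integration.integrable_bound)
    show "integrable lborel (\<lambda>x::real. C * inverse (1 + x\<^sup>2))"
      using integrable_inverse_1_plus_square' by simp
    show "ft (\<lambda>x. complex_of_real (p x)) \<in> borel_measurable lborel" by measurable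
    have "norm (ft (\<lambda>x. complex_of_real (p x)) \<xi>) \<le> C * inverse (1 + \<xi>\<^sup>2)" for \<xi>
    proof -
      have "norm (ft (\<lambda>x. complex_of_real (p x)) \<xi>) * \<xi>\<^sup>2 = norm (ft (\<lambda>x. of_real ((deriv ^^ 2) p x)) \<xi>)"
        unfolding ft_higher_deriv[OF p] by (simp add: norm_mult norm_power)
      also have "\<dots> \<le> (LINT x|lborel. norm (complex_of_real ((deriv ^^ 2) p x)))" by (rule norm_ft_le)
      finally have "norm (ft (\<lambda>x. complex_of_real (p x)) \<xi>) * (1 + \<xi>\<^sup>2) \<le> C"
        using norm_ft_le[of "\<lambda>x. complex_of_real (p x)" \<xi>] unfolding C_def distrib_left by linarith
      then show ?thesis
        by (simp add: field_simps add_pos_nonneg)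
    qed
    then show "AE x in lborel. norm (ft (\<lambda>x. complex_of_real (p x)) x) \<le> norm (C * inverse (1 + x\<^sup>2))"
      by (auto intro: order_trans[OF _ abs_ge_self])
  qed
qed

section \<open>Uniqueness of weak derivatives\<close>

lemma indicator_Icc_scaleR_tendsto:
  fixes y :: "'a::real_normed_vector"
  shows "(\<lambda>n. indicator {-real n..real n} x *\<^sub>R y) \<longlonglongrightarrow> y"
proof -
  obtain N :: nat where "\<bar>x\<bar> \<le> real N" using real_arch_simple by blast
  then have "indicator {-real n..real n} x *\<^sub>R y = y" if "n \<ge> N" for n
    using that by (auto simp: indicator_def)
  then show ?thesis
    by (intro tendsto_eventually) (auto simp: eventually_sequentially)
qed

lemma AE_zero_of_intervals:
  fixes f :: "real \<Rightarrow> 'a::euclidean_space"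
  assumes f: "integrable lborel f" and iv: "\<And>a b. a \<le> b \<Longrightarrow> (LINT x:{a..b}|lborel. f x) = 0"
  shows "AE x in lborel. f x = 0"
proof (rule sigma_finite_measure.density_zero[OF sigma_finite_lborel f])
  have [measurable]: "f \<in> borel_measurable borel" using f by auto
  have si: "set_integrable lborel A f" if "A \<in> sets borel" for A
    using f that unfolding set_integrable_def by (intro integrable_mult_indicator) auto
  \<comment> \<open>The complement step of the induction over Borel sets subtracts from the integral
    over the whole line, which therefore has to vanish too.\<close>
  have total: "(LINT x|lborel. f x) = 0"
  proof (rule LIMSEQ_unique)
    show "(\<lambda>n. LINT x|lborel. indicator {-real n..real n} x *\<^sub>R f x) \<longlonglongrightarrow> (LINT x|lborel. f x)"
    proof (rule integral_dominated_convergence[where w = "\<lambda>x. norm (f x)"])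
      show "AE x in lborel. (\<lambda>n. indicator {-real n..real n} x *\<^sub>R f x) \<longlonglongrightarrow> f x"
        by (intro AE_I2 indicator_Icc_scaleR_tendsto)
    qed (use f in \<open>auto split: split_indicator\<close>)
    show "(\<lambda>n. LINT x|lborel. indicator {-real n..real n} x *\<^sub>R f x) \<longlonglongrightarrow> 0"
      using iv unfolding set_lebesgue_integral_def by simp
  qed
  fix A :: "real set" assume "A \<in> sets lborel"
  then have "A \<in> sets borel" by simp
  then show "set_lebesgue_integral lborel A f = 0"
  proof (induction rule: borel_set_induct)
    case empty then show ?case by (simp add: set_lebesgue_integral_def)
  next
    case (interval a b) then show ?case by (rule iv)
  next
    case (compl A)
    have "(LINT x:A|lborel. f x) + (LINT x:-A|lborel. f x) = (LINT x|lborel. f x)"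
    proof -
      have "(LINT x|lborel. f x) = (LINT x|lborel. indicator A x *\<^sub>R f x + indicator (- A) x *\<^sub>R f x)"
        by (intro Bochner_Integration.integral_cong) (auto split: split_indicator)
      also have "\<dots> = (LINT x|lborel. indicator A x *\<^sub>R f x) + (LINT x|lborel. indicator (- A) x *\<^sub>R f x)"
        using si[of A] si[of "- A"] compl(1) unfolding set_integrable_def
        by (intro Bochner_Integration.integral_add) auto
      finally show ?thesis by (simp add: set_lebesgue_integral_def)
    qed
    then show ?case using compl total by simp
  next
    case (union A)
    then have "(LINT x:(\<Union>i. A i)|lborel. f x) = (\<Sum>i. (LINT x:(A i)|lborel. f x))"
      by (intro lebesgue_integral_countable_add si) (auto simp: disjoint_family_on_def)
    then show ?case using union by simp
  qed
qed

lemma test_function_scaleR_integrable: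
  fixes g :: "real \<Rightarrow> 'a::euclidean_space"
  assumes p: "test_function p" and g: "locally_integrable g"
  shows "integrable lborel (\<lambda>x. p x *\<^sub>R g x)"
proof -
  obtain R B where B: "R > 0" "B > 0" "\<And>x. \<bar>p x\<bar> \<le> B * indicator {-R..R} x"
    by (rule test_function_bound[OF p]) blast
  have [measurable]: "p \<in> borel_measurable borel" by (rule test_function_measurable[OF p])
  have gi: "integrable lborel (\<lambda>x. indicator {-R..R} x *\<^sub>R g x)"
    using g by (simp add: locally_integrable_def set_integrable_def)
  then have [measurable]: "(\<lambda>x. indicator {-R..R} x *\<^sub>R g x) \<in> borel_measurable borel" by auto
  have eq: "p x *\<^sub>R g x = p x *\<^sub>R (indicator {-R..R} x *\<^sub>R g x)" for x
    using B(3)[of x] by (cases "x \<in> {-R..R}") auto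
  show ?thesis
  proof (rule Bochner_Integration.integrable_bound)
    show "integrable lborel (\<lambda>x. B *\<^sub>R (indicator {-R..R} x *\<^sub>R g x))"
      using gi by (rule integrable_scaleR_right)
    show "(\<lambda>x. p x *\<^sub>R g x) \<in> borel_measurable lborel"
      unfolding eq by measurable
    have "\<bar>p x\<bar> * norm (g x) \<le> B * indicator {-R..R} x * norm (g x)" for x
      by (intro mult_right_mono B) auto
    then show "AE x in lborel. norm (p x *\<^sub>R g x) \<le> norm (B *\<^sub>R (indicator {-R..R} x *\<^sub>R g x))"
      using B(2) by (auto simp: mult.assoc)
  qed
qed

lemma test_function_bump:
  assumes c: "c > 0"
  shows "test_function (\<lambda>x. flat (c * (x - a)) * flat (c * (b - x)))"
  unfolding test_function_iff
proof (intro conjI exI allI impI)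
  have "smooth (\<lambda>x. flat (c * x + (- (c * a))) * flat ((- c) * x + c * b))"
    by (intro smooth_mult smooth_affine smooth_flat)
  then show "smooth (\<lambda>x. flat (c * (x - a)) * flat (c * (b - x)))"
    by (simp add: algebra_simps)
  fix x assume "max \<bar>a\<bar> \<bar>b\<bar> < \<bar>x\<bar>"
  then have "x \<le> a \<or> b \<le> x" by auto
  then show "flat (c * (x - a)) * flat (c * (b - x)) = 0"
    using c by (auto intro!: flat_zero mult_nonneg_nonpos)
qed

text \<open>The fundamental lemma of the calculus of variations. Bumps of increasing steepness
  converge to the indicator of an open interval and stay below that of the closed one, which
  provides the dominating function for the merely locally integrable \<open>g\<close>.\<close>

lemma AE_zero_of_test_functions:
  fixes g :: "real \<Rightarrow> 'a::euclidean_space"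
  assumes g: "locally_integrable g"
    and z: "\<And>p. test_function p \<Longrightarrow> (LINT x|lborel. p x *\<^sub>R g x) = 0"
  shows "AE x in lborel. g x = 0"
proof -
  have gi: "integrable lborel (\<lambda>x. indicator {a..b} x *\<^sub>R g x)" for a b
    using g by (simp add: locally_integrable_def set_integrable_def)
  have Ioo: "(LINT x|lborel. indicator {a<..<b} x *\<^sub>R g x) = 0" if "a < b" for a b
  proof (rule LIMSEQ_unique)
    let ?q = "\<lambda>n x. flat (real (Suc n) * (x - a)) * flat (real (Suc n) * (b - x))"
    have q: "test_function (?q n)" for n by (rule test_function_bump) simp
    show "(\<lambda>n. LINT x|lborel. ?q n x *\<^sub>R g x) \<longlonglongrightarrow> 0"
      using z[OF q] by (simp del: of_nat_Suc)
    have lim: "(\<lambda>n. ?q n x) \<longlonglongrightarrow> indicator {a<..<b} x" for x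
    proof (cases "a < x \<and> x < b")
      case True
      then have "(\<lambda>n. ?q n x) \<longlonglongrightarrow> 1 * 1" by (intro tendsto_mult flat_tendsto_1) auto
      with True show ?thesis by simp
    next
      case False
      then have "x \<le> a \<or> b \<le> x" by auto
      then have "?q n x = 0" for n by (auto intro!: flat_zero mult_nonneg_nonpos simp del: of_nat_Suc)
      moreover have "indicator {a<..<b} x = (0::real)" using False by (auto simp: indicator_def)
      ultimately show ?thesis by (simp only: tendsto_const)
    qed
    have le: "\<bar>?q n x\<bar> \<le> indicator {a..b} x" for n x
    proof (cases "a \<le> x \<and> x \<le> b")
      case True then show ?thesis
        using flat_nonneg flat_le_1 by (auto simp: abs_mult intro!: mult_le_one simp del: of_nat_Suc)
    next
      case False
      then have "x \<le> a \<or> b \<le> x" by auto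
      then have "?q n x = 0" by (auto intro!: flat_zero mult_nonneg_nonpos simp del: of_nat_Suc)
      then show ?thesis by (simp only: abs_zero) simp
    qed
    show "(\<lambda>n. LINT x|lborel. ?q n x *\<^sub>R g x) \<longlonglongrightarrow> (LINT x|lborel. indicator {a<..<b} x *\<^sub>R g x)"
    proof (rule integral_dominated_convergence[where w = "\<lambda>x. norm (indicator {a..b} x *\<^sub>R g x)"])
      show "integrable lborel (\<lambda>x. norm (indicator {a..b} x *\<^sub>R g x))" using gi by (rule integrable_norm)
      show "(\<lambda>x. ?q n x *\<^sub>R g x) \<in> borel_measurable lborel" for n
        using test_function_scaleR_integrable[OF q g] by (rule borel_measurable_integrable)
      have "(\<lambda>x. indicator {a<..<b} x *\<^sub>R (indicator {a..b} x *\<^sub>R g x)) \<in> borel_measurable lborel"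
        using borel_measurable_integrable[OF gi[of a b]] by measurable
      then show "(\<lambda>x. indicator {a<..<b} x *\<^sub>R g x) \<in> borel_measurable lborel"
        by (rule measurable_cong[THEN iffD1, rotated]) (auto simp: indicator_def)
      show "AE x in lborel. (\<lambda>n. ?q n x *\<^sub>R g x) \<longlonglongrightarrow> indicator {a<..<b} x *\<^sub>R g x"
        by (intro AE_I2 tendsto_scaleR lim tendsto_const)
      show "AE x in lborel. norm (?q n x *\<^sub>R g x) \<le> norm (indicator {a..b} x *\<^sub>R g x)" for n
        using le by (intro AE_I2) (auto simp del: of_nat_Suc intro!: mult_right_mono order_trans[OF le])
    qed
  qed
  have Icc: "(LINT x|lborel. indicator {a..b} x *\<^sub>R g x) = 0" for a b
  proof -
    have "AE x in lborel. x \<noteq> a" "AE x in lborel. x \<noteq> b" by (auto intro!: AE_lborel_singleton)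
    then have ae: "AE x in lborel. indicator {a..b} x *\<^sub>R g x = indicator {a<..<b} x *\<^sub>R g x"
      by eventually_elim (auto simp: indicator_def)
    show ?thesis
    proof (cases "a < b")
      case True
      have "(LINT x|lborel. indicator {a..b} x *\<^sub>R g x) = (LINT x|lborel. indicator {a<..<b} x *\<^sub>R g x)"
      proof (rule integral_cong_AE[OF _ _ ae])
        show m: "(\<lambda>x. indicator {a..b} x *\<^sub>R g x) \<in> borel_measurable lborel"
          using gi by (rule borel_measurable_integrable)
        have "(\<lambda>x. indicator {a<..<b} x *\<^sub>R (indicator {a..b} x *\<^sub>R g x)) \<in> borel_measurable lborel"
          using m by measurable
        then show "(\<lambda>x. indicator {a<..<b} x *\<^sub>R g x) \<in> borel_measurable lborel"
          by (rule measurable_cong[THEN iffD1, rotated]) (auto simp: indicator_def)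
      qed
      with Ioo[OF True] show ?thesis by simp
    next
      case False
      then have "AE x in lborel. indicator {a..b} x *\<^sub>R g x = 0"
        using ae by (auto simp: indicator_def)
      then show ?thesis by (rule integral_eq_zero_AE)
    qed
  qed
  \<comment> \<open>\<open>AE_zero_of_intervals\<close> asks for an integrable function, so it is
    applied to truncations of \<open>g\<close>; countably many null sets are then united.\<close>
  have "AE x in lborel. indicator {-real n..real n} x *\<^sub>R g x = 0" for n
  proof (rule AE_zero_of_intervals[OF gi])
    fix a b :: real
    have "(LINT x:{a..b}|lborel. indicator {-real n..real n} x *\<^sub>R g x)
      = (LINT x|lborel. indicator {max a (-real n)..min b (real n)} x *\<^sub>R g x)"
      unfolding set_lebesgue_integral_def
      by (intro Bochner_Integration.integral_cong) (auto simp: indicator_def)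
    then show "(LINT x:{a..b}|lborel. indicator {-real n..real n} x *\<^sub>R g x) = 0" using Icc by simp
  qed
  then have "AE x in lborel. \<forall>n. indicator {-real n..real n} x *\<^sub>R g x = 0"
    unfolding AE_all_countable by blast
  then show ?thesis
  proof eventually_elim
    case (elim x)
    obtain N :: nat where "\<bar>x\<bar> \<le> real N" using real_arch_simple by blast
    with elim[rule_format, of N] show ?case by (auto simp: indicator_def)
  qed
qed

lemma has_weak_deriv_unique:
  assumes 1: "has_weak_deriv k f g" and 2: "has_weak_deriv k f g'"
  shows "AE x in lborel. g x = g' x"
proof -
  have l: "locally_integrable g" "locally_integrable g'" using 1 2 by (auto simp: has_weak_deriv_def)
  have "AE x in lborel. g x - g' x = 0"
  proof (rule AE_zero_of_test_functions)
    show "locally_integrable (\<lambda>x. g x - g' x)"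
      using l by (auto simp: locally_integrable_def intro: set_integral_diff)
    fix p assume p: "test_function p"
    have "(-1) ^ k *\<^sub>R (LINT x|lborel. p x *\<^sub>R g x) = (-1) ^ k *\<^sub>R (LINT x|lborel. p x *\<^sub>R g' x)"
      using 1 2 p by (auto simp: has_weak_deriv_def)
    then have "(LINT x|lborel. p x *\<^sub>R g x) = (LINT x|lborel. p x *\<^sub>R g' x)" by simp
    then show "(LINT x|lborel. p x *\<^sub>R (g x - g' x)) = 0"
      unfolding scaleR_diff_right
      by (subst Bochner_Integration.integral_diff) (auto intro!: test_function_scaleR_integrable p l)
  qed
  then show ?thesis by eventually_elim simp
qed

lemma square_integrable_imp_locally_integrable:
  fixes f :: "real \<Rightarrow> 'a::euclidean_space"
  assumes "square_integrable f" shows "locally_integrable f"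
  unfolding locally_integrable_def set_integrable_def
proof (intro allI)
  fix a b :: real
  have [measurable]: "f \<in> borel_measurable borel" and i: "integrable lborel (\<lambda>x. (norm (f x))\<^sup>2)"
    using assms by (auto simp: square_integrable_def)
  show "integrable lborel (\<lambda>x. indicator {a..b} x *\<^sub>R f x)"
  proof (rule Bochner_Integration.integrable_bound)
    show "integrable lborel (\<lambda>x. indicator {a..b} x + (norm (f x))\<^sup>2)"
      using i integrable_indicator_Icc by (rule Bochner_Integration.integrable_add[rotated])
    have "norm (f x) \<le> 1 + (norm (f x))\<^sup>2" for x
      using zero_le_power2[of "norm (f x) - 1"] zero_le_power2[of "norm (f x)"] unfolding power2_diff
      by (smt (verit) one_power2 mult_1_right)
    then show "AE x in lborel. norm (indicator {a..b} x *\<^sub>R f x) \<le> norm (indicator {a..b} x + (norm (f x))\<^sup>2)"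
      by (auto simp: indicator_def abs_of_nonneg)
  qed measurable
qed

lemma L2_norm_cong_AE:
  assumes "f \<in> borel_measurable lborel" "g \<in> borel_measurable lborel" "AE x in lborel. f x = g x"
  shows "L2_norm f = L2_norm g"
proof -
  have "AE x in lborel. (norm (f x))\<^sup>2 = (norm (g x))\<^sup>2" using assms(3) by eventually_elim simp
  then show ?thesis
    unfolding L2_norm_def
    by (intro arg_cong[where f = sqrt] integral_cong_AE borel_measurable_power
        measurable_compose[OF assms(1) borel_measurable_norm]
        measurable_compose[OF assms(2) borel_measurable_norm])
qed

lemma locally_integrable_measurable:
  fixes f :: "real \<Rightarrow> 'a::euclidean_space"
  assumes "locally_integrable f" shows "f \<in> borel_measurable lborel"
proof (rule borel_measurable_LIMSEQ_metric)
  show "(\<lambda>x. indicator {-real n..real n} x *\<^sub>R f x) \<in> borel_measurable lborel" for n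
    using assms unfolding locally_integrable_def set_integrable_def by (blast intro: borel_measurable_integrable)
qed (rule indicator_Icc_scaleR_tendsto)

text \<open>Weak derivatives agree almost everywhere, so the representative chosen by
  \<open>weak_deriv\<close> can be exchanged for any one at hand.\<close>

lemma L2_norm_weak_deriv:
  assumes g: "has_weak_deriv k f g"
  shows "L2_norm (weak_deriv k f) = L2_norm g"
proof -
  have w: "has_weak_deriv k f (weak_deriv k f)"
    unfolding weak_deriv_def by (rule someI[of "has_weak_deriv k f", OF g])
  then show ?thesis
    using has_weak_deriv_unique[OF w g] g
    by (intro L2_norm_cong_AE locally_integrable_measurable) (auto simp: has_weak_deriv_def)
qed

section \<open>Products of square-integrable functions\<close>

lemma integrable_norm_sq_iff:
  fixes f :: "'a \<Rightarrow> 'b::{banach,second_countable_topology}"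
  assumes "f \<in> borel_measurable M"
  shows "integrable M (\<lambda>x. (norm (f x))\<^sup>2) \<longleftrightarrow> (\<integral>\<^sup>+x. ennreal ((norm (f x))\<^sup>2) \<partial>M) < \<infinity>"
  using assms by (subst integrable_iff_bounded) (auto simp: norm_power)

lemma norm_integral_mult_sq_le:
  fixes u q :: "'a \<Rightarrow> complex"
  assumes [measurable]: "u \<in> borel_measurable M" "q \<in> borel_measurable M"
  shows "(ennreal (norm (LINT x|M. u x * q x)))\<^sup>2
    \<le> (\<integral>\<^sup>+x. ennreal ((norm (u x))\<^sup>2) \<partial>M) * (\<integral>\<^sup>+x. ennreal ((norm (q x))\<^sup>2) \<partial>M)"
proof -
  have "(ennreal (norm (LINT x|M. u x * q x)))\<^sup>2 \<le> (\<integral>\<^sup>+x. ennreal (norm (u x * q x)) \<partial>M)\<^sup>2"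
    by (intro power_mono ennreal_norm_integral_le) auto
  also have "\<dots> = (\<integral>\<^sup>+x. ennreal (norm (u x)) * ennreal (norm (q x)) \<partial>M)\<^sup>2"
    by (simp add: norm_mult ennreal_mult)
  also have "\<dots> \<le> (\<integral>\<^sup>+x. (ennreal (norm (u x)))\<^sup>2 \<partial>M) * (\<integral>\<^sup>+x. (ennreal (norm (q x)))\<^sup>2 \<partial>M)"
    by (rule Cauchy_Schwarz_nn_integral) measurable
  finally show ?thesis by (simp add: ennreal_power)
qed

text \<open>Cauchy-Schwarz in extended nonnegative form: convergence to 0 in the mean square becomes
  convergence of the pairings with a fixed function.\<close>

lemma integral_mult_tendsto_0:
  fixes u :: "nat \<Rightarrow> 'a \<Rightarrow> complex" and q :: "'a \<Rightarrow> complex"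
  assumes [measurable]: "\<And>n. u n \<in> borel_measurable M" "q \<in> borel_measurable M"
    and q: "integrable M (\<lambda>x. (norm (q x))\<^sup>2)"
    and u: "(\<lambda>n. \<integral>\<^sup>+x. ennreal ((norm (u n x))\<^sup>2) \<partial>M) \<longlonglongrightarrow> 0"
  shows "(\<lambda>n. LINT x|M. u n x * q x) \<longlonglongrightarrow> 0"
proof -
  define Q where "Q = (\<integral>\<^sup>+x. ennreal ((norm (q x))\<^sup>2) \<partial>M)"
  have Q: "Q < \<infinity>" using q unfolding Q_def by (simp add: integrable_norm_sq_iff)
  have "(\<lambda>n. ennreal ((norm (LINT x|M. u n x * q x))\<^sup>2)) \<longlonglongrightarrow> 0"
  proof (rule tendsto_sandwich[OF always_eventually always_eventually tendsto_const])
    show "\<forall>n. ennreal ((norm (LINT x|M. u n x * q x))\<^sup>2) \<le> (\<integral>\<^sup>+x. ennreal ((norm (u n x))\<^sup>2) \<partial>M) * Q"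
      using norm_integral_mult_sq_le[of "u _" M q] unfolding Q_def by (simp add: ennreal_power)
    show "(\<lambda>n. (\<integral>\<^sup>+x. ennreal ((norm (u n x))\<^sup>2) \<partial>M) * Q) \<longlonglongrightarrow> 0"
      using tendsto_mult_ennreal[OF u tendsto_const[of Q]] Q by simp
  qed auto
  then have "(\<lambda>n. (norm (LINT x|M. u n x * q x))\<^sup>2) \<longlonglongrightarrow> 0"
    unfolding ennreal_0[symmetric] by (subst (asm) tendsto_ennreal_iff) auto
  then have "(\<lambda>n. sqrt ((norm (LINT x|M. u n x * q x))\<^sup>2)) \<longlonglongrightarrow> sqrt 0"
    by (rule tendsto_real_sqrt)
  then show ?thesis by (simp add: tendsto_norm_zero_iff)
qed

lemma integrable_mult_L2:
  fixes u q :: "'a \<Rightarrow> complex"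
  assumes [measurable]: "u \<in> borel_measurable M" "q \<in> borel_measurable M"
    and u: "integrable M (\<lambda>x. (norm (u x))\<^sup>2)" and q: "integrable M (\<lambda>x. (norm (q x))\<^sup>2)"
  shows "integrable M (\<lambda>x. u x * q x)"
proof (rule Bochner_Integration.integrable_bound)
  show "integrable M (\<lambda>x. (norm (u x))\<^sup>2 + (norm (q x))\<^sup>2)" using u q by simp
  have "norm (u x) * norm (q x) \<le> (norm (u x))\<^sup>2 + (norm (q x))\<^sup>2" for x
  proof -
    have "0 \<le> norm (u x) * norm (q x)" by simp
    moreover have "2 * (norm (u x) * norm (q x)) \<le> (norm (u x))\<^sup>2 + (norm (q x))\<^sup>2"
      using sum_squares_bound[of "norm (u x)" "norm (q x)"] by (simp only: mult.assoc)
    ultimately show ?thesis by linarith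
  qed
  then show "AE x in M. norm (u x * q x) \<le> norm ((norm (u x))\<^sup>2 + (norm (q x))\<^sup>2)"
    by (auto simp: norm_mult)
qed measurable

section \<open>Transforms of square-integrable functions\<close>

text \<open>The inverse transform of \<open>p\<close> without its factor 1 / (2 pi). Pairing a
  transform with \<open>qft p\<close> recovers the pairing of the original function with
  \<open>p\<close>, so transforms of square-integrable functions can be handled through test
  functions.\<close>

definition qft :: "(real \<Rightarrow> real) \<Rightarrow> real \<Rightarrow> complex" where
  "qft p \<xi> = ft (\<lambda>x. of_real (p x)) (- \<xi>)"

lemma integrable_L2_bounded:
  fixes q :: "real \<Rightarrow> complex"
  assumes q: "integrable lborel q" and B: "\<And>x. norm (q x) \<le> B"
  shows "integrable lborel (\<lambda>x. (norm (q x))\<^sup>2)"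
proof (rule Bochner_Integration.integrable_bound)
  have [measurable]: "q \<in> borel_measurable borel" using q by auto
  show "integrable lborel (\<lambda>x. B * norm (q x))" using q by simp
  show "AE x in lborel. norm ((norm (q x))\<^sup>2) \<le> norm (B * norm (q x))"
    using B by (auto simp: power2_eq_square abs_mult intro!: mult_right_mono order_trans[OF B abs_ge_self])
  show "(\<lambda>x. (norm (q x))\<^sup>2) \<in> borel_measurable lborel" by measurable
qed

lemma integrable_reflect:
  fixes f :: "real \<Rightarrow> 'a::euclidean_space"
  shows "integrable lborel f \<Longrightarrow> integrable lborel (\<lambda>x. f (- x))"
  using lborel_integrable_real_affine[of f "-1" 0] by simp

lemma integral_reflect:
  fixes f :: "real \<Rightarrow> 'a::euclidean_space"
  shows "(LINT x|lborel. f (- x)) = (LINT x|lborel. f x)"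
  using lborel_integral_real_affine[of "-1" f 0] by simp

lemma ft_reflect: "ft (\<lambda>x. f (- x)) \<xi> = ft f (- \<xi>)"
  unfolding ft_def using integral_reflect[of "\<lambda>x. cis (\<xi> * x) * f x"] by simp

lemma
  assumes p: "test_function p"
  shows integrable_qft: "integrable lborel (qft p)"
    and integrable_qft_sq: "integrable lborel (\<lambda>\<xi>. (norm (qft p \<xi>))\<^sup>2)"
    and ft_qft: "ft (qft p) x = of_real (2 * pi * p x)"
proof -
  show 1: "integrable lborel (qft p)"
    unfolding qft_def[abs_def] by (intro integrable_reflect integrable_ft_test_function[OF p])
  show "integrable lborel (\<lambda>\<xi>. (norm (qft p \<xi>))\<^sup>2)"
    by (rule integrable_L2_bounded[OF 1]) (unfold qft_def, rule norm_ft_le)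
  obtain R B where B: "R > 0" "B > 0" "\<And>x. \<bar>p x\<bar> \<le> B * indicator {-R..R} x"
    by (rule test_function_bound[OF p]) blast
  have "ft (qft p) x = ft (ft (\<lambda>x. of_real (p x))) (- x)"
    unfolding qft_def[abs_def] by (rule ft_reflect)
  also have "\<dots> = of_real (2 * pi) * of_real (p x)"
  proof (rule fourier_inversion[where B = B])
    show "integrable lborel (\<lambda>x. complex_of_real (p x))"
      using test_function_integrable[OF p] by simp
    show "continuous_on UNIV (\<lambda>x. complex_of_real (p x))"
      using p by (intro continuous_intros smooth_continuous) (simp add: test_function_iff)
    show "norm (complex_of_real (p x)) \<le> B" for x
      using B(2) B(3)[of x] by (cases "x \<in> {-R..R}") auto
  qed (rule integrable_ft_test_function[OF p])
  finally show "ft (qft p) x = of_real (2 * pi * p x)" by simp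
qed

text \<open>The reflection in \<open>qft\<close> supplies exactly the sign that the definition of a
  weak derivative carries.\<close>

lemma qft_higher_deriv:
  assumes "test_function p"
  shows "qft ((deriv ^^ k) p) \<xi> = (- 1) ^ k * ((\<i> * \<xi>) ^ k * qft p \<xi>)"
  unfolding qft_def ft_higher_deriv[OF assms] by (simp add: power_minus[of "\<i> * \<xi>"] mult.assoc)

lemma ft_pairing:
  fixes f :: "real \<Rightarrow> complex"
  assumes f: "integrable lborel f" and p: "test_function p"
  shows "(LINT \<xi>|lborel. ft f \<xi> * qft p \<xi>) = of_real (2 * pi) * (LINT x|lborel. of_real (p x) * f x)"
proof -
  have "(LINT \<xi>|lborel. ft f \<xi> * qft p \<xi>) = (LINT x|lborel. of_real (2 * pi) * (of_real (p x) * f x))"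
    unfolding ft_multiplication[OF f integrable_qft[OF p]] ft_qft[OF p] by (simp add: mult_ac)
  then show ?thesis by (simp only: integral_mult_right_zero)
qed

lemma test_function_sq_integrable:
  assumes p: "test_function p"
  shows "integrable lborel (\<lambda>x. (norm (complex_of_real (p x)))\<^sup>2)"
proof -
  obtain R B where B: "R > 0" "B > 0" "\<And>x. \<bar>p x\<bar> \<le> B * indicator {-R..R} x"
    by (rule test_function_bound[OF p]) blast
  show ?thesis
  proof (rule integrable_L2_bounded)
    show "integrable lborel (\<lambda>x. complex_of_real (p x))"
      using test_function_integrable[OF p] by simp
    show "norm (complex_of_real (p x)) \<le> B" for x
      using B(2) B(3)[of x] by (cases "x \<in> {-R..R}") auto
  qed
qed

text \<open>\<open>ft_pairing\<close> is applied to truncations of \<open>f\<close>. Their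
  transforms converge to \<open>g\<close> in the mean square and are paired with the
  square-integrable \<open>qft p\<close>, so both sides pass to the limit.\<close>

lemma ft_L2_pairing:
  fixes f g :: "real \<Rightarrow> complex"
  assumes f: "square_integrable f" and g: "square_integrable g" and p: "test_function p"
    and lim: "((\<lambda>R. \<integral>\<^sup>+ \<xi>. ennreal ((norm (ft (\<lambda>x. indicator {-R..R} x *\<^sub>R f x) \<xi> - g \<xi>))\<^sup>2) \<partial>lborel)
        \<longlongrightarrow> 0) at_top"
  shows "(LINT \<xi>|lborel. g \<xi> * qft p \<xi>) = of_real (2 * pi) * (LINT x|lborel. of_real (p x) * f x)"
proof -
  have [measurable]: "f \<in> borel_measurable borel" "g \<in> borel_measurable borel"
    and f2: "integrable lborel (\<lambda>x. (norm (f x))\<^sup>2)" and g2: "integrable lborel (\<lambda>x. (norm (g x))\<^sup>2)"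
    using f g by (auto simp: square_integrable_def)
  have [measurable]: "p \<in> borel_measurable borel" by (rule test_function_measurable[OF p])
  have [measurable]: "qft p \<in> borel_measurable borel" using integrable_qft[OF p] by auto
  let ?f = "\<lambda>n x. indicator {-real n..real n} x *\<^sub>R f x"
  have fi: "integrable lborel (?f n)" for n
    using square_integrable_imp_locally_integrable[OF f] by (auto simp: locally_integrable_def set_integrable_def)
  have [measurable]: "ft (?f n) \<in> borel_measurable borel" for n by measurable
  have gq: "integrable lborel (\<lambda>\<xi>. g \<xi> * qft p \<xi>)"
    by (intro integrable_mult_L2 g2 integrable_qft_sq p) measurable
  have fq: "integrable lborel (\<lambda>\<xi>. ft (?f n) \<xi> * qft p \<xi>)" for n
  proof (rule Bochner_Integration.integrable_bound)
    show "integrable lborel (\<lambda>\<xi>. (LINT x|lborel. norm (?f n x)) *\<^sub>R qft p \<xi>)"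
      by (intro integrable_scaleR_right integrable_qft p)
    show "AE \<xi> in lborel. norm (ft (?f n) \<xi> * qft p \<xi>) \<le> norm ((LINT x|lborel. norm (?f n x)) *\<^sub>R qft p \<xi>)"
    proof (rule AE_I2)
      fix \<xi>
      have "norm (ft (?f n) \<xi>) * norm (qft p \<xi>) \<le> \<bar>LINT x|lborel. norm (?f n x)\<bar> * norm (qft p \<xi>)"
        by (intro mult_right_mono order_trans[OF norm_ft_le abs_ge_self] norm_ge_zero)
      then show "norm (ft (?f n) \<xi> * qft p \<xi>) \<le> norm ((LINT x|lborel. norm (?f n x)) *\<^sub>R qft p \<xi>)"
        by (subst norm_mult, subst norm_scaleR)
    qed
  qed measurable
  have "(\<lambda>n. LINT \<xi>|lborel. (ft (?f n) \<xi> - g \<xi>) * qft p \<xi>) \<longlonglongrightarrow> 0"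
    by (intro integral_mult_tendsto_0 integrable_qft_sq p
        filterlim_compose[OF lim filterlim_real_sequentially]) measurable
  then have "(\<lambda>n. (LINT \<xi>|lborel. ft (?f n) \<xi> * qft p \<xi>) - (LINT \<xi>|lborel. g \<xi> * qft p \<xi>)) \<longlonglongrightarrow> 0"
    unfolding left_diff_distrib Bochner_Integration.integral_diff[OF fq gq] .
  then have 1: "(\<lambda>n. LINT \<xi>|lborel. ft (?f n) \<xi> * qft p \<xi>) \<longlonglongrightarrow> (LINT \<xi>|lborel. g \<xi> * qft p \<xi>)"
    by (simp only: LIM_zero_iff)
  have pf: "integrable lborel (\<lambda>x. complex_of_real (p x) * f x)"
    by (intro integrable_mult_L2 f2 test_function_sq_integrable p) measurable
  have "(\<lambda>n. LINT x|lborel. of_real (p x) * ?f n x) \<longlonglongrightarrow> (LINT x|lborel. of_real (p x) * f x)"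
  proof (rule integral_dominated_convergence[where w = "\<lambda>x. norm (of_real (p x) * f x)"])
    show "integrable lborel (\<lambda>x. norm (complex_of_real (p x) * f x))" using pf by (rule integrable_norm)
    show "AE x in lborel. (\<lambda>n. of_real (p x) * ?f n x) \<longlonglongrightarrow> of_real (p x) * f x"
      by (intro AE_I2 tendsto_mult tendsto_const indicator_Icc_scaleR_tendsto)
    show "AE x in lborel. norm (of_real (p x) * ?f n x) \<le> norm (of_real (p x) * f x)" for n
      by (intro AE_I2) (auto split: split_indicator)
  qed measurable
  then have "(\<lambda>n. of_real (2 * pi) * (LINT x|lborel. of_real (p x) * ?f n x)) \<longlonglongrightarrow> of_real (2 * pi) * (LINT x|lborel. of_real (p x) * f x)"
    by (intro tendsto_mult tendsto_const)
  then have 2: "(\<lambda>n. LINT \<xi>|lborel. ft (?f n) \<xi> * qft p \<xi>) \<longlonglongrightarrow> of_real (2 * pi) * (LINT x|lborel. of_real (p x) * f x)"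
    unfolding ft_pairing[OF fi p] .
  show ?thesis by (rule LIMSEQ_unique[OF 1 2])
qed

text \<open>The Riesz-Fischer theorem for a fast Cauchy sequence. The limit is taken pointwise
  almost everywhere, and Fatou's lemma bounds the distance to it.\<close>

lemma L2_complete:
  fixes H :: "nat \<Rightarrow> real \<Rightarrow> complex"
  assumes [measurable]: "\<And>k. H k \<in> borel_measurable borel" and C: "0 \<le> C"
    and H: "\<And>k l. (\<integral>\<^sup>+x. ennreal ((norm (H k x - H l x))\<^sup>2) \<partial>lborel) \<le> ennreal (C * (1/4) ^ k + C * (1/4) ^ l)"
  obtains h where "h \<in> borel_measurable borel" "AE x in lborel. (\<lambda>k. H k x) \<longlonglongrightarrow> h x"
    "\<And>k. (\<integral>\<^sup>+x. ennreal ((norm (H k x - h x))\<^sup>2) \<partial>lborel) \<le> ennreal (C * (1/4) ^ k)"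
proof -
  let ?D = "\<lambda>k x. H (Suc k) x - H k x"
  \<comment> \<open>Squared increments are of order 4^-k. The weight 2^k leaves a summable series
    and provides the slack needed to pass from squares to the increments themselves.\<close>
  have "(\<integral>\<^sup>+x. (\<Sum>k. ennreal (2 ^ k * (norm (?D k x))\<^sup>2)) \<partial>lborel)
      = (\<Sum>k. (\<integral>\<^sup>+x. ennreal (2 ^ k * (norm (?D k x))\<^sup>2) \<partial>lborel))"
    by (rule nn_integral_suminf) measurable
  also have "\<dots> \<le> (\<Sum>k. ennreal (2 * C * (1/2) ^ k))"
  proof (intro suminf_le allI summableI)
    fix k
    have "(\<integral>\<^sup>+x. ennreal (2 ^ k * (norm (?D k x))\<^sup>2) \<partial>lborel)
        = ennreal (2 ^ k) * (\<integral>\<^sup>+x. ennreal ((norm (?D k x))\<^sup>2) \<partial>lborel)"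
      by (subst nn_integral_cmult[symmetric]) (auto simp: ennreal_mult)
    also have "\<dots> \<le> ennreal (2 ^ k) * ennreal (C * (1/4) ^ Suc k + C * (1/4) ^ k)"
      by (intro mult_left_mono H) auto
    also have "\<dots> = ennreal (2 ^ k * (C * (1/4) ^ Suc k + C * (1/4) ^ k))"
      using C by (intro ennreal_mult[symmetric]) auto
    also have "\<dots> \<le> ennreal (2 * C * (1/2) ^ k)"
    proof (rule ennreal_leI)
      have "(2::real) ^ k * (1/4) ^ k = (1/2) ^ k" by (simp flip: power_mult_distrib)
      then have "2 ^ k * (C * (1/4) ^ Suc k + C * (1/4) ^ k) = 5/4 * C * (1/2) ^ k"
        by (simp add: algebra_simps)
      also have "\<dots> \<le> 2 * C * (1/2) ^ k" using C by (intro mult_right_mono) auto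
      finally show "2 ^ k * (C * (1/4) ^ Suc k + C * (1/4) ^ k) \<le> 2 * C * (1/2) ^ k" .
    qed
    finally show "(\<integral>\<^sup>+x. ennreal (2 ^ k * (norm (?D k x))\<^sup>2) \<partial>lborel) \<le> \<dots>" .
  qed
  also have "\<dots> = ennreal (\<Sum>k. 2 * C * (1/2) ^ k)"
    using C by (intro suminf_ennreal2) (auto intro!: summable_mult summable_geometric)
  also have "\<dots> < \<infinity>" by simp
  finally have "AE x in lborel. (\<Sum>k. ennreal (2 ^ k * (norm (?D k x))\<^sup>2)) \<noteq> \<infinity>"
    by (intro nn_integral_PInf_AE) auto
  then have conv: "AE x in lborel. convergent (\<lambda>k. H k x)"
  proof eventually_elim
    case (elim x)
    have s1: "summable (\<lambda>k. 2 ^ k * (norm (?D k x))\<^sup>2)"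
      by (rule summable_suminf_not_top) (use elim in auto)
    have s2: "summable (\<lambda>k. (1/2::real) ^ k)" by (rule summable_geometric) simp
    have "summable (\<lambda>k. ?D k x)"
    proof (rule summable_comparison_test[OF _ summable_add[OF s1 s2]], intro exI allI impI)
      fix k :: nat
      define a where "a = norm (?D k x)"
      define b where "b = (2::real) ^ k"
      have b: "b \<ge> 1" by (simp add: b_def)
      \<comment> \<open>From this, a <= b a^2 + 1 / b: the first summand is the weighted square, and
        the second is summable in \<open>k\<close>.\<close>
      have "0 \<le> (b * a - 1)\<^sup>2" by simp
      then have "2 * (b * a) \<le> b * (b * a\<^sup>2) + 1" by (simp add: power2_eq_square algebra_simps)
      moreover have "0 \<le> b * a" using b by (auto simp: a_def)
      ultimately have "b * a \<le> b * (b * a\<^sup>2 + 1 / b)" using b by (simp add: distrib_left)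
      then have "a \<le> b * a\<^sup>2 + 1 / b" using b by simp
      then show "norm (?D k x) \<le> 2 ^ k * (norm (?D k x))\<^sup>2 + (1/2) ^ k"
        by (simp add: a_def b_def power_divide)
    qed
    then have "(\<lambda>n. \<Sum>k<n. ?D k x) \<longlonglongrightarrow> (\<Sum>k. ?D k x)" by (rule summable_LIMSEQ)
    then have "(\<lambda>n. (\<Sum>k<n. ?D k x) + H 0 x) \<longlonglongrightarrow> (\<Sum>k. ?D k x) + H 0 x"
      by (intro tendsto_add tendsto_const)
    moreover have "(\<Sum>k<n. ?D k x) + H 0 x = H n x" for n
      using sum_lessThan_telescope[of "\<lambda>k. H k x" n] by simp
    ultimately show "convergent (\<lambda>k. H k x)" by (auto simp: convergent_def)
  qed
  define h where "h x = lim (\<lambda>k. H k x)" for x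
  have [measurable]: "h \<in> borel_measurable borel" unfolding h_def[abs_def] by measurable
  have lim: "AE x in lborel. (\<lambda>k. H k x) \<longlonglongrightarrow> h x"
    using conv by eventually_elim (simp add: h_def convergent_LIMSEQ_iff)
  have "(\<integral>\<^sup>+x. ennreal ((norm (H k x - h x))\<^sup>2) \<partial>lborel) \<le> ennreal (C * (1/4) ^ k)" for k
  proof -
    have "(\<integral>\<^sup>+x. ennreal ((norm (H k x - h x))\<^sup>2) \<partial>lborel)
       = (\<integral>\<^sup>+x. liminf (\<lambda>l. ennreal ((norm (H k x - H l x))\<^sup>2)) \<partial>lborel)"
    proof (rule nn_integral_cong_AE, use lim in eventually_elim)
      case (elim x)
      then have "(\<lambda>l. ennreal ((norm (H k x - H l x))\<^sup>2)) \<longlonglongrightarrow> ennreal ((norm (H k x - h x))\<^sup>2)"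
        by (intro tendsto_ennrealI tendsto_intros)
      then show ?case by (intro lim_imp_Liminf[symmetric]) auto
    qed
    also have "\<dots> \<le> liminf (\<lambda>l. \<integral>\<^sup>+x. ennreal ((norm (H k x - H l x))\<^sup>2) \<partial>lborel)"
      by (rule nn_integral_liminf) measurable
    also have "\<dots> \<le> liminf (\<lambda>l. ennreal (C * (1/4) ^ k + C * (1/4) ^ l))"
      by (intro Liminf_mono always_eventually allI H)
    also have "\<dots> = ennreal (C * (1/4) ^ k + C * 0)"
      by (intro lim_imp_Liminf tendsto_ennrealI tendsto_add tendsto_mult tendsto_const LIMSEQ_realpow_zero) auto
    finally show ?thesis by simp
  qed
  with lim show thesis by (intro that[of h]) auto
qed

section \<open>The inverse Plancherel transform\<close>

lemma nn_integral_reflect: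
  assumes [measurable]: "f \<in> borel_measurable borel"
  shows "(\<integral>\<^sup>+x. f (- x) \<partial>lborel) = (\<integral>\<^sup>+x. f (x :: real) \<partial>lborel)"
  using nn_integral_real_affine[of f "-1" 0] by simp

lemma inverse_ft_le:
  assumes F: "integrable lborel F"
  shows "(\<integral>\<^sup>+x. ennreal ((norm (of_real (1 / (2 * pi)) * ft F (- x)))\<^sup>2) \<partial>lborel)
     \<le> ennreal (1 / (2 * pi)) * (\<integral>\<^sup>+\<xi>. ennreal ((norm (F \<xi>))\<^sup>2) \<partial>lborel)"
proof -
  have [measurable]: "F \<in> borel_measurable borel" using F by auto
  have "(\<integral>\<^sup>+x. ennreal ((norm (of_real (1 / (2 * pi)) * ft F (- x)))\<^sup>2) \<partial>lborel)
     = (\<integral>\<^sup>+x. ennreal ((1 / (2 * pi))\<^sup>2) * ennreal ((norm (ft F (- x)))\<^sup>2) \<partial>lborel)"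
    unfolding norm_mult norm_of_real power_mult_distrib by (simp add: ennreal_mult)
  also have "\<dots> = ennreal ((1 / (2 * pi))\<^sup>2) * (\<integral>\<^sup>+x. ennreal ((norm (ft F x))\<^sup>2) \<partial>lborel)"
    by (subst nn_integral_cmult) (auto simp: nn_integral_reflect[of "\<lambda>x. ennreal ((norm (ft F x))\<^sup>2)"])
  also have "\<dots> \<le> ennreal ((1 / (2 * pi))\<^sup>2) * (ennreal (2 * pi) * (\<integral>\<^sup>+\<xi>. ennreal ((norm (F \<xi>))\<^sup>2) \<partial>lborel))"
    by (intro mult_left_mono plancherel_le[OF F]) auto
  also have "\<dots> = ennreal ((1 / (2 * pi))\<^sup>2 * (2 * pi)) * (\<integral>\<^sup>+\<xi>. ennreal ((norm (F \<xi>))\<^sup>2) \<partial>lborel)"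
    by (subst ennreal_mult) (auto simp: mult.assoc)
  also have "(1 / (2 * pi))\<^sup>2 * (2 * pi) = 1 / (2 * pi)" by (simp add: power2_eq_square)
  finally show ?thesis .
qed

text \<open>Truncations of \<open>G\<close> are integrable, so their inverse transforms are given by
  integrals, and Plancherel's inequality makes these a fast Cauchy sequence. The limit
  \<open>h\<close> is described through its pairings with test functions, which is the form that
  weak derivatives require.\<close>

lemma L2_inverse_ft:
  fixes G :: "real \<Rightarrow> complex"
  assumes G: "square_integrable G"
  obtains h where "square_integrable h"
    "(\<integral>\<^sup>+x. ennreal ((norm (h x))\<^sup>2) \<partial>lborel) \<le> ennreal (1 / (2 * pi)) * (\<integral>\<^sup>+\<xi>. ennreal ((norm (G \<xi>))\<^sup>2) \<partial>lborel)"
    "\<And>p. test_function p \<Longrightarrow> (LINT \<xi>|lborel. G \<xi> * qft p \<xi>) = of_real (2 * pi) * (LINT x|lborel. of_real (p x) * h x)"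
proof -
  have [measurable]: "G \<in> borel_measurable borel" and G2: "integrable lborel (\<lambda>x. (norm (G x))\<^sup>2)"
    using G by (auto simp: square_integrable_def)
  let ?c = "\<lambda>n \<xi>. indicator {-real n..real n} \<xi> *\<^sub>R G \<xi>"
  have "(\<lambda>n. LINT \<xi>|lborel. (norm (G \<xi> - ?c n \<xi>))\<^sup>2) \<longlonglongrightarrow> (LINT (\<xi>::real)|lborel. 0)"
  proof (rule integral_dominated_convergence[where w = "\<lambda>\<xi>. (norm (G \<xi>))\<^sup>2"])
    show "AE \<xi> in lborel. (\<lambda>n. (norm (G \<xi> - ?c n \<xi>))\<^sup>2) \<longlonglongrightarrow> 0"
    proof (rule AE_I2)
      fix \<xi>
      have "(\<lambda>n. (norm (G \<xi> - ?c n \<xi>))\<^sup>2) \<longlonglongrightarrow> (norm (G \<xi> - G \<xi>))\<^sup>2"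
        by (intro tendsto_intros indicator_Icc_scaleR_tendsto)
      then show "(\<lambda>n. (norm (G \<xi> - ?c n \<xi>))\<^sup>2) \<longlonglongrightarrow> 0" by simp
    qed
    show "AE \<xi> in lborel. norm ((norm (G \<xi> - ?c n \<xi>))\<^sup>2) \<le> (norm (G \<xi>))\<^sup>2" for n
      by (auto split: split_indicator)
  qed (use G2 in auto)
  then have tail0: "(\<lambda>n. LINT \<xi>|lborel. (norm (G \<xi> - ?c n \<xi>))\<^sup>2) \<longlonglongrightarrow> 0" by simp
  have "\<exists>n. (LINT \<xi>|lborel. (norm (G \<xi> - ?c n \<xi>))\<^sup>2) < (1/4) ^ k" for k :: nat
    using order_tendstoD(2)[OF tail0, of "(1/4) ^ k"] by (auto simp: eventually_sequentially)
  \<comment> \<open>Radii along which the tails decrease like 4^-k, as \<open>L2_complete\<close>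
    asks.\<close>
  then obtain r where r: "\<And>k. (LINT \<xi>|lborel. (norm (G \<xi> - ?c (r k) \<xi>))\<^sup>2) < (1/4) ^ k"
    by metis
  define g where "g k = ?c (r k)" for k
  have gi: "integrable lborel (g k)" for k
    using square_integrable_imp_locally_integrable[OF G] unfolding g_def
    by (auto simp: locally_integrable_def set_integrable_def)
  then have [measurable]: "g k \<in> borel_measurable borel" for k by auto
  have g_le: "norm (g k \<xi>) \<le> norm (G \<xi>)" for k \<xi> by (auto simp: g_def split: split_indicator)
  have tail: "(\<integral>\<^sup>+\<xi>. ennreal ((norm (G \<xi> - g k \<xi>))\<^sup>2) \<partial>lborel) \<le> ennreal ((1/4) ^ k)" for k
  proof -
    have "integrable lborel (\<lambda>\<xi>. (norm (G \<xi> - g k \<xi>))\<^sup>2)"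
      by (rule Bochner_Integration.integrable_bound[OF G2]) (auto simp: g_def split: split_indicator)
    then have "(\<integral>\<^sup>+\<xi>. ennreal ((norm (G \<xi> - g k \<xi>))\<^sup>2) \<partial>lborel) = ennreal (LINT \<xi>|lborel. (norm (G \<xi> - g k \<xi>))\<^sup>2)"
      by (rule nn_integral_eq_integral) simp
    then show ?thesis using r[of k] by (simp add: g_def ennreal_leI less_imp_le)
  qed
  define H where "H k x = of_real (1 / (2 * pi)) * ft (g k) (- x)" for k x
  have [measurable]: "H k \<in> borel_measurable borel" for k unfolding H_def by measurable
  have HH: "(\<integral>\<^sup>+x. ennreal ((norm (H k x - H l x))\<^sup>2) \<partial>lborel)
      \<le> ennreal (1 / (2 * pi) * (1/4) ^ k + 1 / (2 * pi) * (1/4) ^ l)" for k l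
  proof -
    have "ft (\<lambda>\<xi>. g k \<xi> - g l \<xi>) x = ft (g k) x - ft (g l) x" for x
      unfolding ft_def right_diff_distrib
      by (intro Bochner_Integration.integral_diff integrable_cis_mult gi) auto
    then have "(\<integral>\<^sup>+x. ennreal ((norm (H k x - H l x))\<^sup>2) \<partial>lborel)
      = (\<integral>\<^sup>+x. ennreal ((norm (of_real (1 / (2 * pi)) * ft (\<lambda>\<xi>. g k \<xi> - g l \<xi>) (- x)))\<^sup>2) \<partial>lborel)"
      by (simp only: H_def right_diff_distrib)
    also have "\<dots> \<le> ennreal (1 / (2 * pi)) * (\<integral>\<^sup>+\<xi>. ennreal ((norm (g k \<xi> - g l \<xi>))\<^sup>2) \<partial>lborel)"
      by (intro inverse_ft_le Bochner_Integration.integrable_diff gi)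
    \<comment> \<open>No factor 2 is lost here: both functions are truncations of \<open>G\<close>,
      so where they differ one of them vanishes and the other equals \<open>G\<close>.\<close>
    also have "\<dots> \<le> ennreal (1 / (2 * pi)) * (\<integral>\<^sup>+\<xi>. ennreal ((norm (G \<xi> - g k \<xi>))\<^sup>2) + ennreal ((norm (G \<xi> - g l \<xi>))\<^sup>2) \<partial>lborel)"
      by (intro mult_left_mono nn_integral_mono) (auto simp: g_def split: split_indicator)
    also have "\<dots> \<le> ennreal (1 / (2 * pi)) * (ennreal ((1/4) ^ k) + ennreal ((1/4) ^ l))"
      by (subst nn_integral_add) (auto intro!: mult_left_mono add_mono tail)
    also have "\<dots> = ennreal (1 / (2 * pi) * (1/4) ^ k + 1 / (2 * pi) * (1/4) ^ l)"
      by (simp add: distrib_left ennreal_mult[symmetric] ennreal_plus[symmetric] del: ennreal_plus)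
    finally show ?thesis .
  qed
  obtain h where [measurable]: "h \<in> borel_measurable borel" and lim: "AE x in lborel. (\<lambda>k. H k x) \<longlonglongrightarrow> h x"
    and hH: "\<And>k. (\<integral>\<^sup>+x. ennreal ((norm (H k x - h x))\<^sup>2) \<partial>lborel) \<le> ennreal (1 / (2 * pi) * (1/4) ^ k)"
    by (rule L2_complete[of H "1 / (2 * pi)"]) (use HH in auto)
  have bound: "(\<integral>\<^sup>+x. ennreal ((norm (H k x))\<^sup>2) \<partial>lborel)
      \<le> ennreal (1 / (2 * pi)) * (\<integral>\<^sup>+\<xi>. ennreal ((norm (G \<xi>))\<^sup>2) \<partial>lborel)" for k
  proof -
    have "(\<integral>\<^sup>+x. ennreal ((norm (H k x))\<^sup>2) \<partial>lborel)
      \<le> ennreal (1 / (2 * pi)) * (\<integral>\<^sup>+\<xi>. ennreal ((norm (g k \<xi>))\<^sup>2) \<partial>lborel)"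
      unfolding H_def by (rule inverse_ft_le[OF gi])
    also have "\<dots> \<le> ennreal (1 / (2 * pi)) * (\<integral>\<^sup>+\<xi>. ennreal ((norm (G \<xi>))\<^sup>2) \<partial>lborel)"
      by (intro mult_left_mono nn_integral_mono ennreal_leI power_mono g_le) auto
    finally show ?thesis .
  qed
  have "(\<integral>\<^sup>+x. ennreal ((norm (h x))\<^sup>2) \<partial>lborel) = (\<integral>\<^sup>+x. liminf (\<lambda>k. ennreal ((norm (H k x))\<^sup>2)) \<partial>lborel)"
  proof (rule nn_integral_cong_AE, use lim in eventually_elim)
    case (elim x)
    then have "(\<lambda>k. ennreal ((norm (H k x))\<^sup>2)) \<longlonglongrightarrow> ennreal ((norm (h x))\<^sup>2)"
      by (intro tendsto_ennrealI tendsto_intros)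
    then show ?case by (intro lim_imp_Liminf[symmetric]) auto
  qed
  also have "\<dots> \<le> liminf (\<lambda>k. \<integral>\<^sup>+x. ennreal ((norm (H k x))\<^sup>2) \<partial>lborel)"
    by (rule nn_integral_liminf) measurable
  also have "\<dots> \<le> liminf (\<lambda>k::nat. ennreal (1 / (2 * pi)) * (\<integral>\<^sup>+\<xi>. ennreal ((norm (G \<xi>))\<^sup>2) \<partial>lborel))"
    by (intro Liminf_mono always_eventually allI bound)
  finally have le: "(\<integral>\<^sup>+x. ennreal ((norm (h x))\<^sup>2) \<partial>lborel)
      \<le> ennreal (1 / (2 * pi)) * (\<integral>\<^sup>+\<xi>. ennreal ((norm (G \<xi>))\<^sup>2) \<partial>lborel)"
    by (simp add: Liminf_const)
  have "(\<integral>\<^sup>+x. ennreal ((norm (h x))\<^sup>2) \<partial>lborel) < \<infinity>"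
    using G2 by (intro order.strict_trans1[OF le]) (simp add: integrable_norm_sq_iff ennreal_mult_less_top)
  then have h2: "integrable lborel (\<lambda>x. (norm (h x))\<^sup>2)"
    by (subst integrable_norm_sq_iff) auto
  show thesis
  proof (rule that[OF _ le])
    show "square_integrable h" using h2 by (simp add: square_integrable_def)
    fix p assume p: "test_function p"
    have [measurable]: "p \<in> borel_measurable borel" by (rule test_function_measurable[OF p])
    have [measurable]: "qft p \<in> borel_measurable borel" using integrable_qft[OF p] by auto
    have H2: "integrable lborel (\<lambda>x. (norm (H k x))\<^sup>2)" for k
      using G2 by (subst integrable_norm_sq_iff, simp, intro order.strict_trans1[OF bound])
        (simp add: integrable_norm_sq_iff ennreal_mult_less_top)
    have Hp: "(LINT x|lborel. H k x * of_real (p x)) = of_real (1 / (2 * pi)) * (LINT \<xi>|lborel. g k \<xi> * qft p \<xi>)" for k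
    proof -
      have "(LINT x|lborel. ft (g k) (- x) * of_real (p x)) = (LINT x|lborel. g k x * qft p x)"
      proof -
        have "(LINT x|lborel. ft (g k) (- x) * of_real (p x)) = (LINT x|lborel. ft (\<lambda>y. g k (- y)) x * of_real (p x))"
          unfolding ft_reflect ..
        also have "\<dots> = (LINT x|lborel. g k (- x) * ft (\<lambda>x. of_real (p x)) x)"
          using test_function_integrable[OF p] by (intro ft_multiplication integrable_reflect gi) auto
        also have "\<dots> = (LINT x|lborel. g k x * qft p x)"
          using integral_reflect[of "\<lambda>x. g k x * qft p x"] by (simp add: qft_def)
        finally show ?thesis .
      qed
      then show ?thesis unfolding H_def mult.assoc integral_mult_right_zero by simp
    qed
    have "(\<lambda>k. LINT x|lborel. (H k x - h x) * of_real (p x)) \<longlonglongrightarrow> 0"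
    proof (rule integral_mult_tendsto_0)
      show "(\<lambda>k. \<integral>\<^sup>+x. ennreal ((norm (H k x - h x))\<^sup>2) \<partial>lborel) \<longlonglongrightarrow> 0"
      proof (rule tendsto_sandwich[OF always_eventually always_eventually tendsto_const])
        have "(\<lambda>k. ennreal (1 / (2 * pi) * (1/4) ^ k)) \<longlonglongrightarrow> ennreal (1 / (2 * pi) * 0)"
          by (intro tendsto_ennrealI tendsto_mult tendsto_const LIMSEQ_realpow_zero) auto
        then show "(\<lambda>k. ennreal (1 / (2 * pi) * (1/4) ^ k)) \<longlonglongrightarrow> 0" by simp
      qed (use hH in auto)
    qed (use test_function_sq_integrable[OF p] in auto)
    moreover have "(LINT x|lborel. (H k x - h x) * of_real (p x))
       = (LINT x|lborel. H k x * of_real (p x)) - (LINT x|lborel. h x * of_real (p x))" for k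
      unfolding left_diff_distrib
      by (intro Bochner_Integration.integral_diff integrable_mult_L2 H2 h2 test_function_sq_integrable p) measurable
    ultimately have 1: "(\<lambda>k. of_real (1 / (2 * pi)) * (LINT \<xi>|lborel. g k \<xi> * qft p \<xi>)) \<longlonglongrightarrow> (LINT x|lborel. h x * of_real (p x))"
      unfolding Hp by (simp only: LIM_zero_iff)
    have "(\<lambda>k. LINT \<xi>|lborel. (g k \<xi> - G \<xi>) * qft p \<xi>) \<longlonglongrightarrow> 0"
    proof (rule integral_mult_tendsto_0)
      show "(\<lambda>k. \<integral>\<^sup>+x. ennreal ((norm (g k x - G x))\<^sup>2) \<partial>lborel) \<longlonglongrightarrow> 0"
      proof (rule tendsto_sandwich[OF always_eventually always_eventually tendsto_const])
        have "(\<lambda>k. ennreal ((1/4) ^ k)) \<longlonglongrightarrow> ennreal 0"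
          by (intro tendsto_ennrealI LIMSEQ_realpow_zero) auto
        then show "(\<lambda>k. ennreal ((1/4) ^ k)) \<longlonglongrightarrow> 0" by simp
      qed (use tail in \<open>auto simp: norm_minus_commute\<close>)
    qed (use integrable_qft_sq[OF p] in auto)
    moreover have "(LINT \<xi>|lborel. (g k \<xi> - G \<xi>) * qft p \<xi>)
       = (LINT \<xi>|lborel. g k \<xi> * qft p \<xi>) - (LINT \<xi>|lborel. G \<xi> * qft p \<xi>)" for k
      unfolding left_diff_distrib
    proof (rule Bochner_Integration.integral_diff)
      show "integrable lborel (\<lambda>\<xi>. G \<xi> * qft p \<xi>)"
        by (intro integrable_mult_L2 G2 integrable_qft_sq p) measurable
      show "integrable lborel (\<lambda>\<xi>. g k \<xi> * qft p \<xi>)"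
      proof (intro integrable_mult_L2 integrable_qft_sq p)
        show "integrable lborel (\<lambda>x. (norm (g k x))\<^sup>2)"
          using g_le by (intro Bochner_Integration.integrable_bound[OF G2]) (auto intro!: power_mono)
      qed measurable
    qed
    ultimately have "(\<lambda>k. LINT \<xi>|lborel. g k \<xi> * qft p \<xi>) \<longlonglongrightarrow> (LINT \<xi>|lborel. G \<xi> * qft p \<xi>)"
      by (simp only: LIM_zero_iff)
    then have "(\<lambda>k. of_real (1 / (2 * pi)) * (LINT \<xi>|lborel. g k \<xi> * qft p \<xi>))
        \<longlonglongrightarrow> of_real (1 / (2 * pi)) * (LINT \<xi>|lborel. G \<xi> * qft p \<xi>)"
      by (intro tendsto_mult tendsto_const)
    from LIMSEQ_unique[OF 1 this]
    show "(LINT \<xi>|lborel. G \<xi> * qft p \<xi>) = of_real (2 * pi) * (LINT x|lborel. of_real (p x) * h x)"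
      by (simp add: mult.commute)
  qed
qed

text \<open>\<open>h\<close> is the inverse transform of \<open>g\<close> multiplied by the power of
  \<i> \<xi>. In the pairing with a test function this power can be moved onto \<open>qft p\<close>,
  where by \<open>qft_higher_deriv\<close> it amounts to a derivative of \<open>p\<close>.\<close>

lemma weak_derivative_of_ft:
  fixes f g :: "real \<Rightarrow> complex"
  assumes f: "square_integrable f" and g: "square_integrable g"
    and lim: "((\<lambda>R. \<integral>\<^sup>+ \<xi>. ennreal ((norm (ft (\<lambda>x. indicator {-R..R} x *\<^sub>R f x) \<xi> - g \<xi>))\<^sup>2) \<partial>lborel)
        \<longlongrightarrow> 0) at_top"
    and G: "square_integrable (\<lambda>\<xi>. (\<i> * of_real \<xi>) ^ k * g \<xi>)"
  obtains h where "square_integrable h"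
    "(\<integral>\<^sup>+x. ennreal ((norm (h x))\<^sup>2) \<partial>lborel)
      \<le> ennreal (1 / (2 * pi)) * (\<integral>\<^sup>+\<xi>. ennreal ((norm ((\<i> * of_real \<xi>) ^ k * g \<xi>))\<^sup>2) \<partial>lborel)"
    "\<And>p. test_function p \<Longrightarrow> (LINT x|lborel. of_real ((deriv ^^ k) p x) * f x) = (-1) ^ k * (LINT x|lborel. of_real (p x) * h x)"
proof -
  obtain h where h: "square_integrable h"
    "(\<integral>\<^sup>+x. ennreal ((norm (h x))\<^sup>2) \<partial>lborel)
      \<le> ennreal (1 / (2 * pi)) * (\<integral>\<^sup>+\<xi>. ennreal ((norm ((\<i> * of_real \<xi>) ^ k * g \<xi>))\<^sup>2) \<partial>lborel)"
    and hp: "\<And>p. test_function p \<Longrightarrow> (LINT \<xi>|lborel. (\<i> * of_real \<xi>) ^ k * g \<xi> * qft p \<xi>)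
       = of_real (2 * pi) * (LINT x|lborel. of_real (p x) * h x)"
    by (rule L2_inverse_ft[OF G]) blast
  have "(LINT x|lborel. of_real ((deriv ^^ k) p x) * f x) = (-1) ^ k * (LINT x|lborel. of_real (p x) * h x)"
    if p: "test_function p" for p
  proof -
    have "of_real (2 * pi) * (LINT x|lborel. of_real ((deriv ^^ k) p x) * f x)
       = (LINT \<xi>|lborel. (-1) ^ k * ((\<i> * of_real \<xi>) ^ k * g \<xi> * qft p \<xi>))"
      unfolding ft_L2_pairing[OF f g test_function_higher_deriv[OF p] lim, symmetric] qft_higher_deriv[OF p]
      by (simp add: mult_ac)
    also have "\<dots> = of_real (2 * pi) * ((-1) ^ k * (LINT x|lborel. of_real (p x) * h x))"
      unfolding integral_mult_right_zero hp[OF p] by (simp add: mult_ac)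
    finally show ?thesis by simp
  qed
  with h show thesis by (intro that[of h]) auto
qed

text \<open>Test functions are real-valued, so the exponential is split into the phases \<open>c = 0\<close> and
  \<open>c = \<pi> / 2\<close> of a cosine, cut off by a bump whose support grows with \<open>n\<close>.\<close>

lemma bump_cos_limit:
  fixes f :: "real \<Rightarrow> complex" and \<xi> c :: real and m :: nat
  defines "\<kappa> \<equiv> \<lambda>x. flat (1 * (x - (-1))) * flat (1 * (1 - x))"
  defines "\<psi> \<equiv> \<lambda>n x. \<kappa> (inverse (real (Suc n)) * x + 0) * cos (\<xi> * x + c)"
  assumes f: "integrable lborel f"
  shows "test_function (\<psi> n)"
    and "(\<lambda>n. LINT x|lborel. of_real ((deriv ^^ m) (\<psi> n) x) * f x)
      \<longlonglongrightarrow> of_real (\<kappa> 0) * (LINT x|lborel. of_real (\<xi> ^ m * cos (\<xi> * x + c + m * (pi / 2))) * f x)"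
proof -
  have \<kappa>: "test_function \<kappa>" unfolding \<kappa>_def by (rule test_function_bump) simp
  then have s\<kappa>: "smooth \<kappa>" by (simp add: test_function_iff)
  let ?s = "\<lambda>n. inverse (real (Suc n))"
  have s: "smooth (\<lambda>x. \<kappa> (?s n * x + 0))" for n by (rule smooth_affine[OF s\<kappa>])
  have tf: "test_function (\<psi> n)" for n
    unfolding test_function_iff
  proof (intro conjI exI allI impI)
    show "smooth (\<psi> n)" unfolding \<psi>_def by (intro smooth_mult s smooth_cos)
    fix x assume x: "real (Suc n) < \<bar>x\<bar>"
    then have "1 < \<bar>?s n * x + 0\<bar>" by (simp add: abs_mult field_simps)
    then have "\<kappa> (?s n * x + 0) = 0"
      unfolding \<kappa>_def by (auto intro!: flat_zero simp: abs_if split: if_splits simp del: of_nat_Suc)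
    then show "\<psi> n x = 0" by (simp add: \<psi>_def)
  qed
  then show "test_function (\<psi> n)" .
  have "\<exists>B. \<forall>x. \<bar>(deriv ^^ i) \<kappa> x\<bar> \<le> B" for i
  proof -
    obtain R B where RB: "R > 0" "B > 0" "\<And>x. \<bar>(deriv ^^ i) \<kappa> x\<bar> \<le> B * indicator {-R..R} x"
      by (rule test_function_bound[OF test_function_higher_deriv[OF \<kappa>, of i]]) blast
    have "\<bar>(deriv ^^ i) \<kappa> x\<bar> \<le> B" for x
      using RB(2) RB(3)[of x] by (cases "x \<in> {-R..R}") auto
    then show ?thesis by blast
  qed
  then obtain B where B: "\<And>i x. \<bar>(deriv ^^ i) \<kappa> x\<bar> \<le> B i" by metis
  let ?t = "\<lambda>n x i. real (m choose i) * (?s n ^ i * (deriv ^^ i) \<kappa> (?s n * x + 0) *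
      (\<xi> ^ (m - i) * cos (\<xi> * x + c + real (m - i) * (pi / 2))))"
  have d: "(deriv ^^ m) (\<psi> n) x = (\<Sum>i\<le>m. ?t n x i)" for n x
    unfolding \<psi>_def higher_deriv_mult_real[OF s smooth_cos] higher_deriv_affine[OF s\<kappa>] higher_deriv_cos ..
  \<comment> \<open>A bound uniform in \<open>n\<close> and \<open>x\<close>, since the scale
    factors and the cosines are at most 1 in modulus.\<close>
  define K where "K = (\<Sum>i\<le>m. real (m choose i) * (1 * B i * (\<bar>\<xi>\<bar> ^ (m - i) * 1)))"
  have K: "\<bar>(deriv ^^ m) (\<psi> n) x\<bar> \<le> K" for n x
    unfolding d K_def
  proof (intro order_trans[OF sum_abs] sum_mono)
    fix i
    have "\<bar>?s n ^ i\<bar> \<le> 1" by (simp add: power_abs power_le_one field_simps)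
    then show "\<bar>?t n x i\<bar> \<le> real (m choose i) * (1 * B i * (\<bar>\<xi>\<bar> ^ (m - i) * 1))"
      unfolding abs_mult power_abs
      by (intro mult_mono B) (use B[of i] in \<open>auto simp: power_abs intro: order_trans[OF abs_ge_zero]\<close>)
  qed
  have lim: "(\<lambda>n. (deriv ^^ m) (\<psi> n) x) \<longlonglongrightarrow> \<kappa> 0 * (\<xi> ^ m * cos (\<xi> * x + c + m * (pi / 2)))" for x
  proof -
    have c: "(\<lambda>n. (deriv ^^ i) \<kappa> (?s n * x + 0)) \<longlonglongrightarrow> (deriv ^^ i) \<kappa> (0 * x + 0)" for i
    proof (rule continuous_on_tendsto_compose[of UNIV "(deriv ^^ i) \<kappa>" "\<lambda>n. ?s n * x + 0" "0 * x + 0"])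
      show "continuous_on UNIV ((deriv ^^ i) \<kappa>)"
        using test_function_higher_deriv[OF \<kappa>, of i] by (auto simp: test_function_iff smooth_continuous)
      show "(\<lambda>n. ?s n * x + 0) \<longlonglongrightarrow> 0 * x + 0"
        by (intro tendsto_add tendsto_mult tendsto_const LIMSEQ_inverse_real_of_nat)
    qed auto
    have "(\<lambda>n. \<Sum>i\<le>m. ?t n x i) \<longlonglongrightarrow> (\<Sum>i\<le>m. real (m choose i) * (0 ^ i * (deriv ^^ i) \<kappa> (0 * x + 0) *
      (\<xi> ^ (m - i) * cos (\<xi> * x + c + real (m - i) * (pi / 2)))))"
      by (intro tendsto_sum tendsto_mult tendsto_const c tendsto_power LIMSEQ_inverse_real_of_nat)
    \<comment> \<open>Every derivative that falls on the bump brings a factor 1 / (n + 1), so in the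
      limit only the term with all derivatives on the cosine survives.\<close>
    also have "(\<Sum>i\<le>m. real (m choose i) * (0 ^ i * (deriv ^^ i) \<kappa> (0 * x + 0) *
      (\<xi> ^ (m - i) * cos (\<xi> * x + c + real (m - i) * (pi / 2)))))
      = (\<Sum>i\<in>{0}. real (m choose i) * (0 ^ i * (deriv ^^ i) \<kappa> (0 * x + 0) *
      (\<xi> ^ (m - i) * cos (\<xi> * x + c + real (m - i) * (pi / 2)))))"
      by (rule sum.mono_neutral_right) auto
    also have "\<dots> = \<kappa> 0 * (\<xi> ^ m * cos (\<xi> * x + c + m * (pi / 2)))" by simp
    finally show ?thesis unfolding d .
  qed
  have [measurable]: "f \<in> borel_measurable borel" using f by auto
  have [measurable]: "(deriv ^^ m) (\<psi> n) \<in> borel_measurable borel" for n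
    by (rule test_function_measurable[OF test_function_higher_deriv[OF tf]])
  have "(\<lambda>n. LINT x|lborel. of_real ((deriv ^^ m) (\<psi> n) x) * f x)
      \<longlonglongrightarrow> (LINT x|lborel. of_real (\<kappa> 0 * (\<xi> ^ m * cos (\<xi> * x + c + m * (pi / 2)))) * f x)"
  proof (rule integral_dominated_convergence[where w = "\<lambda>x. K * norm (f x)"])
    show "integrable lborel (\<lambda>x. K * norm (f x))" using f by simp
    show "AE x in lborel. (\<lambda>n. complex_of_real ((deriv ^^ m) (\<psi> n) x) * f x)
      \<longlonglongrightarrow> of_real (\<kappa> 0 * (\<xi> ^ m * cos (\<xi> * x + c + m * (pi / 2)))) * f x"
      by (intro AE_I2 tendsto_mult tendsto_const tendsto_of_real lim)
    show "AE x in lborel. norm (complex_of_real ((deriv ^^ m) (\<psi> n) x) * f x) \<le> K * norm (f x)" for n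
      unfolding norm_mult norm_of_real by (intro AE_I2 mult_right_mono K norm_ge_zero)
  qed measurable
  also have "(LINT x|lborel. of_real (\<kappa> 0 * (\<xi> ^ m * cos (\<xi> * x + c + m * (pi / 2)))) * f x)
     = of_real (\<kappa> 0) * (LINT x|lborel. of_real (\<xi> ^ m * cos (\<xi> * x + c + m * (pi / 2))) * f x)"
    unfolding of_real_mult[of "\<kappa> 0"] mult.assoc[of "of_real (\<kappa> 0)"] by (rule integral_mult_right_zero)
  finally show "(\<lambda>n. LINT x|lborel. of_real ((deriv ^^ m) (\<psi> n) x) * f x)
      \<longlonglongrightarrow> of_real (\<kappa> 0) * (LINT x|lborel. of_real (\<xi> ^ m * cos (\<xi> * x + c + m * (pi / 2))) * f x)" .
qed

text \<open>The factor \<open>flat 1 ^ 4\<close> is the squared height at 0 of the bump \<open>flat (1 + x) * flat (1 - x)\<close>.\<close>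

lemma ft_of_weak_derivative:
  fixes f w :: "real \<Rightarrow> complex"
  assumes f: "integrable lborel f" and w: "square_integrable w"
    and fw: "\<And>p. test_function p \<Longrightarrow>
      (LINT x|lborel. of_real ((deriv ^^ m) p x) * f x) = (-1) ^ m * (LINT x|lborel. of_real (p x) * w x)"
  shows "ennreal (flat 1 ^ 4) * (\<integral>\<^sup>+\<xi>. ennreal ((\<bar>\<xi>\<bar> ^ m * norm (ft f \<xi>))\<^sup>2) \<partial>lborel)
      \<le> ennreal (2 * pi) * (\<integral>\<^sup>+x. ennreal ((norm (w x))\<^sup>2) \<partial>lborel)"
proof -
  have [measurable]: "w \<in> borel_measurable borel" and w2: "integrable lborel (\<lambda>x. (norm (w x))\<^sup>2)"
    using w by (auto simp: square_integrable_def)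
  have [measurable]: "f \<in> borel_measurable borel" using f by auto
  define \<kappa> where "\<kappa> = (\<lambda>x. flat (1 * (x - (-1))) * flat (1 * (1 - x)))"
  let ?\<kappa> = "\<lambda>n x. \<kappa> (inverse (real (Suc n)) * x + 0)"
  have \<kappa>0: "\<kappa> 0 = flat 1 ^ 2" by (simp add: \<kappa>_def power2_eq_square)
  have \<kappa>1: "\<bar>\<kappa> x\<bar> \<le> 1" for x
    unfolding \<kappa>_def by (simp add: abs_mult flat_nonneg flat_le_1 mult_le_one)
  have tf: "test_function (?\<kappa> n)" for n
    using bump_cos_limit(1)[OF f, of n 0 0] unfolding \<kappa>_def by simp
  have [measurable]: "?\<kappa> n \<in> borel_measurable borel" for n by (rule test_function_measurable[OF tf])
  let ?\<psi> = "\<lambda>\<xi> c n x. ?\<kappa> n x * cos (\<xi> * x + c)"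
  have tf\<psi>: "test_function (?\<psi> \<xi> c n)" for \<xi> c n
    using bump_cos_limit(1)[OF f, of n \<xi> c] unfolding \<kappa>_def .
  let ?I = "\<lambda>\<xi> c. LINT x|lborel. of_real (\<xi> ^ m * cos (\<xi> * x + c + m * (pi / 2))) * f x"
  let ?J = "\<lambda>\<xi> c n. LINT x|lborel. of_real (?\<psi> \<xi> c n x) * w x"
  have lim: "(\<lambda>n. (-1) ^ m * ?J \<xi> c n) \<longlonglongrightarrow> of_real (\<kappa> 0) * ?I \<xi> c" for \<xi> c
    using bump_cos_limit(2)[OF f, of m \<xi> c] fw[OF tf\<psi>] unfolding \<kappa>_def by (simp del: of_nat_Suc)
  \<comment> \<open>\<open>w\<close> is only square-integrable, so its transform need not be an
    integral. Multiplied by \<open>?\<kappa> n\<close> it becomes integrable, and Plancherel's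
    inequality then holds with a bound independent of \<open>n\<close>.\<close>
  have wi: "integrable lborel (\<lambda>x. of_real (p x) * w x)" if "test_function p" for p
    using test_function_measurable[OF that]
    by (intro integrable_mult_L2 test_function_sq_integrable that w2) auto
  \<comment> \<open>Since cos (y + pi / 2) = - sin y, the exponential exp (- i y) equals cos y + i
    cos (y + pi / 2).\<close>
  have J: "ft (\<lambda>x. of_real (?\<kappa> n x) * w x) \<xi> = ?J \<xi> 0 n + \<i> * ?J \<xi> (pi / 2) n" for n \<xi>
  proof -
    have "ft (\<lambda>x. of_real (?\<kappa> n x) * w x) \<xi>
      = (LINT x|lborel. of_real (?\<psi> \<xi> 0 n x) * w x + \<i> * (of_real (?\<psi> \<xi> (pi / 2) n x) * w x))"
      unfolding ft_def
      by (intro Bochner_Integration.integral_cong refl)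
        (simp add: cis.code complex_eq_iff cos_add algebra_simps del: of_nat_Suc)
    also have "\<dots> = ?J \<xi> 0 n + (LINT x|lborel. \<i> * (of_real (?\<psi> \<xi> (pi / 2) n x) * w x))"
      by (intro Bochner_Integration.integral_add integrable_mult_right wi tf\<psi>)
    finally show ?thesis by (simp only: integral_mult_right_zero)
  qed
  \<comment> \<open>After \<open>m\<close> derivatives both phases are advanced by m pi / 2, which
    changes the exponential only by a factor of modulus 1.\<close>
  have I: "?I \<xi> 0 + \<i> * ?I \<xi> (pi / 2) = of_real (\<xi> ^ m) * cis (- (m * (pi / 2))) * ft f \<xi>" for \<xi>
  proof -
    have ii: "integrable lborel (\<lambda>x. of_real (\<xi> ^ m * cos (\<xi> * x + c + m * (pi / 2))) * f x)" for c
    proof (rule Bochner_Integration.integrable_bound)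
      show "integrable lborel (\<lambda>x. \<bar>\<xi> ^ m\<bar> * norm (f x))" using f by simp
      show "AE x in lborel. norm (of_real (\<xi> ^ m * cos (\<xi> * x + c + m * (pi / 2))) * f x) \<le> norm (\<bar>\<xi> ^ m\<bar> * norm (f x))"
      proof (rule AE_I2)
        fix x
        have "\<bar>\<xi> ^ m * cos (\<xi> * x + c + m * (pi / 2))\<bar> \<le> \<bar>\<xi> ^ m\<bar>"
          unfolding abs_mult by (intro mult_left_le abs_cos_le_one abs_ge_zero)
        then have "\<bar>\<xi> ^ m * cos (\<xi> * x + c + m * (pi / 2))\<bar> * norm (f x) \<le> \<bar>\<xi> ^ m\<bar> * norm (f x)"
          by (intro mult_right_mono norm_ge_zero)
        then show "norm (of_real (\<xi> ^ m * cos (\<xi> * x + c + m * (pi / 2))) * f x) \<le> norm (\<bar>\<xi> ^ m\<bar> * norm (f x))"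
          by (simp only: norm_mult[of "of_real _"] norm_of_real) simp
      qed
    qed measurable
    have "?I \<xi> 0 + \<i> * ?I \<xi> (pi / 2) = (LINT x|lborel. of_real (\<xi> ^ m * cos (\<xi> * x + 0 + m * (pi / 2))) * f x
        + \<i> * (of_real (\<xi> ^ m * cos (\<xi> * x + pi / 2 + m * (pi / 2))) * f x))"
      by (subst Bochner_Integration.integral_add, rule ii, intro integrable_mult_right ii)
        (simp only: integral_mult_right_zero)
    also have "\<dots> = (LINT x|lborel. of_real (\<xi> ^ m) * cis (- (m * (pi / 2))) * (cis (- (\<xi> * x)) * f x))"
    proof (intro Bochner_Integration.integral_cong refl)
      fix x
      have "cos (\<xi> * x + pi / 2 + m * (pi / 2)) = cos ((\<xi> * x + m * (pi / 2)) + pi / 2)"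
        by (simp add: algebra_simps)
      also have "\<dots> = - sin (\<xi> * x + m * (pi / 2))" by (simp only: cos_add) simp
      finally have 1: "cos (\<xi> * x + pi / 2 + m * (pi / 2)) = - sin (\<xi> * x + m * (pi / 2))" .
      have "cis (- (m * (pi / 2))) * cis (- (\<xi> * x)) = cis (- (\<xi> * x + m * (pi / 2)))"
        by (simp add: cis_mult algebra_simps)
      moreover have "cis (- (\<xi> * x + m * (pi / 2)))
          = of_real (cos (\<xi> * x + m * (pi / 2))) - \<i> * of_real (sin (\<xi> * x + m * (pi / 2)))"
        by (simp add: complex_eq_iff del: minus_add_distrib)
      ultimately have 2: "cis (- (m * (pi / 2))) * (cis (- (\<xi> * x)) * f x)
         = (of_real (cos (\<xi> * x + m * (pi / 2))) - \<i> * of_real (sin (\<xi> * x + m * (pi / 2)))) * f x"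
        by (simp only: mult.assoc[symmetric])
      show "of_real (\<xi> ^ m * cos (\<xi> * x + 0 + m * (pi / 2))) * f x
          + \<i> * (of_real (\<xi> ^ m * cos (\<xi> * x + pi / 2 + m * (pi / 2))) * f x)
        = of_real (\<xi> ^ m) * cis (- (m * (pi / 2))) * (cis (- (\<xi> * x)) * f x)"
        unfolding 1 mult.assoc[of "of_real (\<xi> ^ m)"] 2 by (simp add: algebra_simps)
    qed
    also have "\<dots> = of_real (\<xi> ^ m) * cis (- (m * (pi / 2))) * ft f \<xi>"
      unfolding ft_def by (rule integral_mult_right_zero)
    finally show ?thesis .
  qed
  let ?F = "\<lambda>n \<xi>. ennreal ((norm (ft (\<lambda>x. of_real (?\<kappa> n x) * w x) \<xi>))\<^sup>2)"
  have ptw: "(\<lambda>n. ?F n \<xi>) \<longlonglongrightarrow> ennreal (flat 1 ^ 4 * (\<bar>\<xi>\<bar> ^ m * norm (ft f \<xi>))\<^sup>2)" for \<xi>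
  proof -
    have "(\<lambda>n. (-1) ^ m * ?J \<xi> 0 n + \<i> * ((-1) ^ m * ?J \<xi> (pi / 2) n))
        \<longlonglongrightarrow> of_real (\<kappa> 0) * ?I \<xi> 0 + \<i> * (of_real (\<kappa> 0) * ?I \<xi> (pi / 2))"
      by (intro tendsto_add tendsto_mult[OF tendsto_const] lim)
    then have "(\<lambda>n. (-1) ^ m * ft (\<lambda>x. of_real (?\<kappa> n x) * w x) \<xi>) \<longlonglongrightarrow> of_real (\<kappa> 0) * (?I \<xi> 0 + \<i> * ?I \<xi> (pi / 2))"
      unfolding J by (simp add: algebra_simps del: of_nat_Suc)
    then have "(\<lambda>n. ennreal ((norm ((-1) ^ m * ft (\<lambda>x. of_real (?\<kappa> n x) * w x) \<xi>))\<^sup>2))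
       \<longlonglongrightarrow> ennreal ((norm (of_real (\<kappa> 0) * (?I \<xi> 0 + \<i> * ?I \<xi> (pi / 2))))\<^sup>2)"
      by (intro tendsto_ennrealI tendsto_power tendsto_norm)
    moreover have "(norm (of_real (\<kappa> 0) * (?I \<xi> 0 + \<i> * ?I \<xi> (pi / 2))))\<^sup>2 = flat 1 ^ 4 * (\<bar>\<xi>\<bar> ^ m * norm (ft f \<xi>))\<^sup>2"
      unfolding I norm_mult norm_of_real norm_cis power_abs \<kappa>0 by (simp add: power_mult_distrib)
    moreover have "norm ((-1) ^ m * z) = norm z" for z :: complex by (simp add: norm_mult norm_power)
    ultimately show ?thesis by simp
  qed
  have "ennreal (flat 1 ^ 4) * (\<integral>\<^sup>+\<xi>. ennreal ((\<bar>\<xi>\<bar> ^ m * norm (ft f \<xi>))\<^sup>2) \<partial>lborel)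
     = (\<integral>\<^sup>+\<xi>. ennreal (flat 1 ^ 4 * (\<bar>\<xi>\<bar> ^ m * norm (ft f \<xi>))\<^sup>2) \<partial>lborel)"
    by (subst nn_integral_cmult[symmetric]) (auto simp: ennreal_mult)
  also have "\<dots> = (\<integral>\<^sup>+\<xi>. liminf (\<lambda>n. ?F n \<xi>) \<partial>lborel)"
    by (intro nn_integral_cong lim_imp_Liminf[symmetric] ptw) auto
  also have "\<dots> \<le> liminf (\<lambda>n. \<integral>\<^sup>+\<xi>. ?F n \<xi> \<partial>lborel)"
    by (rule nn_integral_liminf) measurable
  also have "\<dots> \<le> liminf (\<lambda>n::nat. ennreal (2 * pi) * (\<integral>\<^sup>+x. ennreal ((norm (w x))\<^sup>2) \<partial>lborel))"
  proof (intro Liminf_mono always_eventually allI)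
    fix n
    have "(\<integral>\<^sup>+\<xi>. ?F n \<xi> \<partial>lborel) \<le> ennreal (2 * pi) * (\<integral>\<^sup>+x. ennreal ((norm (of_real (?\<kappa> n x) * w x))\<^sup>2) \<partial>lborel)"
      by (rule plancherel_le[OF wi[OF tf]])
    also have "\<dots> \<le> ennreal (2 * pi) * (\<integral>\<^sup>+x. ennreal ((norm (w x))\<^sup>2) \<partial>lborel)"
    proof (intro mult_left_mono nn_integral_mono ennreal_leI power_mono)
      show "norm (complex_of_real (?\<kappa> n x) * w x) \<le> norm (w x)" for x
        unfolding norm_mult norm_of_real by (intro mult_left_le_one_le \<kappa>1) auto
    qed auto
    finally show "(\<integral>\<^sup>+\<xi>. ?F n \<xi> \<partial>lborel) \<le> ennreal (2 * pi) * (\<integral>\<^sup>+x. ennreal ((norm (w x))\<^sup>2) \<partial>lborel)" .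
  qed
  finally show ?thesis by (simp add: Liminf_const)
qed

section \<open>Exponential decay from a resolvent bound\<close>

lemma matrix_pow_vec:
  fixes A :: "complex ^ 'n ^ 'n"
  shows "(((**) A ^^ k) (mat 1)) *v x = ((*v) A ^^ k) x"
  by (induction k) (auto simp: matrix_vector_mul_assoc[symmetric])

lemma bounded_linear_matrix_vector_mult:
  fixes A :: "complex ^ 'n ^ 'm"
  shows "bounded_linear ((*v) A)"
  by (rule linear_conv_bounded_linear[THEN iffD1], rule linearI)
    (simp_all add: vec_eq_iff matrix_vector_mult_def scaleR_sum_right sum.distrib distrib_left)

lemma bounded_linear_matrix_vector_mult_left:
  fixes x :: "complex ^ 'n"
  shows "bounded_linear (\<lambda>A :: complex ^ 'n ^ 'm. A *v x)"
  by (rule linear_conv_bounded_linear[THEN iffD1], rule linearI)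
    (simp_all add: vec_eq_iff matrix_vector_mult_def scaleR_sum_right sum.distrib distrib_right)

lemma bounded_linear_matrix_matrix_mult:
  fixes A :: "complex ^ 'n ^ 'm"
  shows "bounded_linear (\<lambda>B :: complex ^ 'p ^ 'n. A ** B)"
  by (rule linear_conv_bounded_linear[THEN iffD1], rule linearI)
    (simp_all add: vec_eq_iff matrix_matrix_mult_def scaleR_sum_right sum.distrib distrib_left)

lemma matrix_pow_scaleR:
  fixes A :: "complex ^ 'n ^ 'n"
  shows "((**) (t *\<^sub>R A) ^^ k) (mat 1) = t ^ k *\<^sub>R (((**) A ^^ k) (mat 1))"
  by (induction k) (simp_all add: vec_eq_iff matrix_matrix_mult_def scaleR_sum_right mult.commute)

lemma funpow_norm_le:
  fixes f :: "'a::real_normed_vector \<Rightarrow> 'a"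
  assumes "\<And>x. norm (f x) \<le> K * norm x" "K \<ge> 0"
  shows "norm ((f ^^ k) x) \<le> K ^ k * norm x"
proof (induction k)
  case (Suc k)
  have "norm ((f ^^ Suc k) x) \<le> K * norm ((f ^^ k) x)" using assms(1) by simp
  also have "\<dots> \<le> K * (K ^ k * norm x)" using Suc assms(2) by (rule mult_left_mono)
  finally show ?case by (simp add: mult.assoc)
qed simp

lemma summable_exp_funpow:
  fixes f :: "'a::{banach} \<Rightarrow> 'a"
  assumes "bounded_linear f"
  shows "summable (\<lambda>k. (t ^ k / fact k) *\<^sub>R (f ^^ k) x)"
proof -
  obtain K where K: "K > 0" "\<And>x. norm (f x) \<le> norm x * K"
    using bounded_linear.pos_bounded[OF assms] by blast
  have s: "summable (\<lambda>k. ((\<bar>t\<bar> * K) ^ k /\<^sub>R fact k) * norm x)"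
    by (intro summable_mult2 summable_exp_generic)
  show ?thesis
  proof (rule summable_comparison_test[OF _ s], intro exI allI impI)
    fix k
    have "norm ((t ^ k / fact k) *\<^sub>R (f ^^ k) x) = \<bar>t\<bar> ^ k / fact k * norm ((f ^^ k) x)"
      by (simp add: power_abs)
    also have "\<dots> \<le> \<bar>t\<bar> ^ k / fact k * (K ^ k * norm x)"
      using K by (intro mult_left_mono funpow_norm_le) (auto simp: mult.commute)
    finally show "norm ((t ^ k / fact k) *\<^sub>R (f ^^ k) x) \<le> ((\<bar>t\<bar> * K) ^ k /\<^sub>R fact k) * norm x"
      by (simp add: power_mult_distrib divide_inverse mult_ac)
  qed
qed

lemma mat_exp_vec:
  fixes A :: "complex ^ 'n ^ 'n"
  shows "mat_exp (t *\<^sub>R A) *v x = (\<Sum>k. (t ^ k / fact k) *\<^sub>R ((*v) A ^^ k) x)"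
proof -
  have s: "summable (\<lambda>k. (t ^ k / fact k) *\<^sub>R ((**) A ^^ k) (mat 1))"
    by (rule summable_exp_funpow[OF bounded_linear_matrix_matrix_mult])
  have "mat_exp (t *\<^sub>R A) = (\<Sum>k. (t ^ k / fact k) *\<^sub>R ((**) A ^^ k) (mat 1))"
    unfolding mat_exp_def matrix_pow_scaleR by (simp add: mult.commute)
  then have "mat_exp (t *\<^sub>R A) *v x = (\<Sum>k. ((t ^ k / fact k) *\<^sub>R ((**) A ^^ k) (mat 1)) *v x)"
    using bounded_linear.suminf[OF bounded_linear_matrix_vector_mult_left s, of x] by simp
  then show ?thesis
    by (simp add: scaleR_matrix_vector_assoc[symmetric] matrix_pow_vec
        linear_cmul[OF bounded_linear.linear[OF bounded_linear_matrix_vector_mult_left]])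
qed

text \<open>Each component of an orbit is a power series in \<open>t\<close> with complex
  coefficients that converges everywhere, so it can be differentiated term by term.\<close>

lemma mat_exp_ode:
  fixes A :: "complex ^ 'n ^ 'n"
  shows "((\<lambda>t. (mat_exp (t *\<^sub>R A) *v x) $ i) has_vector_derivative (A *v (mat_exp (t *\<^sub>R A) *v x)) $ i) (at t)"
proof -
  let ?a = "\<lambda>k. ((*v) A ^^ k) x"
  have bl: "bounded_linear (\<lambda>v :: complex ^ 'n. v $ i)" by (rule bounded_linear_vec_nth)
  have s: "summable (\<lambda>k. (t ^ k / fact k) *\<^sub>R ?a k)" for t
    by (rule summable_exp_funpow[OF bounded_linear_matrix_vector_mult])
  define c where "c k = (?a k $ i) / fact k" for k
  have comp: "((t ^ k / fact k) *\<^sub>R ?a k) $ i = c k * complex_of_real t ^ k" for t k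
    by (simp add: c_def scaleR_conv_of_real[where 'a=complex])
  have W: "(mat_exp (t *\<^sub>R A) *v x) $ i = (\<Sum>k. c k * complex_of_real t ^ k)" for t
    unfolding mat_exp_vec comp[symmetric] by (rule bounded_linear.suminf[OF bl s])
  \<comment> \<open>Convergence is known at real arguments; the argument \<open>norm z + 1\<close>
    places \<open>z\<close> strictly inside the disc of convergence.\<close>
  have "summable (\<lambda>k. c k * z ^ k)" for z
  proof (rule powser_inside)
    show "summable (\<lambda>k. c k * complex_of_real (norm z + 1) ^ k)"
      unfolding comp[symmetric] by (rule bounded_linear.summable[OF bl s])
  qed (auto simp del: of_real_add)
  then have "((\<lambda>z. \<Sum>k. c k * z ^ k) has_field_derivative (\<Sum>k. diffs c k * z ^ k)) (at z)" for z
    by (rule termdiffs_strong_converges_everywhere)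
  then have d: "((\<lambda>t. \<Sum>k. c k * complex_of_real t ^ k) has_vector_derivative (\<Sum>k. diffs c k * complex_of_real t ^ k)) (at t)"
    by (rule has_vector_derivative_real_field)
  have "(A *v (mat_exp (t *\<^sub>R A) *v x)) $ i = (\<Sum>k. (A *v ((t ^ k / fact k) *\<^sub>R ?a k)) $ i)"
    unfolding mat_exp_vec bounded_linear.suminf[OF bounded_linear_matrix_vector_mult s]
    by (rule bounded_linear.suminf[OF bl bounded_linear.summable[OF bounded_linear_matrix_vector_mult s]])
  also have "\<dots> = (\<Sum>k. diffs c k * complex_of_real t ^ k)"
    by (intro suminf_cong)
      (simp add: diffs_def c_def linear_cmul[OF bounded_linear.linear[OF bounded_linear_matrix_vector_mult]]
        scaleR_conv_of_real[where 'a=complex] field_simps del: of_nat_Suc)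
  finally show ?thesis using d unfolding W by simp
qed

lemma mat_exp_0_vec: "mat_exp (0 *\<^sub>R A) *v x = x"
  for A :: "complex ^ 'n ^ 'n"
proof -
  have "(\<Sum>k. (0 ^ k / fact k) *\<^sub>R ((*v) A ^^ k) x) = (\<Sum>k\<in>{0::nat}. (0 ^ k / fact k) *\<^sub>R ((*v) A ^^ k) x)"
    by (rule suminf_finite) auto
  then show ?thesis unfolding mat_exp_vec by simp
qed

section \<open>Energy decay by a cutoff in time\<close>

definition energy :: "('n \<Rightarrow> real) \<Rightarrow> complex ^ 'n \<Rightarrow> real" where
  "energy \<kappa> x = (\<Sum>i\<in>UNIV. \<kappa> i * (norm (x $ i))\<^sup>2)"

lemma norm_sq_vec: "(norm x)\<^sup>2 = (\<Sum>i\<in>UNIV. (norm (x $ i))\<^sup>2)" for x :: "complex ^ 'n"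
  by (simp add: norm_vec_def L2_set_def sum_nonneg)

lemma energy_bounds:
  fixes x :: "complex ^ 'n"
  assumes "\<And>i. a \<le> \<kappa> i" "\<And>i. \<kappa> i \<le> b"
  shows "a * (norm x)\<^sup>2 \<le> energy \<kappa> x" "energy \<kappa> x \<le> b * (norm x)\<^sup>2"
  unfolding energy_def norm_sq_vec sum_distrib_left
  by (intro sum_mono mult_right_mono assms zero_le_power2)+

lemma energy_antimono:
  fixes w :: "real \<Rightarrow> complex ^ 'n"
  assumes ode: "\<And>i t. ((\<lambda>t. w t $ i) has_vector_derivative (A *v w t) $ i) (at t)"
    and diss: "\<And>x. (\<Sum>i\<in>UNIV. \<kappa> i * (x $ i \<bullet> (A *v x) $ i)) \<le> 0"
    and st: "s \<le> t"
  shows "energy \<kappa> (w t) \<le> energy \<kappa> (w s)"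
proof (rule DERIV_nonpos_imp_nonincreasing[OF st])
  fix x
  have "((\<lambda>t. energy \<kappa> (w t)) has_vector_derivative
     (\<Sum>i\<in>UNIV. \<kappa> i * (w x $ i \<bullet> (A *v w x) $ i + (A *v w x) $ i \<bullet> w x $ i))) (at x)"
    unfolding energy_def power2_norm_eq_inner
    by (intro has_vector_derivative_sum has_vector_derivative_mult_right
        bounded_bilinear.has_vector_derivative[OF bounded_bilinear_inner] ode)
  moreover have "(\<Sum>i\<in>UNIV. \<kappa> i * (w x $ i \<bullet> (A *v w x) $ i + (A *v w x) $ i \<bullet> w x $ i)) \<le> 0"
  proof -
    have "(\<Sum>i\<in>UNIV. \<kappa> i * (w x $ i \<bullet> (A *v w x) $ i + (A *v w x) $ i \<bullet> w x $ i))
        = 2 * (\<Sum>i\<in>UNIV. \<kappa> i * (w x $ i \<bullet> (A *v w x) $ i))"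
      unfolding sum_distrib_left by (intro sum.cong refl) (simp add: inner_commute)
    then show ?thesis using diss[of "w x"] by simp
  qed
  ultimately show "\<exists>y. ((\<lambda>t. energy \<kappa> (w t)) has_real_derivative y) (at x) \<and> y \<le> 0"
    unfolding has_real_derivative_iff_has_vector_derivative by blast
qed

text \<open>The cutoff \<open>t (T - t)\<close> vanishes at both ends of \<open>[0, T]\<close>, so the time Fourier transform of the
  cut-off solution solves the resolvent equation, with the transform of \<open>(T - 2 t) u(t)\<close> as
  right-hand side; Plancherel's identity transfers the resolvent bound to the time side.\<close>

lemma cutoff_resolvent_estimate:
  fixes u :: "real \<Rightarrow> complex ^ 'n"
  assumes ode: "\<And>i t. ((\<lambda>t. u t $ i) has_vector_derivative (A *v u t) $ i) (at t)"
    and res: "\<And>\<omega> x. norm x \<le> M * norm ((\<i> * of_real \<omega>) *s x - A *v x)"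
    and T: "0 < T" and M: "0 \<le> M"
  shows "(\<integral>\<^sup>+t. ennreal ((max 0 (t * (T - t)) * norm (u t))\<^sup>2) \<partial>lborel)
    \<le> ennreal (M\<^sup>2) * (\<integral>\<^sup>+t. ennreal ((indicator {0..T} t * (T - 2 * t) * norm (u t))\<^sup>2) \<partial>lborel)"
proof -
  have cu: "continuous_on S (\<lambda>t. u t $ i)" for i S
    using ode has_vector_derivative_continuous continuous_at_imp_continuous_on by blast
  have cAu: "continuous_on S (\<lambda>t. (A *v u t) $ i)" for i S
    unfolding matrix_vector_mult_def by (simp, intro continuous_intros cu)
  \<comment> \<open>With \<open>max\<close>, the cut-off solution is continuous on the whole line,
    as \<open>plancherel_ge\<close> demands. \<open>f\<close> may jump at 0 and \<open>T\<close>,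
    but only the upper bound \<open>plancherel_le\<close> is applied to it.\<close>
  define g where "g i t = of_real (max 0 (t * (T - t))) * u t $ i" for i t
  define f where "f i t = indicator {0..T} t *\<^sub>R (of_real (T - 2 * t) * u t $ i)" for i t
  have mx: "max 0 (t * (T - t)) = indicator {0..T} t * (t * (T - t))" for t
    using T by (auto simp: indicator_def max_def mult_le_0_iff zero_le_mult_iff)
  have g_ind: "g i t = indicator {0..T} t *\<^sub>R (of_real (t * (T - t)) * u t $ i)" for i t
    unfolding g_def mx by (simp add: scaleR_conv_of_real)
  have cg: "continuous_on S (g i)" for i S
    unfolding g_def by (intro continuous_intros cu)
  have icomp: "integrable lborel (\<lambda>t. indicator {0..T} t *\<^sub>R h t)" if "continuous_on UNIV h" for h :: "real \<Rightarrow> complex"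
    using borel_integrable_compact[of "{0..T}" h] continuous_on_subset[OF that] by auto
  have gi: "integrable lborel (g i)" for i
    unfolding g_ind[abs_def] by (intro icomp continuous_intros cu)
  have fi: "integrable lborel (f i)" for i
    unfolding f_def[abs_def] by (intro icomp continuous_intros cu)
  have [measurable]: "g i \<in> borel_measurable borel" "f i \<in> borel_measurable borel" for i
    using gi fi by auto
  have "\<exists>B. \<forall>t\<in>{0..T}. norm (g i t) \<le> B" for i
  proof -
    have "bounded (g i ` {0..T})"
      by (intro compact_imp_bounded compact_continuous_image cg) auto
    then show ?thesis by (auto simp: bounded_iff)
  qed
  then obtain B where B: "\<And>i t. t \<in> {0..T} \<Longrightarrow> norm (g i t) \<le> B i" by metis
  have gB: "norm (g i t) \<le> max 0 (B i)" for i t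
    using B[of t i] by (cases "t \<in> {0..T}") (auto simp: g_ind)
  have eq: "\<i> * of_real \<omega> * ft (g i) \<omega> - (\<Sum>j\<in>UNIV. A $ i $ j * ft (g j) \<omega>) = ft (f i) \<omega>" for i \<omega>
  proof -
    let ?c = "\<lambda>t. cis (- (\<omega> * t))"
    let ?p = "\<lambda>t. complex_of_real (t * (T - t))"
    \<comment> \<open>The derivative of phase times cutoff times solution. Its integral over [0, T]
      is 0, because the cutoff vanishes at both ends, and written out this is the resolvent equation
      for the transforms.\<close>
    let ?D = "\<lambda>t. ?c t * (?p t * (A *v u t) $ i + of_real (T - 2 * t) * u t $ i) + (- (\<i> * of_real \<omega>) * ?c t) * (?p t * u t $ i)"
    have dc: "(?c has_vector_derivative - (\<i> * of_real \<omega>) * ?c t) (at t)" for t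
      unfolding cis_conv_exp
      by (auto intro!: derivative_eq_intros has_vector_derivative_real_field simp: field_simps)
    have "((\<lambda>t. t * (T - t)) has_vector_derivative (T - 2 * t)) (at t)" for t
      unfolding has_real_derivative_iff_has_vector_derivative[symmetric]
      by (auto intro!: derivative_eq_intros)
    then have dp: "(?p has_vector_derivative of_real (T - 2 * t)) (at t)" for t
      by (rule bounded_linear.has_vector_derivative[OF bounded_linear_of_real])
    have "(LINT t|lborel. indicator {0..T} t *\<^sub>R ?D t)
        = ?c T * (?p T * u T $ i) - ?c 0 * (?p 0 * u 0 $ i)"
    proof (rule integral_FTC_Icc)
      have "continuous_on {0..T} (\<lambda>t. ?c t * (?p t * v t + of_real (T - 2 * t) * z t) + (- (\<i> * of_real \<omega>) * ?c t) * (?p t * z t))"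
        if "continuous_on {0..T} v" "continuous_on {0..T} z" for v z :: "real \<Rightarrow> complex"
        by (intro continuous_intros that)
      from this[OF cAu cu] show "continuous_on {0..T} ?D" .
      fix t
      show "((\<lambda>t. ?c t * (?p t * u t $ i)) has_vector_derivative ?D t) (at t within {0..T})"
        by (intro has_vector_derivative_at_within[OF has_vector_derivative_mult[OF dc has_vector_derivative_mult[OF dp ode]]])
    qed (use T in auto)
    then have 0: "(LINT t|lborel. indicator {0..T} t *\<^sub>R ?D t) = 0" by simp
    have D: "indicator {0..T} t *\<^sub>R ?D t = (\<Sum>j\<in>UNIV. A $ i $ j * (?c t * g j t)) + ?c t * f i t
       + (- (\<i> * of_real \<omega>)) * (?c t * g i t)" for t
      by (cases "t \<in> {0..T}")
        (simp_all add: g_ind f_def matrix_vector_mult_def sum_distrib_left distrib_left mult_ac)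
    have ic: "integrable lborel (\<lambda>t. ?c t * h t)" if "integrable lborel h" for h
      by (rule integrable_cis_mult[OF that]) measurable
    have "(LINT t|lborel. indicator {0..T} t *\<^sub>R ?D t) = (LINT t|lborel. (\<Sum>j\<in>UNIV. A $ i $ j * (?c t * g j t)) + ?c t * f i t)
        + (LINT t|lborel. (- (\<i> * of_real \<omega>)) * (?c t * g i t))"
      unfolding D
      by (intro Bochner_Integration.integral_add Bochner_Integration.integrable_add
          Bochner_Integration.integrable_sum integrable_mult_right ic gi fi)
    also have "(LINT t|lborel. (\<Sum>j\<in>UNIV. A $ i $ j * (?c t * g j t)) + ?c t * f i t)
        = (LINT t|lborel. (\<Sum>j\<in>UNIV. A $ i $ j * (?c t * g j t))) + (LINT t|lborel. ?c t * f i t)"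
      by (intro Bochner_Integration.integral_add Bochner_Integration.integrable_sum integrable_mult_right ic gi fi)
    also have "(LINT t|lborel. (\<Sum>j\<in>UNIV. A $ i $ j * (?c t * g j t))) = (\<Sum>j\<in>UNIV. LINT t|lborel. A $ i $ j * (?c t * g j t))"
      by (intro Bochner_Integration.integral_sum integrable_mult_right ic gi)
    finally show ?thesis
      using 0 unfolding integral_mult_right_zero ft_def[symmetric] by (simp add: algebra_simps)
  qed
  define G where "G \<omega> = (\<chi> i. ft (g i) \<omega>)" for \<omega>
  define F where "F \<omega> = (\<chi> i. ft (f i) \<omega>)" for \<omega>
  have "(\<i> * of_real \<omega>) *s G \<omega> - A *v G \<omega> = F \<omega>" for \<omega>
    using eq by (simp add: vec_eq_iff G_def F_def matrix_vector_mult_def)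
  then have GF: "norm (G \<omega>) \<le> M * norm (F \<omega>)" for \<omega>
    using res[of "G \<omega>" \<omega>] by simp
  have sq: "(\<Sum>i\<in>UNIV. ennreal ((norm (h i x))\<^sup>2)) = ennreal (\<Sum>i\<in>UNIV. (norm (h i x))\<^sup>2)" for h :: "'n \<Rightarrow> real \<Rightarrow> complex" and x
    by (rule sum_ennreal) auto
  have gu: "(\<Sum>i\<in>UNIV. (norm (g i t))\<^sup>2) = (max 0 (t * (T - t)) * norm (u t))\<^sup>2" for t
    unfolding power_mult_distrib norm_sq_vec[of "u t"] sum_distrib_left
    by (intro sum.cong refl) (simp add: g_def norm_mult power_mult_distrib)
  have fu: "(\<Sum>i\<in>UNIV. (norm (f i t))\<^sup>2) = (indicator {0..T} t * (T - 2 * t) * norm (u t))\<^sup>2" for t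
    unfolding power_mult_distrib norm_sq_vec[of "u t"] sum_distrib_left
    unfolding f_def norm_scaleR norm_mult norm_of_real power_mult_distrib power2_abs by (simp add: mult.assoc)
  have "ennreal (2 * pi) * (\<integral>\<^sup>+t. ennreal ((max 0 (t * (T - t)) * norm (u t))\<^sup>2) \<partial>lborel)
     = (\<Sum>i\<in>UNIV. ennreal (2 * pi) * (\<integral>\<^sup>+t. ennreal ((norm (g i t))\<^sup>2) \<partial>lborel))"
    unfolding gu[symmetric] sq[symmetric] by (subst nn_integral_sum) (auto simp: sum_distrib_left)
  also have "\<dots> \<le> (\<Sum>i\<in>UNIV. \<integral>\<^sup>+\<omega>. ennreal ((norm (ft (g i) \<omega>))\<^sup>2) \<partial>lborel)"
    by (intro sum_mono plancherel_ge[OF gi cg gB])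
  also have "\<dots> = (\<integral>\<^sup>+\<omega>. ennreal ((norm (G \<omega>))\<^sup>2) \<partial>lborel)"
    unfolding norm_sq_vec G_def by (subst nn_integral_sum[symmetric]) (auto simp: sq[of "\<lambda>i. ft (g i)"])
  also have "\<dots> \<le> (\<integral>\<^sup>+\<omega>. ennreal (M\<^sup>2) * ennreal ((norm (F \<omega>))\<^sup>2) \<partial>lborel)"
  proof (rule nn_integral_mono)
    fix \<omega>
    have "(norm (G \<omega>))\<^sup>2 \<le> M\<^sup>2 * (norm (F \<omega>))\<^sup>2"
      using power_mono[OF GF norm_ge_zero, of \<omega> 2] by (simp add: power_mult_distrib)
    then show "ennreal ((norm (G \<omega>))\<^sup>2) \<le> ennreal (M\<^sup>2) * ennreal ((norm (F \<omega>))\<^sup>2)"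
      by (subst ennreal_mult[symmetric]) (auto intro: ennreal_leI)
  qed
  also have "\<dots> = (\<Sum>i\<in>UNIV. ennreal (M\<^sup>2) * (\<integral>\<^sup>+\<omega>. ennreal ((norm (ft (f i) \<omega>))\<^sup>2) \<partial>lborel))"
    unfolding norm_sq_vec F_def vec_lambda_beta sq[of "\<lambda>i. ft (f i)", symmetric] sum_distrib_left
    by (subst nn_integral_sum) (auto intro!: sum.cong nn_integral_cmult)
  also have "\<dots> \<le> (\<Sum>i\<in>UNIV. ennreal (M\<^sup>2) * (ennreal (2 * pi) * (\<integral>\<^sup>+t. ennreal ((norm (f i t))\<^sup>2) \<partial>lborel)))"
    by (intro sum_mono mult_left_mono plancherel_le fi) auto
  also have "\<dots> = ennreal (2 * pi) * (ennreal (M\<^sup>2) * (\<Sum>i\<in>UNIV. \<integral>\<^sup>+t. ennreal ((norm (f i t))\<^sup>2) \<partial>lborel))"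
    by (simp add: sum_distrib_left mult_ac)
  also have "(\<Sum>i\<in>UNIV. \<integral>\<^sup>+t. ennreal ((norm (f i t))\<^sup>2) \<partial>lborel)
      = (\<integral>\<^sup>+t. ennreal ((indicator {0..T} t * (T - 2 * t) * norm (u t))\<^sup>2) \<partial>lborel)"
    unfolding fu[symmetric] sq[symmetric] by (subst nn_integral_sum) auto
  finally show ?thesis
    by (subst (asm) ennreal_mult_le_mult_iff) auto
qed

text \<open>On [T / 4, T / 2] the cutoff is at least T^2 / 8 and the energy at least its final
  value, so the integral on the left of \<open>cutoff_resolvent_estimate\<close> is at least T^5 /
  256 times the final energy over \<open>b\<close>. The right-hand side is at most M^2 T^3 times the
  initial energy over \<open>a\<close>. Their quotient is the stated factor.\<close>

lemma energy_decay_step: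
  fixes u :: "real \<Rightarrow> complex ^ 'n"
  assumes ode: "\<And>i t. ((\<lambda>t. u t $ i) has_vector_derivative (A *v u t) $ i) (at t)"
    and diss: "\<And>x. (\<Sum>i\<in>UNIV. \<kappa> i * (x $ i \<bullet> (A *v x) $ i)) \<le> 0"
    and a: "0 < a" "\<And>i. a \<le> \<kappa> i" and b: "\<And>i. \<kappa> i \<le> b"
    and res: "\<And>\<omega> x. norm x \<le> M * norm ((\<i> * of_real \<omega>) *s x - A *v x)"
    and T: "0 < T" and M: "0 \<le> M"
  shows "energy \<kappa> (u T) \<le> 256 * (b / a) * M\<^sup>2 / T\<^sup>2 * energy \<kappa> (u 0)"
proof -
  have b0: "0 < b" using a b order_less_le_trans order_trans by blast
  have en: "a * (norm x)\<^sup>2 \<le> energy \<kappa> x" "energy \<kappa> x \<le> b * (norm x)\<^sup>2" for x :: "complex ^ 'n"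
    using energy_bounds[of a \<kappa> b x] a b by auto
  have en0: "0 \<le> energy \<kappa> x" for x :: "complex ^ 'n"
    using en(1)[of x] a by (meson mult_nonneg_nonneg less_imp_le order_trans zero_le_power2)
  let ?E = "energy \<kappa> (u T)" and ?I = "energy \<kappa> (u 0)"
  have "ennreal (T ^ 4 / 64 * (?E / b) * (T / 4)) = (\<integral>\<^sup>+t. ennreal (T ^ 4 / 64 * (?E / b)) * indicator {T/4..T/2} t \<partial>lborel)"
    using T en0[of "u T"] b0 by (subst nn_integral_cmult_indicator) (auto simp: ennreal_mult[symmetric])
  also have "\<dots> \<le> (\<integral>\<^sup>+t. ennreal ((max 0 (t * (T - t)) * norm (u t))\<^sup>2) \<partial>lborel)"
  proof (rule nn_integral_mono)
    fix t
    show "ennreal (T ^ 4 / 64 * (?E / b)) * indicator {T/4..T/2} t \<le> ennreal ((max 0 (t * (T - t)) * norm (u t))\<^sup>2)"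
    proof (cases "t \<in> {T/4..T/2}")
      case True
      have "T / 4 * (T / 2) \<le> t * (T - t)" using True T by (intro mult_mono) auto
      also have "\<dots> \<le> max 0 (t * (T - t))" by simp
      finally have "(T / 4 * (T / 2))\<^sup>2 \<le> (max 0 (t * (T - t)))\<^sup>2" using T by (intro power_mono) auto
      moreover have "?E / b \<le> (norm (u t))\<^sup>2"
      proof -
        have "?E \<le> energy \<kappa> (u t)" using True T by (intro energy_antimono[OF ode diss]) auto
        also have "\<dots> \<le> b * (norm (u t))\<^sup>2" by (rule en)
        finally show ?thesis using b0 by (simp add: field_simps)
      qed
      ultimately have h: "(T / 4 * (T / 2))\<^sup>2 * (?E / b) \<le> (max 0 (t * (T - t)))\<^sup>2 * (norm (u t))\<^sup>2"
        using en0[of "u T"] b0 by (intro mult_mono) auto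
      have "(T / 4 * (T / 2))\<^sup>2 = T ^ 4 / 64" by (simp add: field_simps power2_eq_square power4_eq_xxxx)
      then have "T ^ 4 / 64 * (?E / b) \<le> (max 0 (t * (T - t)) * norm (u t))\<^sup>2"
        using h unfolding power_mult_distrib[of "max 0 (t * (T - t))"] by (simp only:)
      then show ?thesis using True by (simp add: ennreal_leI)
    qed simp
  qed
  also have "\<dots> \<le> ennreal (M\<^sup>2) * (\<integral>\<^sup>+t. ennreal ((indicator {0..T} t * (T - 2 * t) * norm (u t))\<^sup>2) \<partial>lborel)"
    by (rule cutoff_resolvent_estimate[OF ode res T M])
  also have "\<dots> \<le> ennreal (M\<^sup>2) * (\<integral>\<^sup>+t. ennreal (T\<^sup>2 * (?I / a)) * indicator {0..T} t \<partial>lborel)"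
  proof (intro mult_left_mono nn_integral_mono)
    fix t
    show "ennreal ((indicator {0..T} t * (T - 2 * t) * norm (u t))\<^sup>2) \<le> ennreal (T\<^sup>2 * (?I / a)) * indicator {0..T} t"
    proof (cases "t \<in> {0..T}")
      case True
      have "\<bar>T - 2 * t\<bar> \<le> T" using True by auto
      then have "(T - 2 * t)\<^sup>2 \<le> T\<^sup>2" using power_mono[of "\<bar>T - 2 * t\<bar>" T 2] by simp
      moreover have "(norm (u t))\<^sup>2 \<le> ?I / a"
      proof -
        have "a * (norm (u t))\<^sup>2 \<le> energy \<kappa> (u t)" by (rule en)
        also have "\<dots> \<le> ?I" using True by (intro energy_antimono[OF ode diss]) auto
        finally show ?thesis using a by (simp add: field_simps)
      qed
      ultimately have "(T - 2 * t)\<^sup>2 * (norm (u t))\<^sup>2 \<le> T\<^sup>2 * (?I / a)" by (intro mult_mono) auto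
      then show ?thesis using True by (simp add: power_mult_distrib ennreal_leI)
    qed simp
  qed simp
  also have "\<dots> = ennreal (M\<^sup>2 * (T\<^sup>2 * (?I / a) * T))"
    using T en0[of "u 0"] a by (subst nn_integral_cmult_indicator) (auto simp: ennreal_mult[symmetric])
  finally have "T ^ 4 / 64 * (?E / b) * (T / 4) \<le> M\<^sup>2 * (T\<^sup>2 * (?I / a) * T)"
    using T en0[of "u 0"] a by (subst (asm) ennreal_le_iff) auto
  moreover have "T ^ 3 * (T\<^sup>2 * (?E / b)) = 256 * (T ^ 4 / 64 * (?E / b) * (T / 4))"
    by (simp add: power2_eq_square power3_eq_cube power4_eq_xxxx)
  moreover have "T ^ 3 * (256 * M\<^sup>2 * (?I / a)) = 256 * (M\<^sup>2 * (T\<^sup>2 * (?I / a) * T))"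
    by (simp add: power2_eq_square power3_eq_cube)
  ultimately have "T ^ 3 * (T\<^sup>2 * (?E / b)) \<le> T ^ 3 * (256 * M\<^sup>2 * (?I / a))" by linarith
  then have "T\<^sup>2 * (?E / b) \<le> 256 * M\<^sup>2 * (?I / a)"
    by (rule mult_left_le_imp_le) (use T in simp)
  then show ?thesis using T a b0 by (simp add: field_simps)
qed

text \<open>A quantitative form of the Gearhart-Pruess theorem. The rate depends on the matrix only
  through \<open>M\<close>, and on the weights through \<open>b / a\<close>, so it can be followed
  as the frequency \<xi> varies.\<close>

lemma resolvent_bound_imp_decay:
  fixes w :: "real \<Rightarrow> complex ^ 'n"
  assumes ode: "\<And>i t. ((\<lambda>t. w t $ i) has_vector_derivative (A *v w t) $ i) (at t)"
    and diss: "\<And>x. (\<Sum>i\<in>UNIV. \<kappa> i * (x $ i \<bullet> (A *v x) $ i)) \<le> 0"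
    and a: "0 < a" "\<And>i. a \<le> \<kappa> i" and b: "\<And>i. \<kappa> i \<le> b"
    and res: "\<And>\<omega> x. norm x \<le> M * norm ((\<i> * of_real \<omega>) *s x - A *v x)"
    and M: "0 < M" and t: "0 \<le> t"
  shows "(norm (w t))\<^sup>2 \<le> 3 * (b / a) * exp (- (t / (32 * sqrt (b / a) * M))) * (norm (w 0))\<^sup>2"
proof -
  have b0: "0 < b" using a b order_less_le_trans order_trans by blast
  \<comment> \<open>Makes the factor of \<open>energy_decay_step\<close> equal to 256 / 32^2 = 1 /
    4.\<close>
  define T where "T = 32 * sqrt (b / a) * M"
  have T: "0 < T" using a b0 M by (simp add: T_def)
  have en: "a * (norm x)\<^sup>2 \<le> energy \<kappa> x" "energy \<kappa> x \<le> b * (norm x)\<^sup>2" for x :: "complex ^ 'n"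
    using energy_bounds[of a \<kappa> b x] a b by auto
  have en0: "0 \<le> energy \<kappa> x" for x :: "complex ^ 'n"
    using en(1)[of x] a by (meson mult_nonneg_nonneg less_imp_le order_trans zero_le_power2)
  have T2: "256 * (b / a) * M\<^sup>2 / T\<^sup>2 = 1 / 4"
    using a b0 M by (simp add: T_def power_mult_distrib field_simps)
  have step: "energy \<kappa> (w (s + T)) \<le> 1 / 4 * energy \<kappa> (w s)" for s
  proof -
    have "((\<lambda>t. w (s + t) $ i) has_vector_derivative (A *v w (s + t)) $ i) (at t)" for i t
    proof -
      have "((\<lambda>t. s + t) has_vector_derivative 1) (at t)"
        unfolding has_real_derivative_iff_has_vector_derivative[symmetric]
        by (auto intro!: derivative_eq_intros)
      from vector_diff_chain_at[OF this ode] show ?thesis by (simp add: o_def)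
    qed
    from energy_decay_step[OF this diss a b res T less_imp_le[OF M]]
    show ?thesis unfolding T2 by simp
  qed
  have iter: "energy \<kappa> (w (real n * T)) \<le> (1 / 4) ^ n * energy \<kappa> (w 0)" for n
  proof (induction n)
    case (Suc n)
    have "energy \<kappa> (w (real (Suc n) * T)) \<le> 1 / 4 * energy \<kappa> (w (real n * T))"
      using step[of "real n * T"] by (simp add: algebra_simps)
    also have "\<dots> \<le> 1 / 4 * ((1 / 4) ^ n * energy \<kappa> (w 0))" using Suc by simp
    finally show ?case by simp
  qed simp
  define n where "n = nat \<lfloor>t / T\<rfloor>"
  have n: "real n \<le> t / T" "t / T \<le> real n + 1"
    using t T unfolding n_def by (auto simp: of_nat_nat)
  \<comment> \<open>The bound e <= 3 is used twice: 1 / 4 <= 1 / e turns the powers into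
    exponentials, and rounding t / T down costs a factor e.\<close>
  have e1: "exp 1 \<le> (3::real)" by (rule exp_le)
  have "(1 / 4) ^ n \<le> exp (- 1 :: real) ^ n"
    using e1 by (intro power_mono) (auto simp: exp_minus field_simps)
  also have "\<dots> = exp (- real n)" by (simp add: exp_of_nat_mult[symmetric])
  also have "\<dots> \<le> exp (1 + - (t / T))" using n by simp
  also have "\<dots> \<le> 3 * exp (- (t / T))" using e1 by (simp only: exp_add) simp
  finally have n2: "(1 / 4) ^ n \<le> 3 * exp (- (t / T))" .
  have "a * (norm (w t))\<^sup>2 \<le> energy \<kappa> (w t)" by (rule en)
  also have "\<dots> \<le> energy \<kappa> (w (real n * T))"
    using n T by (intro energy_antimono[OF ode diss]) (simp add: field_simps)
  also have "\<dots> \<le> (1 / 4) ^ n * energy \<kappa> (w 0)" by (rule iter)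
  also have "\<dots> \<le> 3 * exp (- (t / T)) * (b * (norm (w 0))\<^sup>2)"
    by (intro mult_mono n2 en) (auto simp: en0)
  finally show ?thesis using a by (simp add: T_def field_simps)
qed

section \<open>The resolvent equation of the beam\<close>

text \<open>Componentwise form of \<open>(\<i> \<omega> - A \<xi>) U = f\<close>, with \<open>d\<close> the damping factor of \<open>\<eta>\<close>. The constant \<open>B\<close>
  bounds all coefficients from above and below. The lemma \<open>solve8_y\<close> estimates \<open>y\<close> from the eighth
  equation, and so on. Besides \<open>f\<close>, the bounds on the solution involve only \<open>\<eta>\<close>, which the
  dissipation controls.\<close>

locale beam_resolvent =
  fixes k1 k2 k3 k4 \<gamma> d B \<xi> \<omega> E x w :: real
    and v u z y \<phi> \<theta> \<sigma> \<eta> f1 f2 f3 f4 f5 f6 f7 f8 :: complex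
  assumes eq1: "\<i> * \<omega> * v - (\<i> * \<xi> * u + y + \<theta>) = f1"
    and eq2: "\<i> * \<omega> * u - k1 * (\<i> * \<xi> * v) = f2"
    and eq3: "\<i> * \<omega> * z - \<i> * \<xi> * y = f3"
    and eq4: "\<i> * \<omega> * y - (k2 * (\<i> * \<xi> * z) - k1 * v - \<gamma> * (\<i> * \<xi> * \<eta>)) = f4"
    and eq5: "\<i> * \<omega> * \<phi> - \<i> * \<xi> * \<theta> = f5"
    and eq6: "\<i> * \<omega> * \<theta> - (k3 * (\<i> * \<xi> * \<phi>) - k1 * v) = f6"
    and eq7: "\<i> * \<omega> * \<sigma> - \<i> * \<xi> * \<eta> = f7"
    and eq8: "\<i> * \<omega> * \<eta> - (k4 * (\<i> * \<xi> * \<sigma>) - d * \<eta> - \<gamma> * (\<i> * \<xi> * y)) = f8"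
    and E: "norm f1 \<le> E" "norm f2 \<le> E" "norm f3 \<le> E" "norm f4 \<le> E"
      "norm f5 \<le> E" "norm f6 \<le> E" "norm f7 \<le> E" "norm f8 \<le> E"
    and pos: "0 < k1" "0 < k2" "0 < k3" "0 < k4" "0 \<le> d"
    and up: "k1 \<le> B" "k2 \<le> B" "k3 \<le> B" "k4 \<le> B" "\<bar>\<gamma>\<bar> \<le> B"
    and low: "1 \<le> B * k1" "1 \<le> B * k2" "1 \<le> B * k3" "1 \<le> B * k4" "1 \<le> B * \<bar>\<gamma>\<bar>"
    and B1: "1 \<le> B" and x_pos: "0 < x" and x: "\<bar>\<xi>\<bar> = x" and w: "\<bar>\<omega>\<bar> = w"
begin

text \<open>A sum of moduli instead of the Euclidean norm, so that bounds on the components can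
  simply be added.\<close>

abbreviation "S \<equiv> norm v + norm u + norm z + norm y + norm \<phi> + norm \<theta> + norm \<sigma> + norm \<eta>"

lemma w_nonneg: "0 \<le> w" using w by (metis abs_ge_zero)
lemma E_nonneg: "0 \<le> E" using E(1) norm_ge_zero order_trans by blast
lemma B_pos: "0 < B" using B1 by simp

lemma norm_sum4_le:
  fixes X p q r s :: complex
  assumes "X = p + q + r + s" shows "norm X \<le> norm p + norm q + norm r + norm s"
  unfolding assms by (intro norm_triangle_le add_right_mono order_refl)

text \<open>Multiplication by \<open>B\<close> replaces division by a coefficient, which leaves
  every estimate polynomial in the single constant \<open>B\<close>.\<close>

lemma div_le: "1 \<le> B * k \<Longrightarrow> 0 \<le> X \<Longrightarrow> k * X \<le> R \<Longrightarrow> X \<le> B * R" for k X R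
proof -
  assume "1 \<le> B * k" "0 \<le> X" and le: "k * X \<le> R"
  then have "1 * X \<le> (B * k) * X" by (intro mult_right_mono)
  also have "\<dots> \<le> B * R" using le B_pos by (simp add: mult.assoc mult_left_mono)
  finally show "X \<le> B * R" by simp
qed

lemma up_mult: "0 \<le> X \<Longrightarrow> k1 * X \<le> B * X" "0 \<le> X \<Longrightarrow> k2 * X \<le> B * X" "0 \<le> X \<Longrightarrow> k3 * X \<le> B * X"
  "0 \<le> X \<Longrightarrow> k4 * X \<le> B * X" "0 \<le> X \<Longrightarrow> \<bar>\<gamma>\<bar> * X \<le> B * X"
  using up by (auto intro: mult_right_mono)

lemma abs_pos: "\<bar>k1\<bar> = k1" "\<bar>k2\<bar> = k2" "\<bar>k3\<bar> = k3" "\<bar>k4\<bar> = k4"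
  using pos by simp_all

lemmas norms = norm_mult norm_minus_cancel norm_of_real norm_ii mult_1_left mult.assoc
  norm_zero add_0_right abs_pos x w

lemma x_norm_nonneg: "0 \<le> x * norm q" for q :: complex
  using x_pos by simp

lemma damped_norm_le: "norm (\<i> * \<omega> + d) * norm \<eta> \<le> (w + d) * norm \<eta>"
  using pos w
  by (intro mult_right_mono order_trans[OF norm_triangle_ineq]) (auto simp: norm_mult)

section \<open>Single equations solved for one unknown\<close>

lemma solve1_u: "x * norm u \<le> w * norm v + norm y + norm \<theta> + E"
proof -
  have "\<i> * \<xi> * u = \<i> * \<omega> * v + - y + - \<theta> + - f1"
    unfolding eq1[symmetric] by (simp add: algebra_simps)
  from norm_sum4_le[OF this, unfolded norms] show ?thesis
    using E(1) by linarith
qed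

lemma solve1_v: "w * norm v \<le> x * norm u + norm y + norm \<theta> + E"
proof -
  have "\<i> * \<omega> * v = \<i> * \<xi> * u + y + \<theta> + f1"
    unfolding eq1[symmetric] by (simp add: algebra_simps)
  from norm_sum4_le[OF this, unfolded norms] show ?thesis
    using E(1) by linarith
qed

lemma solve1_\<theta>: "norm \<theta> \<le> w * norm v + x * norm u + norm y + E"
proof -
  have "\<theta> = \<i> * \<omega> * v + - (\<i> * \<xi> * u) + - y + - f1"
    unfolding eq1[symmetric] by (simp add: algebra_simps)
  from norm_sum4_le[OF this, unfolded norms] show ?thesis
    using E(1) by linarith
qed

lemma solve2_u: "w * norm u \<le> B * (x * norm v) + E"
proof -
  have "\<i> * \<omega> * u = k1 * (\<i> * \<xi> * v) + f2 + 0 + 0"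
    unfolding eq2[symmetric] by (simp add: algebra_simps)
  from norm_sum4_le[OF this, unfolded norms] show ?thesis
    using E(2) up_mult(1)[OF x_norm_nonneg[of "v"]] by linarith
qed

lemma solve2_v: "x * norm v \<le> B * (w * norm u + E)"
proof -
  have "k1 * (\<i> * \<xi> * v) = \<i> * \<omega> * u + - f2 + 0 + 0"
    unfolding eq2[symmetric] by (simp add: algebra_simps)
  from norm_sum4_le[OF this, unfolded norms] have "k1 * (x * norm v) \<le> w * norm u + E"
    using E(2) by linarith
  then show ?thesis using x_pos by (intro div_le[OF low(1)]) auto
qed

lemma solve3_z: "w * norm z \<le> x * norm y + E"
proof -
  have "\<i> * \<omega> * z = \<i> * \<xi> * y + f3 + 0 + 0"
    unfolding eq3[symmetric] by (simp add: algebra_simps)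
  from norm_sum4_le[OF this, unfolded norms] show ?thesis
    using E(3) by linarith
qed

lemma solve3_y: "x * norm y \<le> w * norm z + E"
proof -
  have "\<i> * \<xi> * y = \<i> * \<omega> * z + - f3 + 0 + 0"
    unfolding eq3[symmetric] by (simp add: algebra_simps)
  from norm_sum4_le[OF this, unfolded norms] show ?thesis
    using E(3) by linarith
qed

lemma solve4_z: "x * norm z \<le> B * (w * norm y + B * norm v + B * (x * norm \<eta>) + E)"
proof -
  have "k2 * (\<i> * \<xi> * z) = \<i> * \<omega> * y + k1 * v + \<gamma> * (\<i> * \<xi> * \<eta>) + - f4"
    unfolding eq4[symmetric] by (simp add: algebra_simps)
  from norm_sum4_le[OF this, unfolded norms] have "k2 * (x * norm z) \<le> w * norm y + B * norm v + B * (x * norm \<eta>) + E"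
    using E(4) up_mult(1)[OF norm_ge_zero[of v]] up_mult(5)[OF x_norm_nonneg[of "\<eta>"]] by linarith
  then show ?thesis using x_pos by (intro div_le[OF low(2)]) auto
qed

lemma solve4_v: "norm v \<le> B * (w * norm y + B * (x * norm z) + B * (x * norm \<eta>) + E)"
proof -
  have "k1 * v = - (\<i> * \<omega> * y) + k2 * (\<i> * \<xi> * z) + - (\<gamma> * (\<i> * \<xi> * \<eta>)) + f4"
    unfolding eq4[symmetric] by (simp add: algebra_simps)
  from norm_sum4_le[OF this, unfolded norms] have "k1 * (norm v) \<le> w * norm y + B * (x * norm z) + B * (x * norm \<eta>) + E"
    using E(4) up_mult(2)[OF x_norm_nonneg[of "z"]] up_mult(5)[OF x_norm_nonneg[of "\<eta>"]] by linarith
  then show ?thesis using x_pos by (intro div_le[OF low(1)]) auto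
qed

lemma solve4_y: "w * norm y \<le> B * (x * norm z) + B * norm v + B * (x * norm \<eta>) + E"
proof -
  have "\<i> * \<omega> * y = - (k1 * v) + k2 * (\<i> * \<xi> * z) + - (\<gamma> * (\<i> * \<xi> * \<eta>)) + f4"
    unfolding eq4[symmetric] by (simp add: algebra_simps)
  from norm_sum4_le[OF this, unfolded norms] show ?thesis
    using E(4) up_mult(2)[OF x_norm_nonneg[of "z"]] up_mult(5)[OF x_norm_nonneg[of "\<eta>"]] up_mult(1)[OF norm_ge_zero[of v]] by linarith
qed

lemma solve5_\<phi>: "w * norm \<phi> \<le> x * norm \<theta> + E"
proof -
  have "\<i> * \<omega> * \<phi> = \<i> * \<xi> * \<theta> + f5 + 0 + 0"
    unfolding eq5[symmetric] by (simp add: algebra_simps)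
  from norm_sum4_le[OF this, unfolded norms] show ?thesis
    using E(5) by linarith
qed

lemma solve5_\<theta>: "x * norm \<theta> \<le> w * norm \<phi> + E"
proof -
  have "\<i> * \<xi> * \<theta> = \<i> * \<omega> * \<phi> + - f5 + 0 + 0"
    unfolding eq5[symmetric] by (simp add: algebra_simps)
  from norm_sum4_le[OF this, unfolded norms] show ?thesis
    using E(5) by linarith
qed

lemma solve6_\<phi>: "x * norm \<phi> \<le> B * (w * norm \<theta> + B * norm v + E)"
proof -
  have "k3 * (\<i> * \<xi> * \<phi>) = \<i> * \<omega> * \<theta> + k1 * v + - f6 + 0"
    unfolding eq6[symmetric] by (simp add: algebra_simps)
  from norm_sum4_le[OF this, unfolded norms] have "k3 * (x * norm \<phi>) \<le> w * norm \<theta> + B * norm v + E"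
    using E(6) up_mult(1)[OF norm_ge_zero[of v]] by linarith
  then show ?thesis using x_pos by (intro div_le[OF low(3)]) auto
qed

lemma solve6_\<theta>: "w * norm \<theta> \<le> B * (x * norm \<phi>) + B * norm v + E"
proof -
  have "\<i> * \<omega> * \<theta> = k3 * (\<i> * \<xi> * \<phi>) + - (k1 * v) + f6 + 0"
    unfolding eq6[symmetric] by (simp add: algebra_simps)
  from norm_sum4_le[OF this, unfolded norms] show ?thesis
    using E(6) up_mult(1)[OF norm_ge_zero[of v]] up_mult(3)[OF x_norm_nonneg[of "\<phi>"]] by linarith
qed

lemma solve7_\<sigma>: "w * norm \<sigma> \<le> x * norm \<eta> + E"
proof -
  have "\<i> * \<omega> * \<sigma> = \<i> * \<xi> * \<eta> + f7 + 0 + 0"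
    unfolding eq7[symmetric] by (simp add: algebra_simps)
  from norm_sum4_le[OF this, unfolded norms] show ?thesis
    using E(7) by linarith
qed

lemma solve8_y: "x * norm y \<le> B * ((w + d) * norm \<eta> + B * (x * norm \<sigma>) + E)"
proof -
  have "\<gamma> * (\<i> * \<xi> * y) = - ((\<i> * \<omega> + d) * \<eta>) + k4 * (\<i> * \<xi> * \<sigma>) + f8 + 0"
    unfolding eq8[symmetric] by (simp add: algebra_simps)
  from norm_sum4_le[OF this, unfolded norms] have "\<bar>\<gamma>\<bar> * (x * norm y) \<le> (w + d) * norm \<eta> + B * (x * norm \<sigma>) + E"
    using E(8) up_mult(4)[OF x_norm_nonneg[of "\<sigma>"]] damped_norm_le by linarith
  then show ?thesis using x_pos by (intro div_le[OF low(5)]) auto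
qed

lemma solve8_\<sigma>: "x * norm \<sigma> \<le> B * ((w + d) * norm \<eta> + B * (x * norm y) + E)"
proof -
  have "k4 * (\<i> * \<xi> * \<sigma>) = (\<i> * \<omega> + d) * \<eta> + \<gamma> * (\<i> * \<xi> * y) + - f8 + 0"
    unfolding eq8[symmetric] by (simp add: algebra_simps)
  from norm_sum4_le[OF this, unfolded norms] have "k4 * (x * norm \<sigma>) \<le> (w + d) * norm \<eta> + B * (x * norm y) + E"
    using E(8) up_mult(5)[OF x_norm_nonneg[of "y"]] damped_norm_le by linarith
  then show ?thesis using x_pos by (intro div_le[OF low(4)]) auto
qed

text \<open>The number \<open>\<i> * \<omega> + d\<close> has modulus at least \<open>w\<close>, so
  the damping, which for second-order dissipation is unbounded in \<xi>, drops out of this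
  bound.\<close>

lemma solve8_\<eta>: "w * norm \<eta> \<le> B * (x * norm \<sigma>) + B * (x * norm y) + E"
proof -
  have "w * norm \<eta> \<le> norm ((\<i> * \<omega> + d) * \<eta>)"
    unfolding norm_mult by (intro mult_right_mono) (use abs_Im_le_cmod[of "\<i> * \<omega> + d"] w in auto)
  also have "\<dots> \<le> norm (k4 * (\<i> * \<xi> * \<sigma>)) + norm (- (\<gamma> * (\<i> * \<xi> * y))) + norm f8 + norm (0::complex)"
    by (rule norm_sum4_le) (use eq8 in \<open>simp add: algebra_simps\<close>)
  also have "\<dots> \<le> B * (x * norm \<sigma>) + B * (x * norm y) + E"
    unfolding norms using up_mult(4)[OF x_norm_nonneg[of \<sigma>]] up_mult(5)[OF x_norm_nonneg[of y]] E(8) by linarith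
  finally show ?thesis .
qed

section \<open>Estimates for small, large and intermediate \<omega>\<close>

lemma pow_B_mono: "0 \<le> Q \<Longrightarrow> m \<le> n \<Longrightarrow> B ^ m * Q \<le> B ^ n * Q"
  using B1 by (intro mult_right_mono power_increasing)

text \<open>For small \<open>\<omega>\<close> the terms containing \<open>w\<close> contribute at most half of \<open>S\<close> and are absorbed.\<close>

lemma small_frequency:
  assumes \<omega>: "48 * B ^ 3 * w \<le> m" and m0: "0 < m" and mx: "m \<le> x" "m \<le> x * x"
  shows "S \<le> 48 * B ^ 3 * (E / m + (1 + d / x) * norm \<eta>)"
proof -
  \<comment> \<open>Chosen so that the final factor \<open>24 * B ^ 3\<close> turns the contribution
    of the terms with \<open>w\<close> into \<open>T / 2\<close>.\<close>
  define \<delta> where "\<delta> = 1 / (48 * B ^ 3)"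
  define e where "e = E / m"
  define T where "T = S"
  define \<alpha> where "\<alpha> = \<delta> * T + e"
  define g where "g = (1 + d / x) * norm \<eta>"
  have e0: "0 \<le> e" using E_nonneg m0 by (simp add: e_def)
  have me: "m * e = E" using m0 by (simp add: e_def)
  have S0: "0 \<le> T" by (simp add: T_def)
  have nT: "norm v \<le> T" "norm u \<le> T" "norm z \<le> T" "norm y \<le> T" "norm \<phi> \<le> T" "norm \<theta> \<le> T"
    by (simp_all add: T_def)
  have \<delta>0: "0 < \<delta>" using B_pos by (simp add: \<delta>_def)
  have B3: "1 \<le> B ^ 3" using B1 by (rule one_le_power)
  have \<delta>1: "\<delta> \<le> 1" using B3 B_pos by (simp add: \<delta>_def divide_le_eq)
  have wm: "w \<le> \<delta> * m" using \<omega> B_pos by (simp add: \<delta>_def field_simps)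
  \<comment> \<open>Some bounds divide by \<open>x\<close> twice, so \<open>w\<close> has to be
    small against both \<open>x\<close> and \<open>x * x\<close>.\<close>
  have wx: "w \<le> x * \<delta>" "w \<le> x * x * \<delta>"
    using order_trans[OF wm mult_left_mono[OF mx(1)]] order_trans[OF wm mult_left_mono[OF mx(2)]] \<delta>0
    by (simp_all add: mult_ac)
  have Ex: "E \<le> x * e" "E \<le> x * x * e"
    using mult_right_mono[OF mx(1) e0] mult_right_mono[OF mx(2) e0] me by simp_all
  have wt: "w * t \<le> x * (\<delta> * T)" "w * t \<le> x * x * (\<delta> * T)" if "0 \<le> t" "t \<le> T" for t
    using mult_mono[OF wx(1) that(2)] mult_mono[OF wx(2) that(2)] that \<delta>0 x_pos by (simp_all add: mult.assoc)
  have \<alpha>x: "x * \<alpha> = x * (\<delta> * T) + x * e" "x * x * \<alpha> = x * x * (\<delta> * T) + x * x * e"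
    by (simp_all add: \<alpha>_def distrib_left)
  have \<alpha>0: "0 \<le> \<alpha>" using \<delta>0 S0 e0 by (simp add: \<alpha>_def)
  have g0: "norm \<eta> \<le> g" using pos(5) x_pos by (simp add: g_def distrib_right)
  have c1: "t \<le> c" if "x * t \<le> x * c" for t c using that x_pos by simp
  have c2: "t \<le> c" if "x * (x * t) \<le> x * (x * c)" for t c using that x_pos by simp
  have y: "norm y \<le> \<alpha>"
    using solve3_y wt(1)[OF norm_ge_zero nT(3)] Ex \<alpha>x by - (rule c1, linarith)
  have \<theta>: "norm \<theta> \<le> \<alpha>"
    using solve5_\<theta> wt(1)[OF norm_ge_zero nT(5)] Ex \<alpha>x by - (rule c1, linarith)
  have y2: "x * norm y \<le> x * x * \<alpha>" "x * norm \<theta> \<le> x * x * \<alpha>"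
    using solve3_y wt(2)[OF norm_ge_zero nT(3)] solve5_\<theta> wt(2)[OF norm_ge_zero nT(5)] Ex \<alpha>x by linarith+
  have v: "norm v \<le> B * (x * \<alpha>)"
  proof (rule c1)
    have "w * norm u + E \<le> x * x * \<alpha>" using wt(2)[OF norm_ge_zero nT(2)] Ex \<alpha>x by linarith
    from order_trans[OF solve2_v mult_left_mono[OF this]] show "x * norm v \<le> x * (B * (x * \<alpha>))"
      using B_pos by (simp add: algebra_simps)
  qed
  have v1: "norm v \<le> B * \<alpha>"
  proof (rule c1)
    have "w * norm u + E \<le> x * \<alpha>" using wt(1)[OF norm_ge_zero nT(2)] Ex \<alpha>x by linarith
    from order_trans[OF solve2_v mult_left_mono[OF this]] show "x * norm v \<le> x * (B * \<alpha>)"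
      using B_pos by (simp add: algebra_simps)
  qed
  have u: "norm u \<le> 3 * \<alpha>"
  proof (rule c2)
    have "x * (x * norm u) \<le> x * (w * norm v + norm y + norm \<theta> + E)"
      using solve1_u x_pos by (intro mult_left_mono) auto
    also have "\<dots> = x * (w * norm v) + x * norm y + x * norm \<theta> + x * E" by (simp add: algebra_simps)
    also have "x * (w * norm v) + x * E \<le> x * (x * \<alpha>)"
    proof -
      have "w * norm v + E \<le> x * \<alpha>" using wt(1)[OF norm_ge_zero nT(1)] Ex \<alpha>x by linarith
      from mult_left_mono[OF this, of x] show ?thesis using x_pos by (simp add: distrib_left)
    qed
    then have "x * (w * norm v) + x * norm y + x * norm \<theta> + x * E \<le> x * (x * (3 * \<alpha>))"
      using y2 by (simp add: algebra_simps)
    finally show "x * (x * norm u) \<le> x * (x * (3 * \<alpha>))" .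
  qed
  have pw: "B ^ i * \<alpha> \<le> B ^ 3 * \<alpha>" "B ^ i * g \<le> B ^ 3 * g" if "i \<le> 3" for i
    using pow_B_mono that \<alpha>0 order_trans[OF norm_ge_zero g0] by auto
  note pw' = pw[of 0] pw[of 1] pw[of 2]
  have z: "norm z \<le> 3 * B ^ 3 * (\<alpha> + g)"
  proof -
    have "w * norm y + B * norm v + B * (x * norm \<eta>) + E \<le> x * \<alpha> + B * (B * (x * \<alpha>)) + B * (x * g)"
    proof -
      have "B * norm v \<le> B * (B * (x * \<alpha>))" using v B_pos by (intro mult_left_mono) auto
      moreover have "B * (x * norm \<eta>) \<le> B * (x * g)" using g0 B_pos x_pos by (intro mult_left_mono) auto
      ultimately show ?thesis using wt(1)[OF norm_ge_zero nT(4)] Ex \<alpha>x by linarith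
    qed
    from order_trans[OF solve4_z mult_left_mono[OF this]] have "norm z \<le> B * (\<alpha> + B * (B * \<alpha>) + B * g)"
      using B_pos by - (rule c1, simp add: algebra_simps)
    also have "\<dots> = B * \<alpha> + B ^ 3 * \<alpha> + B\<^sup>2 * g" by (simp add: algebra_simps power2_eq_square power3_eq_cube)
    also have "\<dots> \<le> 3 * B ^ 3 * (\<alpha> + g)"
      using pw' pw(2)[of 3] order_trans[OF norm_ge_zero g0] B_pos \<alpha>0 mult_nonneg_nonneg[of "B ^ 3" \<alpha>] mult_nonneg_nonneg[of "B ^ 3" g]
      by (simp add: algebra_simps)
    finally show ?thesis .
  qed
  have \<phi>: "norm \<phi> \<le> 3 * B ^ 3 * (\<alpha> + g)"
  proof -
    have "w * norm \<theta> + B * norm v + E \<le> x * \<alpha> + B * (B * (x * \<alpha>))"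
    proof -
      have "B * norm v \<le> B * (B * (x * \<alpha>))" using v B_pos by (intro mult_left_mono) auto
      then show ?thesis using wt(1)[OF norm_ge_zero nT(6)] Ex \<alpha>x by linarith
    qed
    from order_trans[OF solve6_\<phi> mult_left_mono[OF this]] have "norm \<phi> \<le> B * (\<alpha> + B * (B * \<alpha>))"
      using B_pos by - (rule c1, simp add: algebra_simps)
    also have "\<dots> = B * \<alpha> + B ^ 3 * \<alpha>" by (simp add: algebra_simps power2_eq_square power3_eq_cube)
    also have "\<dots> \<le> 3 * B ^ 3 * (\<alpha> + g)"
      using pw' order_trans[OF norm_ge_zero g0] B_pos \<alpha>0 mult_nonneg_nonneg[of "B ^ 3" \<alpha>] mult_nonneg_nonneg[of "B ^ 3" g]
      by (simp add: algebra_simps)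
    finally show ?thesis .
  qed
  have \<sigma>: "norm \<sigma> \<le> 3 * B ^ 3 * (\<alpha> + g)"
  proof -
    have "w * norm \<eta> \<le> x * norm \<eta>"
      using wx(1) \<delta>1 x_pos by (intro mult_right_mono) (auto intro: order_trans mult_left_le)
    then have "(w + d) * norm \<eta> \<le> x * g"
      using x_pos by (simp add: g_def field_simps)
    moreover have "B * (x * norm y) \<le> B * (x * \<alpha>)" using y B_pos x_pos by (intro mult_left_mono) auto
    moreover have "E \<le> x * \<alpha>" using \<delta>0 S0 x_pos
      by (intro order_trans[OF Ex(1)] mult_left_mono) (auto simp: \<alpha>_def)
    ultimately have "(w + d) * norm \<eta> + B * (x * norm y) + E \<le> x * g + B * (x * \<alpha>) + x * \<alpha>" by linarith
    from order_trans[OF solve8_\<sigma> mult_left_mono[OF this]] have "norm \<sigma> \<le> B * (g + B * \<alpha> + \<alpha>)"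
      using B_pos by - (rule c1, simp add: algebra_simps)
    also have "\<dots> = B * g + B\<^sup>2 * \<alpha> + B * \<alpha>" by (simp add: algebra_simps power2_eq_square)
    also have "\<dots> \<le> 3 * B ^ 3 * (\<alpha> + g)"
      using pw' order_trans[OF norm_ge_zero g0] B_pos \<alpha>0 mult_nonneg_nonneg[of "B ^ 3" \<alpha>] mult_nonneg_nonneg[of "B ^ 3" g]
      by (simp add: algebra_simps)
    finally show ?thesis .
  qed
  have r: "\<alpha> \<le> B ^ 3 * (\<alpha> + g)" "B * \<alpha> \<le> B ^ 3 * (\<alpha> + g)" "g \<le> B ^ 3 * (\<alpha> + g)"
    using pw' order_trans[OF norm_ge_zero g0] B_pos \<alpha>0 mult_nonneg_nonneg[of "B ^ 3" \<alpha>] mult_nonneg_nonneg[of "B ^ 3" g]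
    by (simp_all add: distrib_left)
  have "S \<le> 24 * (B ^ 3 * (\<alpha> + g))"
    using z \<phi> \<sigma> u v1 y \<theta> g0 r \<alpha>0 by linarith
  then have "T \<le> 24 * (B ^ 3 * (\<alpha> + g))" by (simp only: T_def)
  also have "\<dots> = 24 * B ^ 3 * \<delta> * T + 24 * B ^ 3 * (e + g)" by (simp add: \<alpha>_def algebra_simps)
  also have "24 * B ^ 3 * \<delta> = 1 / 2" using B_pos by (simp add: \<delta>_def)
  finally have "T \<le> 48 * B ^ 3 * (e + g)" by simp
  then show ?thesis by (simp add: e_def g_def T_def)
qed

text \<open>Here \<omega> dominates the other coefficients, so each equation is solved for its term
  with \<omega>. The eight bounds add up to w S <= 8 B (1 + x) S + 8 E. The constant 16 lets half of
  the left side absorb the first term, and it also makes \<open>w\<close> at least 16.\<close>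

lemma large_frequency:
  assumes \<omega>: "16 * B * (1 + x) \<le> w"
  shows "S \<le> E"
proof -
  have S0: "0 \<le> S" by simp
  have Bx: "B * (x * t) + B * s \<le> B * (1 + x) * S" if "t + s \<le> S" "0 \<le> t" "0 \<le> s" for t s
  proof -
    have "x * t + s \<le> (1 + x) * (t + s)" using that x_pos by (simp add: algebra_simps)
    also have "\<dots> \<le> (1 + x) * S" using that x_pos by (intro mult_left_mono) auto
    finally have "B * (x * t + s) \<le> B * ((1 + x) * S)" using B_pos by (intro mult_left_mono) auto
    then show ?thesis by (simp add: algebra_simps)
  qed
  have up1: "t \<le> B * t" if "0 \<le> t" for t using B1 that mult_right_mono[of 1 B t] by simp
  note n = norm_ge_zero[of v] norm_ge_zero[of u] norm_ge_zero[of z] norm_ge_zero[of y]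
    norm_ge_zero[of \<phi>] norm_ge_zero[of \<theta>] norm_ge_zero[of \<sigma>] norm_ge_zero[of \<eta>]
  have "w * norm v \<le> B * (1 + x) * S + E"
    using solve1_v Bx[of "norm u" "norm y + norm \<theta>"] up1[OF x_norm_nonneg[of "u"]] up1[OF add_nonneg_nonneg[OF norm_ge_zero[of y] norm_ge_zero[of \<theta>]]] n by linarith
  moreover have "w * norm u \<le> B * (1 + x) * S + E" using solve2_u Bx[of "norm v" 0] n by (simp add: distrib_left[of B]; linarith)
  moreover have "w * norm z \<le> B * (1 + x) * S + E" using solve3_z Bx[of "norm y" 0] up1[OF x_norm_nonneg[of "y"]] n by (simp add: distrib_left[of B]; linarith)
  moreover have "w * norm y \<le> B * (1 + x) * S + E"
    using solve4_y Bx[of "norm z + norm \<eta>" "norm v"] n by (simp add: distrib_left)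
  moreover have "w * norm \<phi> \<le> B * (1 + x) * S + E" using solve5_\<phi> Bx[of "norm \<theta>" 0] up1[OF x_norm_nonneg[of "\<theta>"]] n by (simp add: distrib_left[of B]; linarith)
  moreover have "w * norm \<theta> \<le> B * (1 + x) * S + E" using solve6_\<theta> Bx[of "norm \<phi>" "norm v"] n by (simp add: distrib_left[of B]; linarith)
  moreover have "w * norm \<sigma> \<le> B * (1 + x) * S + E" using solve7_\<sigma> Bx[of "norm \<eta>" 0] up1[OF x_norm_nonneg[of "\<eta>"]] n by (simp add: distrib_left[of B]; linarith)
  moreover have "w * norm \<eta> \<le> B * (1 + x) * S + E"
    using solve8_\<eta> Bx[of "norm \<sigma> + norm y" 0] n by (simp add: distrib_left)
  ultimately have "w * S \<le> 8 * (B * (1 + x) * S) + 8 * E" by (simp add: distrib_left)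
  moreover have "16 * B * (1 + x) * S \<le> w * S" using \<omega> by (intro mult_right_mono) auto
  ultimately have "w * S \<le> 16 * E" by simp
  moreover have "16 * S \<le> w * S"
  proof (rule mult_right_mono[OF _ S0])
    have "1 * 1 \<le> B * (1 + x)" using B1 x_pos by (intro mult_mono) auto
    then show "16 \<le> w" using \<omega> by simp
  qed
  ultimately show ?thesis by simp
qed

lemma B_step: "t \<le> c \<Longrightarrow> B * t \<le> B * c"
  using B_pos by (intro mult_left_mono) auto

lemma x_step: "t \<le> c \<Longrightarrow> x * t \<le> x * c"
  using x_pos by (intro mult_left_mono) auto

lemma x_cancel: "x * t \<le> x * c \<Longrightarrow> t \<le> c"
  using x_pos by simp

text \<open>The components are recovered from \<open>\<eta>\<close> in the order \<open>\<sigma>, y, z, v, u, \<theta>, \<phi>\<close>.\<close>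

lemma low_frequency_middle:
  assumes \<omega>: "x * x \<le> B * w" "w \<le> B" and x1: "x \<le> 1" and d: "d \<le> B"
  shows "x * x * S \<le> 100 * B ^ 9 * (norm \<eta> + E / x)"
proof -
  define Q where "Q = norm \<eta> + E / x"
  \<comment> \<open>Each passage through an equation costs powers of \<open>B\<close>. Indexing the
    bounds by the exponent lets them be compared through monotonicity of \<open>b\<close>.\<close>
  define b where "b n = B ^ n * Q" for n
  have Q0: "0 \<le> Q" using E_nonneg x_pos by (simp add: Q_def)
  have bS: "B * b n = b (Suc n)" for n by (simp add: b_def)
  have bm: "b m \<le> b n" if "m \<le> n" for m n unfolding b_def by (rule pow_B_mono[OF Q0 that])
  have b0: "b 0 = Q" by (simp add: b_def)
  have bp: "0 \<le> b n" for n using Q0 B_pos by (simp add: b_def)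
  have xQ: "x * norm \<eta> + E = x * Q" using x_pos by (simp add: Q_def field_simps)
  have eQ: "norm \<eta> \<le> Q" using E_nonneg x_pos by (simp add: Q_def)
  have ExQ: "E \<le> x * Q" using xQ x_norm_nonneg[of \<eta>] by linarith
  have xle: "x * t \<le> t" if "0 \<le> t" for t using x1 that by (rule mult_left_le_one_le[rotated 2]) (use x_pos that in auto)
  have EQ: "E \<le> Q" using ExQ xle[OF Q0] by linarith
  have wt: "w * t \<le> B * t" if "0 \<le> t" for t using \<omega>(2) that by (rule mult_right_mono)
  \<comment> \<open>Only w >= x^2 / B is known, so dividing by \<omega> costs two powers of
    \<open>x\<close>. This is why the conclusion carries the factor \<open>x * x\<close>.\<close>
  have xxt: "x * x * t \<le> B * (w * t)" if "0 \<le> t" for t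
    using mult_right_mono[OF \<omega>(1) that] by (simp add: mult.assoc)
  have \<sigma>: "x * norm \<sigma> \<le> b 1"
  proof (rule x_cancel)
    have "x * (x * norm \<sigma>) \<le> B * (w * norm \<sigma>)" using xxt[of "norm \<sigma>"] by (simp add: mult.assoc)
    also have "\<dots> \<le> B * (x * Q)" using solve7_\<sigma> xQ by (intro B_step) linarith
    finally show "x * (x * norm \<sigma>) \<le> x * b 1" by (simp add: b_def mult_ac)
  qed
  have y: "x * norm y \<le> 4 * b 3"
  proof -
    have "(w + d) * norm \<eta> \<le> 2 * (B * Q)"
    proof -
      have "(w + d) * norm \<eta> \<le> (2 * B) * Q"
        using \<omega>(2) d eQ w_nonneg pos B_pos by (intro mult_mono) auto
      then show ?thesis by simp
    qed
    then have "(w + d) * norm \<eta> + B * (x * norm \<sigma>) + E \<le> 2 * b 1 + b 2 + b 0"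
      using B_step[OF \<sigma>] EQ bS[of 0] bS[of 1] b0 by (simp add: numeral_2_eq_2)
    from order_trans[OF solve8_y B_step[OF this]] show ?thesis
      using bS[of 0] bS[of 1] bS[of 2] bm[of 1 3] bm[of 2 3] by (simp add: distrib_left numeral_3_eq_3 numeral_2_eq_2)
  qed
  have z: "x * x * norm z \<le> 5 * b 4"
  proof -
    have "w * norm z \<le> 4 * b 3 + b 0" using solve3_z y EQ b0 by linarith
    from order_trans[OF xxt[OF norm_ge_zero] B_step[OF this]] show ?thesis
      using bS[of 0] bS[of 3] bm[of 1 4] by (simp add: distrib_left)
  qed
  have v: "x * norm v \<le> 11 * b 6"
  proof -
    have "x * (w * norm y) \<le> 4 * b 4"
      using wt[OF x_norm_nonneg[of y]] B_step[OF y] bS[of 3] by (simp add: mult.left_commute)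
    moreover have "x * (B * (x * norm z)) \<le> 5 * b 5"
      using B_step[OF z] bS[of 4] by (simp add: mult_ac)
    moreover have "x * (B * (x * norm \<eta>)) \<le> b 1"
    proof -
      have "x * (x * norm \<eta>) \<le> Q" using xle[OF x_norm_nonneg[of \<eta>]] xle[OF norm_ge_zero[of \<eta>]] eQ by linarith
      from B_step[OF this] show ?thesis by (simp add: b_def mult.left_commute)
    qed
    moreover have "x * E \<le> b 0" using xle[OF E_nonneg] EQ b0 by linarith
    ultimately have "x * (w * norm y + B * (x * norm z) + B * (x * norm \<eta>) + E) \<le> 4 * b 4 + 5 * b 5 + b 1 + b 0"
      unfolding distrib_left by linarith
    from B_step[OF this] x_step[OF solve4_v] show ?thesis
      using bS[of 0] bS[of 1] bS[of 4] bS[of 5] bm[of 1 6] bm[of 2 6] bm[of 5 6]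
      by (simp add: distrib_left mult.left_commute[of x B] numeral_2_eq_2)
  qed
  have u: "x * x * norm u \<le> 12 * b 8"
  proof -
    have "w * norm u \<le> 11 * b 7 + b 0" using solve2_u B_step[OF v] EQ b0 bS[of 6] by simp
    from order_trans[OF xxt[OF norm_ge_zero] B_step[OF this]] show ?thesis
      using bS[of 0] bS[of 7] bm[of 1 8] by (simp add: distrib_left)
  qed
  have \<theta>: "x * norm \<theta> \<le> 28 * b 8"
  proof -
    have "x * (w * norm v) \<le> 11 * b 7"
      using wt[OF x_norm_nonneg[of v]] B_step[OF v] bS[of 6] by (simp add: mult.left_commute)
    moreover have "x * E \<le> b 0" using xle[OF E_nonneg] EQ b0 by linarith
    ultimately have "x * (w * norm v + x * norm u + norm y + E) \<le> 11 * b 7 + 12 * b 8 + 4 * b 3 + b 0"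
      using u y unfolding distrib_left mult.assoc by linarith
    then show ?thesis using x_step[OF solve1_\<theta>] bm[of 7 8] bm[of 3 8] bm[of 0 8] by linarith
  qed
  have \<phi>: "x * x * norm \<phi> \<le> 29 * b 9"
  proof -
    have "w * norm \<phi> \<le> 28 * b 8 + b 0" using solve5_\<phi> \<theta> EQ b0 by linarith
    from order_trans[OF xxt[OF norm_ge_zero] B_step[OF this]] show ?thesis
      using bS[of 0] bS[of 8] bm[of 1 9] by (simp add: distrib_left)
  qed
  have \<eta>: "x * x * norm \<eta> \<le> b 0" using xle[OF x_norm_nonneg[of \<eta>]] xle[OF norm_ge_zero[of \<eta>]] eQ b0 by (simp add: mult.assoc)
  have "x * x * norm \<sigma> \<le> b 1" "x * x * norm y \<le> 4 * b 3" "x * x * norm v \<le> 11 * b 6" "x * x * norm \<theta> \<le> 28 * b 8"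
    using xle[OF x_norm_nonneg[of \<sigma>]] xle[OF x_norm_nonneg[of y]] xle[OF x_norm_nonneg[of v]] xle[OF x_norm_nonneg[of \<theta>]] \<sigma> y v \<theta>
    unfolding mult.assoc by linarith+
  then have "x * x * S \<le> 100 * b 9"
    using z u \<phi> \<eta> bm[of 0 9] bm[of 1 9] bm[of 3 9] bm[of 4 9] bm[of 6 9] bm[of 8 9] bp[of 9]
    unfolding distrib_left by linarith
  then show ?thesis by (simp add: b_def Q_def)
qed

lemma high_frequency_middle:
  assumes \<omega>: "x \<le> B * w" "w \<le> B * x" and x1: "1 \<le> x"
  defines "Q \<equiv> (x + d) * norm \<eta> + E"
  shows "x * norm \<sigma> \<le> B * Q" and "x * norm y \<le> 2 * B ^ 3 * Q"
    and "x * norm z \<le> 3 * B ^ 4 * Q" and "norm v \<le> 7 * B ^ 6 * Q"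
    and "norm u \<le> 8 * B ^ 8 * Q" and "S \<le> 60 * B ^ 9 * (x * Q)"
proof -
  define b where "b n = B ^ n * Q" for n
  have dn: "0 \<le> d * norm \<eta>" using pos by simp
  have Q0: "0 \<le> Q" using E_nonneg x_pos pos by (simp add: Q_def)
  have bS: "B * b n = b (Suc n)" for n by (simp add: b_def)
  have bm: "b m \<le> b n" if "m \<le> n" for m n unfolding b_def by (rule pow_B_mono[OF Q0 that])
  have b0: "b 0 = Q" by (simp add: b_def)
  have bp: "0 \<le> b n" for n using Q0 B_pos by (simp add: b_def)
  have Qe: "x * norm \<eta> + d * norm \<eta> + E = Q" by (simp add: Q_def distrib_right)
  have EQ: "E \<le> Q" using Qe x_norm_nonneg[of \<eta>] dn by linarith
  have xeQ: "x * norm \<eta> \<le> Q" using Qe E_nonneg dn by linarith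
  have xge: "t \<le> x * t" if "0 \<le> t" for t using mult_right_mono[OF x1 that] by simp
  have wt: "w * t \<le> B * (x * t)" if "0 \<le> t" for t using mult_right_mono[OF \<omega>(2) that] by (simp add: mult.assoc)
  have xt: "x * t \<le> B * (w * t)" if "0 \<le> t" for t
    using mult_right_mono[OF \<omega>(1) that] by (simp add: mult.assoc)
  have \<sigma>: "x * norm \<sigma> \<le> b 1"
  proof -
    have "w * norm \<sigma> \<le> b 0" using solve7_\<sigma> Qe dn b0 by linarith
    from order_trans[OF xt[OF norm_ge_zero] B_step[OF this]] show ?thesis using bS[of 0] by simp
  qed
  have y: "x * norm y \<le> 2 * b 3"
  proof -
    have "d * norm \<eta> + E \<le> B * (d * norm \<eta> + E)" using mult_right_mono[OF B1, of "d * norm \<eta> + E"] dn E_nonneg by simp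
    then have "(w + d) * norm \<eta> + E \<le> B * Q"
      using wt[OF norm_ge_zero[of \<eta>]] unfolding Qe[symmetric] distrib_left distrib_right by linarith
    then have "(w + d) * norm \<eta> + B * (x * norm \<sigma>) + E \<le> b 1 + b 2"
      using B_step[OF \<sigma>] bS[of 0] bS[of 1] b0 by (simp add: numeral_2_eq_2)
    from order_trans[OF solve8_y B_step[OF this]] show ?thesis
      using bS[of 1] bS[of 2] bm[of 2 3] by (simp add: distrib_left numeral_3_eq_3 numeral_2_eq_2)
  qed
  have z: "x * norm z \<le> 3 * b 4"
  proof -
    have "w * norm z \<le> 2 * b 3 + b 0" using solve3_z y EQ b0 by linarith
    from order_trans[OF xt[OF norm_ge_zero] B_step[OF this]] show ?thesis
      using bS[of 0] bS[of 3] bm[of 1 4] by (simp add: distrib_left)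
  qed
  have v: "norm v \<le> 7 * b 6"
  proof -
    have "w * norm y \<le> 2 * b 4"
      using wt[OF norm_ge_zero[of y]] B_step[OF y] bS[of 3] by simp
    moreover have "B * (x * norm z) \<le> 3 * b 5" using B_step[OF z] bS[of 4] by simp
    moreover have "B * (x * norm \<eta>) \<le> b 1" using B_step[OF xeQ] by (simp add: b_def)
    ultimately have "w * norm y + B * (x * norm z) + B * (x * norm \<eta>) + E \<le> 2 * b 4 + 3 * b 5 + b 1 + b 0"
      using EQ b0 by linarith
    from order_trans[OF solve4_v B_step[OF this]] show ?thesis
      using bS[of 0] bS[of 1] bS[of 4] bS[of 5] bm[of 1 6] bm[of 2 6] bm[of 5 6]
      by (simp add: distrib_left numeral_2_eq_2)
  qed
  have u: "norm u \<le> 8 * b 8"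
  proof (rule x_cancel)
    have "B * (x * norm v) \<le> x * (7 * b 7)" using B_step[OF x_step[OF v]] bS[of 6] by (simp add: mult.left_commute[of B])
    then have "w * norm u \<le> x * (7 * b 7 + b 0)"
      using solve2_u EQ b0 xge[OF Q0] by (simp add: distrib_left)
    from order_trans[OF xt[OF norm_ge_zero] B_step[OF this]] have "x * norm u \<le> x * (7 * b 8 + b 1)"
      using bS[of 0] bS[of 7] by (simp add: distrib_left mult.left_commute[of B])
    also have "\<dots> \<le> x * (8 * b 8)" using bm[of 1 8] by (intro x_step) simp
    finally show "x * norm u \<le> x * (8 * b 8)" .
  qed
  have \<theta>: "norm \<theta> \<le> x * (18 * b 8)"
  proof -
    have "w * norm v \<le> x * (7 * b 7)"
      using wt[OF norm_ge_zero[of v]] B_step[OF x_step[OF v]] bS[of 6] by (simp add: mult.left_commute[of B])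
    moreover have "norm y \<le> x * (2 * b 3)" using y xge[OF norm_ge_zero[of y]] xge[OF bp[of 3]] by simp
    moreover have "E \<le> x * b 0" using EQ xge[OF Q0] b0 by simp
    ultimately have "norm \<theta> \<le> x * (7 * b 7) + x * (8 * b 8) + x * (2 * b 3) + x * b 0"
      using solve1_\<theta> x_step[OF u] by linarith
    also have "\<dots> = x * (7 * b 7 + 8 * b 8 + 2 * b 3 + b 0)" by (simp add: distrib_left)
    also have "\<dots> \<le> x * (18 * b 8)" using bm[of 7 8] bm[of 3 8] bm[of 0 8] by (intro x_step) linarith
    finally show ?thesis .
  qed
  have \<phi>: "norm \<phi> \<le> x * (19 * b 9)"
  proof (rule x_cancel)
    have "b 0 \<le> x * (x * b 0)" using xge[OF bp[of 0]] xge[OF x_norm_nonneg[of "of_real (b 0)"]] bp[of 0] by simp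
    then have "w * norm \<phi> \<le> x * (x * (18 * b 8 + b 0))"
      using solve5_\<phi> x_step[OF \<theta>] EQ b0 by (simp add: distrib_left)
    from order_trans[OF xt[OF norm_ge_zero] B_step[OF this]] have "x * norm \<phi> \<le> x * (x * (18 * b 9 + b 1))"
      using bS[of 0] bS[of 8] by (simp add: distrib_left mult.left_commute[of B])
    also have "\<dots> \<le> x * (x * (19 * b 9))" using bm[of 1 9] by (intro x_step) simp
    finally show "x * norm \<phi> \<le> x * (x * (19 * b 9))" .
  qed
  show "x * norm \<sigma> \<le> B * Q" "x * norm y \<le> 2 * B ^ 3 * Q" "x * norm z \<le> 3 * B ^ 4 * Q"
    "norm v \<le> 7 * B ^ 6 * Q" "norm u \<le> 8 * B ^ 8 * Q"
    using \<sigma> y z v u by (simp_all add: b_def)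
  have xb: "b n \<le> x * b 9" if "n \<le> 9" for n using bm[OF that] xge[OF bp[of 9]] by linarith
  have "norm \<sigma> \<le> b 1" "norm y \<le> 2 * b 3" "norm z \<le> 3 * b 4" "norm \<eta> \<le> b 0"
    using \<sigma> y z xeQ b0 xge[OF norm_ge_zero[of \<sigma>]] xge[OF norm_ge_zero[of y]] xge[OF norm_ge_zero[of z]]
      xge[OF norm_ge_zero[of \<eta>]] by linarith+
  moreover have "x * (18 * b 8) \<le> 18 * (x * b 9)" using x_step[OF bm[of 8 9]] by simp
  ultimately have "S \<le> 60 * (x * b 9)"
    using v u \<theta> \<phi> xb[of 0] xb[of 1] xb[of 3] xb[of 4] xb[of 6] xb[of 8] bp[of 9] xge[OF bp[of 9]]
    by linarith
  then show "S \<le> 60 * B ^ 9 * (x * Q)" by (simp add: b_def mult_ac)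
qed

text \<open>Eliminating \<open>u\<close> between equations 1 and 2 brings out the wave symbol
  \<omega>^2 - k1 \<xi>^2. As a bound on \<open>v\<close> it is useful where this symbol is large;
  \<open>reduced_\<theta>'\<close> reads the same identity where it is small.\<close>

lemma reduced_v: "\<bar>\<omega>\<^sup>2 - k1 * \<xi>\<^sup>2\<bar> * norm v \<le> w * (norm y + norm \<theta> + E) + x * E"
proof -
  have "\<i> * of_real (\<omega>\<^sup>2 - k1 * \<xi>\<^sup>2) * v = \<omega> * y + \<omega> * \<theta> + \<omega> * f1 + \<xi> * f2"
    unfolding eq1[symmetric] eq2[symmetric] by (simp add: algebra_simps power2_eq_square)
  from norm_sum4_le[OF this, unfolded norms] show ?thesis
    using mult_left_mono[OF E(1) w_nonneg] x_step[OF E(2)] by (simp add: distrib_left)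
qed

lemma reduced_\<theta>: "\<bar>\<omega>\<^sup>2 - k3 * \<xi>\<^sup>2\<bar> * norm \<theta> \<le> w * (E + B * norm v) + B * (x * E)"
proof -
  have "\<i> * of_real (\<omega>\<^sup>2 - k3 * \<xi>\<^sup>2) * \<theta> = \<omega> * f6 + - (\<omega> * (k1 * v)) + k3 * (\<xi> * f5) + 0"
    unfolding eq5[symmetric] eq6[symmetric] by (simp add: algebra_simps power2_eq_square)
  from norm_sum4_le[OF this, unfolded norms] show ?thesis
    using mult_left_mono[OF E(6) w_nonneg] mult_left_mono[OF up_mult(1)[OF norm_ge_zero[of v]] w_nonneg]
      up_mult(3)[OF x_norm_nonneg[of f5]] B_step[OF x_step[OF E(5)]] by (simp add: distrib_left)
qed

lemma reduced_\<theta>': "w * norm \<theta> \<le> \<bar>\<omega>\<^sup>2 - k1 * \<xi>\<^sup>2\<bar> * norm v + w * (norm y + E) + x * E"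
proof -
  have "\<omega> * \<theta> = \<i> * of_real (\<omega>\<^sup>2 - k1 * \<xi>\<^sup>2) * v + - (\<omega> * y) + - (\<omega> * f1) + - (\<xi> * f2)"
    unfolding eq1[symmetric] eq2[symmetric] by (simp add: algebra_simps power2_eq_square)
  from norm_sum4_le[OF this, unfolded norms] show ?thesis
    using mult_left_mono[OF E(1) w_nonneg] x_step[OF E(2)] by (simp add: distrib_left)
qed

text \<open>Eliminating \<open>z\<close> between equations 3 and 4 expresses \<open>v\<close>
  through \<open>y\<close>, for which the eighth equation gives an independent bound. If k1 = k2,
  the factor is the same symbol as in \<open>reduced_v\<close>.\<close>

lemma reduced_v': "w * norm v \<le> B * (\<bar>\<omega>\<^sup>2 - k2 * \<xi>\<^sup>2\<bar> * norm y + w * (E + B * (x * norm \<eta>)) + B * (x * E))"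
proof -
  have "k1 * (\<omega> * v) = - (\<i> * of_real (\<omega>\<^sup>2 - k2 * \<xi>\<^sup>2) * y) + \<omega> * f4 + - (\<omega> * (\<gamma> * (\<i> * \<xi> * \<eta>))) + k2 * (\<xi> * f3)"
    unfolding eq3[symmetric] eq4[symmetric] by (simp add: algebra_simps power2_eq_square)
  from norm_sum4_le[OF this, unfolded norms]
  have "k1 * (w * norm v) \<le> \<bar>\<omega>\<^sup>2 - k2 * \<xi>\<^sup>2\<bar> * norm y + w * (E + B * (x * norm \<eta>)) + B * (x * E)"
    using mult_left_mono[OF E(4) w_nonneg] mult_left_mono[OF up_mult(5)[OF x_norm_nonneg[of \<eta>]] w_nonneg]
      up_mult(2)[OF x_norm_nonneg[of f3]] B_step[OF x_step[OF E(3)]] by (simp add: distrib_left)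
  then show ?thesis using w_nonneg by (intro div_le[OF low(1)]) auto
qed

text \<open>If \<open>k1 = k3\<close>, the same factor \<open>p = \<bar>\<omega>\<^sup>2 - k1 \<xi>\<^sup>2\<bar>\<close> occurs in the reduced equations for \<open>v\<close> and
  \<open>\<theta>\<close>: if \<open>p \<le> w\<close>, then \<open>reduced_\<theta>'\<close> bounds \<open>\<theta>\<close> without losing a power of \<open>x\<close>, and otherwise
  \<open>reduced_\<theta>\<close> does. If also \<open>k1 = k2\<close>, then \<open>p \<le> 2 B w\<close>
  bounds \<open>v\<close> by \<open>reduced_v'\<close>, and otherwise \<open>reduced_v\<close> and \<open>reduced_\<theta>\<close> are weakly coupled.\<close>

lemma high_frequency_equal_13:
  assumes \<omega>: "x \<le> B * w" "w \<le> B * x" and x1: "1 \<le> x" and k: "k1 = k3"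
  shows "S \<le> 45 * B ^ 8 * ((x + d) * norm \<eta> + E)"
proof -
  define Q where "Q = (x + d) * norm \<eta> + E"
  note h = high_frequency_middle[OF \<omega> x1, folded Q_def]
  define b where "b n = B ^ n * Q" for n
  define p where "p = \<bar>\<omega>\<^sup>2 - k1 * \<xi>\<^sup>2\<bar>"
  have Q0: "0 \<le> Q" using E_nonneg x_pos pos by (simp add: Q_def)
  have bS: "B * b n = b (Suc n)" for n by (simp add: b_def)
  have bm: "b m \<le> b n" if "m \<le> n" for m n unfolding b_def by (rule pow_B_mono[OF Q0 that])
  have xge: "t \<le> x * t" if "0 \<le> t" for t using mult_right_mono[OF x1 that] by simp
  have E0Q: "E \<le> b 0" using pos x_pos by (simp add: b_def Q_def)
  have E1: "B * E \<le> b 1" "B * (B * E) \<le> b 2"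
    using B_step[OF E0Q] B_step[OF B_step[OF E0Q]] by (simp_all add: bS numeral_2_eq_2)
  have w_pos: "0 < w" using \<omega>(1) x_pos w_nonneg by (cases "w = 0") auto
  have wc: "t \<le> c" if "w * t \<le> w * c" for t c using that w_pos by simp
  have xw: "x * t \<le> w * (B * t)" if "0 \<le> t" for t using mult_right_mono[OF \<omega>(1) that] by (simp add: mult_ac)
  have v: "norm v \<le> 7 * b 6" and u: "norm u \<le> 8 * b 8" using h(4,5) by (simp_all add: b_def)
  have y: "norm y \<le> 2 * b 3" and z: "norm z \<le> 3 * b 4" and \<sigma>: "norm \<sigma> \<le> b 1"
    using h(1-3) xge[OF norm_ge_zero[of y]] xge[OF norm_ge_zero[of z]] xge[OF norm_ge_zero[of \<sigma>]]
    by (simp_all add: b_def)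
  have \<eta>: "norm \<eta> \<le> b 0"
  proof -
    have "norm \<eta> \<le> x * norm \<eta> + d * norm \<eta> + E" using xge[OF norm_ge_zero[of \<eta>]] pos E_nonneg by (simp add: add_nonneg_nonneg add_increasing2)
    then show ?thesis by (simp add: b_def Q_def distrib_right)
  qed
  have \<theta>: "norm \<theta> \<le> 11 * b 7"
  proof (cases "p \<le> w")
    case True
    have "w * norm \<theta> \<le> p * norm v + w * (norm y + E) + x * E" using reduced_\<theta>' by (simp add: p_def)
    also have "\<dots> \<le> w * norm v + w * (norm y + E) + w * (B * E)"
      using mult_right_mono[OF True norm_ge_zero[of v]] xw[OF E_nonneg] by linarith
    also have "\<dots> = w * (norm v + (norm y + E) + B * E)" by (simp add: distrib_left)
    finally have "norm \<theta> \<le> norm v + (norm y + E) + B * E" by (rule wc)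
    then show ?thesis using v y E0Q E1 bm[of 6 7] bm[of 3 7] bm[of 0 7] bm[of 1 7] by linarith
  next
    case False
    have "p * norm \<theta> \<le> w * (E + B * norm v) + B * (x * E)" using reduced_\<theta> k by (simp add: p_def)
    also have "\<dots> \<le> w * (E + B * norm v) + B * (w * (B * E))" using B_step[OF xw[OF E_nonneg]] by linarith
    also have "\<dots> = w * (E + B * norm v + B * (B * E))" by (simp add: algebra_simps)
    also have "\<dots> \<le> p * (E + B * norm v + B * (B * E))"
      using False E_nonneg B_pos by (intro mult_right_mono) auto
    finally have "norm \<theta> \<le> E + B * norm v + B * (B * E)" using False w_pos by simp
    moreover have "B * norm v \<le> 7 * b 7"
      using B_step[OF v] bS[of 6] by (simp add: mult.left_commute[of B])
    moreover have "0 \<le> b 7" using Q0 B_pos by (simp add: b_def)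
    ultimately show ?thesis
      using E0Q E1(2) bm[of 0 7] bm[of 2 7] by linarith
  qed
  have \<phi>: "norm \<phi> \<le> 12 * b 8"
  proof (rule wc)
    have "w * norm \<phi> \<le> x * (11 * b 7) + x * b 0"
      using solve5_\<phi> x_step[OF \<theta>] E0Q xge[of "b 0"] Q0 by (simp add: b_def)
    also have "\<dots> = x * (11 * b 7 + b 0)" by (simp add: distrib_left)
    also have "\<dots> \<le> w * (B * (11 * b 7 + b 0))" using Q0 B_pos by (intro xw) (auto simp: b_def)
    also have "\<dots> \<le> w * (12 * b 8)"
      using w_nonneg bS[of 7] bS[of 0] bm[of 1 8] by (intro mult_left_mono) (auto simp: distrib_left)
    finally show "w * norm \<phi> \<le> w * (12 * b 8)" .
  qed
  have "S \<le> 45 * b 8"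
    using v u y z \<sigma> \<eta> \<theta> \<phi> bm[of 0 8] bm[of 1 8] bm[of 3 8] bm[of 4 8] bm[of 6 8] bm[of 7 8] by linarith
  then show ?thesis by (simp add: b_def Q_def)
qed

text \<open>Gains a power of \<open>x\<close> over the case of two equal speeds: \<open>Y\<close> is
  at least \<open>Q / x\<close>, and \<open>\<sigma>\<close>, \<open>y\<close> and \<open>z\<close>
  were already of that order. The condition \<open>x * x \<le> B * d\<close>, met by second-order
  damping, makes \<open>x * norm \<eta>\<close> of order \<open>Y\<close> as well, which is how
  \<open>\<eta>\<close> enters the bound for \<open>v\<close>.\<close>

lemma high_frequency_equal:
  assumes \<omega>: "x \<le> B * w" "w \<le> B * x" and x1: "1 \<le> x" and k: "k1 = k2" "k1 = k3"
    and d: "x * x \<le> B * d"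
  shows "S \<le> 63 * B ^ 7 * ((1 + d / x) * norm \<eta> + 2 * E)"
proof -
  define Q where "Q = (x + d) * norm \<eta> + E"
  note h = high_frequency_middle[OF \<omega> x1, folded Q_def]
  define Y where "Y = (1 + d / x) * norm \<eta> + 2 * E"
  define b where "b n = B ^ n * Y" for n
  define p where "p = \<bar>\<omega>\<^sup>2 - k1 * \<xi>\<^sup>2\<bar>"
  have Y0: "0 \<le> Y" using E_nonneg x_pos pos by (simp add: Y_def)
  have bS: "B * b n = b (Suc n)" for n by (simp add: b_def)
  have bm: "b m \<le> b n" if "m \<le> n" for m n unfolding b_def by (rule pow_B_mono[OF Y0 that])
  have xge: "t \<le> x * t" if "0 \<le> t" for t using mult_right_mono[OF x1 that] by simp
  have g0: "0 \<le> (1 + d / x) * norm \<eta>" using x_pos pos by simp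
  have E0Y: "2 * E \<le> b 0" using g0 by (simp add: b_def Y_def)
  have EY: "E \<le> b 0" using E0Y E_nonneg by simp
  have E1: "B * E \<le> b 1" "B * (B * E) \<le> b 2"
    using B_step[OF EY] B_step[OF B_step[OF EY]] by (simp_all add: bS numeral_2_eq_2)
  have QY: "Q \<le> x * Y"
  proof -
    have "x * Y = (x + d) * norm \<eta> + 2 * (x * E)" using x_pos by (simp add: Y_def field_simps)
    then show ?thesis using xge[OF E_nonneg] E_nonneg by (simp add: Q_def)
  qed
  have cQ: "t \<le> B ^ n * Y" if "x * t \<le> B ^ n * Q" for t n
  proof (rule x_cancel)
    have "B ^ n * Q \<le> B ^ n * (x * Y)" using QY B_pos by (intro mult_left_mono) auto
    then show "x * t \<le> x * (B ^ n * Y)" using that by (simp add: mult_ac)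
  qed
  have \<sigma>: "norm \<sigma> \<le> b 1" using cQ[of "norm \<sigma>" 1] h(1) by (simp add: b_def)
  have y: "norm y \<le> 2 * b 3" using cQ[of "norm y / 2" 3] h(2) by (simp add: b_def)
  have z: "norm z \<le> 3 * b 4" using cQ[of "norm z / 3" 4] h(3) by (simp add: b_def)
  have x\<eta>: "x * norm \<eta> \<le> b 1"
  proof -
    have "x * (x * norm \<eta>) \<le> B * (d * norm \<eta>)" using mult_right_mono[OF d norm_ge_zero[of \<eta>]] by (simp add: mult.assoc)
    also have "\<dots> \<le> B * Q" using x_norm_nonneg[of \<eta>] E_nonneg by (intro B_step) (simp add: Q_def distrib_right)
    finally show ?thesis using cQ[of "x * norm \<eta>" 1] by (simp add: b_def)
  qed
  have \<eta>: "norm \<eta> \<le> b 1" using x\<eta> xge[OF norm_ge_zero[of \<eta>]] by simp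
  have w_pos: "0 < w" using \<omega>(1) x_pos w_nonneg by (cases "w = 0") auto
  have wc: "t \<le> c" if "w * t \<le> w * c" for t c using that w_pos by simp
  have xw: "x * t \<le> w * (B * t)" if "0 \<le> t" for t using mult_right_mono[OF \<omega>(1) that] by (simp add: mult_ac)
  have "norm v \<le> 9 * b 5 \<and> norm \<theta> \<le> 18 * b 6"
  \<comment> \<open>Above the threshold the coupled bounds read 2 B |v| <= |\<theta>| + ... and 2 B
    |\<theta>| <= B |v| + ..., so the product of the coupling factors is at most 1 / 4 and the pair
    is solved by linear arithmetic.\<close>
  proof (cases "p \<le> 2 * B * w")
    case True
    have pt: "p * t \<le> w * (2 * (B * t))" if "0 \<le> t" for t
      using mult_right_mono[OF True that] by (simp add: mult_ac)
    have "p * norm y + w * (E + B * (x * norm \<eta>)) + B * (x * E)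
        \<le> w * (2 * (B * norm y)) + w * (E + B * (x * norm \<eta>)) + B * (w * (B * E))"
      using pt[OF norm_ge_zero[of y]] B_step[OF xw[OF E_nonneg]] by linarith
    also have "\<dots> = w * (2 * (B * norm y) + (E + B * (x * norm \<eta>)) + B * (B * E))" by (simp add: algebra_simps)
    also have "\<dots> \<le> w * (7 * b 4)"
      using w_nonneg B_step[OF y] B_step[OF x\<eta>] EY E1 bS[of 3] bS[of 1] bm[of 0 4] bm[of 2 4]
      by (intro mult_left_mono) (simp_all add: numeral_2_eq_2)
    finally have "w * norm v \<le> B * (w * (7 * b 4))"
      using order_trans[OF reduced_v' B_step] k by (simp add: p_def)
    also have "\<dots> = w * (7 * b 5)" using bS[of 4] by (simp add: mult.left_commute[of B])
    finally have v: "norm v \<le> 7 * b 5" by (rule wc)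
    have "w * norm \<theta> \<le> p * norm v + w * (norm y + E) + x * E" using reduced_\<theta>' by (simp add: p_def)
    also have "\<dots> \<le> w * (2 * (B * norm v)) + w * (norm y + E) + w * (B * E)"
      using pt[OF norm_ge_zero[of v]] xw[OF E_nonneg] by linarith
    also have "\<dots> = w * (2 * (B * norm v) + (norm y + E) + B * E)" by (simp add: distrib_left)
    finally have "norm \<theta> \<le> 2 * (B * norm v) + (norm y + E) + B * E" by (rule wc)
    then have "norm \<theta> \<le> 18 * b 6"
      using B_step[OF v] y EY E1 bS[of 5] bm[of 3 6] bm[of 0 6] bm[of 1 6] by simp
    moreover have "0 \<le> b 5" using Y0 B_pos by (simp add: b_def)
    ultimately show ?thesis using v by linarith
  next
    case False
    have pt: "2 * (B * t) \<le> c" if "p * t \<le> w * c" "0 \<le> t" for t c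
    proof (rule wc)
      have "2 * B * w * t \<le> p * t" using False that by (intro mult_right_mono) auto
      then show "w * (2 * (B * t)) \<le> w * c" using that(1) by (simp add: mult_ac)
    qed
    have Bt: "t \<le> B * t" if "0 \<le> t" for t using mult_right_mono[OF B1 that] by simp
    have "p * norm v \<le> w * (norm y + norm \<theta> + E) + x * E" using reduced_v by (simp add: p_def)
    also have "\<dots> \<le> w * (norm y + norm \<theta> + E + B * E)" using xw[OF E_nonneg] by (simp add: distrib_left)
    finally have 1: "2 * (B * norm v) \<le> norm y + norm \<theta> + E + B * E" by (rule pt) simp
    have "p * norm \<theta> \<le> w * (E + B * norm v) + B * (x * E)" using reduced_\<theta> k by (simp add: p_def)
    also have "\<dots> \<le> w * (E + B * norm v) + B * (w * (B * E))" using B_step[OF xw[OF E_nonneg]] by linarith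
    also have "\<dots> = w * (E + B * norm v + B * (B * E))" by (simp add: algebra_simps)
    finally have 2: "2 * (B * norm \<theta>) \<le> E + B * norm v + B * (B * E)" by (rule pt) simp
    show ?thesis
      using 1 2 Bt[OF norm_ge_zero[of v]] Bt[OF norm_ge_zero[of \<theta>]] y EY E1
        bm[of 0 3] bm[of 1 3] bm[of 2 3] bm[of 3 5] bm[of 3 6] E_nonneg by (intro conjI) linarith+
  qed
  then have v: "norm v \<le> 9 * b 5" and \<theta>: "norm \<theta> \<le> 18 * b 6" by auto
  have u: "norm u \<le> 10 * b 7"
  proof (rule wc)
    have "B * (x * norm v) \<le> x * (9 * b 6)" using B_step[OF x_step[OF v]] bS[of 5] by (simp add: mult.left_commute[of B])
    then have "w * norm u \<le> x * (9 * b 6 + b 0)"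
      using solve2_u EY xge[of "b 0"] Y0 by (simp add: distrib_left b_def)
    also have "\<dots> \<le> w * (B * (9 * b 6 + b 0))" using Y0 B_pos by (intro xw) (auto simp: b_def)
    also have "\<dots> \<le> w * (10 * b 7)"
      using w_nonneg bS[of 6] bS[of 0] bm[of 1 7] by (intro mult_left_mono) (auto simp: distrib_left)
    finally show "w * norm u \<le> w * (10 * b 7)" .
  qed
  have \<phi>: "norm \<phi> \<le> 19 * b 7"
  proof (rule wc)
    have "w * norm \<phi> \<le> x * (18 * b 6 + b 0)"
      using solve5_\<phi> x_step[OF \<theta>] EY xge[of "b 0"] Y0 by (simp add: distrib_left b_def)
    also have "\<dots> \<le> w * (B * (18 * b 6 + b 0))" using Y0 B_pos by (intro xw) (auto simp: b_def)
    also have "\<dots> \<le> w * (19 * b 7)"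
      using w_nonneg bS[of 6] bS[of 0] bm[of 1 7] by (intro mult_left_mono) (auto simp: distrib_left)
    finally show "w * norm \<phi> \<le> w * (19 * b 7)" .
  qed
  have "S \<le> 63 * b 7"
    using v u y z \<sigma> \<eta> \<theta> \<phi> bm[of 1 7] bm[of 3 7] bm[of 4 7] bm[of 5 7] bm[of 6 7] by linarith
  then show ?thesis by (simp add: b_def Y_def)
qed

end

text \<open>With h = a^2 D E / d the second assumption gives (a e)^2 <= S h, so a e <= (S + h) / 2,
  and half of \<open>S\<close> is absorbed. The loss \<open>a\<close> enters squared, which is where
  powers of \<xi> double.\<close>

lemma dissipative_absorption:
  fixes S E a b e D d :: real
  assumes "S \<le> a * e + b * E" "d * e\<^sup>2 \<le> D * (S * E)" "0 < d" "0 \<le> S" "0 \<le> E" "0 \<le> D"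
  shows "S \<le> (a\<^sup>2 * D / d + 2 * b) * E"
proof -
  define h where "h = a\<^sup>2 * D / d * E"
  have h0: "0 \<le> h" using assms by (simp add: h_def)
  have "(a * e)\<^sup>2 = a\<^sup>2 * (d * e\<^sup>2) / d" using assms(3) by (simp add: power_mult_distrib)
  also have "\<dots> \<le> a\<^sup>2 * (D * (S * E)) / d"
    using assms by (intro divide_right_mono mult_left_mono) auto
  also have "\<dots> = S * h" by (simp add: h_def)
  also have "\<dots> \<le> ((S + h) / 2)\<^sup>2"
    using zero_le_power2[of "S - h"] by (simp add: power2_eq_square algebra_simps)
  finally have "(a * e)\<^sup>2 \<le> ((S + h) / 2)\<^sup>2" .
  then have "a * e \<le> (S + h) / 2" using power2_le_imp_le assms(4) h0 by fastforce
  then have "S \<le> h + 2 * (b * E)" using assms(1) by (simp add: field_simps)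
  then show ?thesis by (simp add: h_def distrib_right)
qed

section \<open>The vector-valued Fourier transform\<close>

lemma borel_measurable_vec_nth [measurable]:
  "(\<lambda>v :: complex ^ 'n. v $ i) \<in> borel_measurable borel"
  by (intro borel_measurable_continuous_onI continuous_intros)

lemma borel_measurable_vec_lambda:
  fixes h :: "'n::finite \<Rightarrow> real \<Rightarrow> complex"
  assumes [measurable]: "\<And>i. h i \<in> borel_measurable M"
  shows "(\<lambda>x. \<chi> i. h i x) \<in> borel_measurable M"
proof -
  have "bounded_linear (axis i :: complex \<Rightarrow> complex ^ 'n)" for i
    by (rule linear_conv_bounded_linear[THEN iffD1], rule linearI) (simp_all add: axis_def vec_eq_iff)
  then have c: "continuous_on UNIV (axis i :: complex \<Rightarrow> complex ^ 'n)" for i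
    by (intro linear_continuous_on)
  have "(\<lambda>x. (axis i (h i x) :: complex ^ 'n)) \<in> borel_measurable M" for i
    by (rule measurable_compose[OF assms borel_measurable_continuous_onI[OF c]])
  then have "(\<lambda>x. \<Sum>i\<in>UNIV. (axis i (h i x) :: complex ^ 'n)) \<in> borel_measurable M"
    by (rule borel_measurable_sum)
  moreover have "(\<chi> i. h i x) = (\<Sum>i\<in>UNIV. axis i (h i x))" for x
    by (simp add: vec_eq_iff axis_def)
  ultimately show ?thesis by simp
qed

lemma square_integrable_nth:
  fixes f :: "real \<Rightarrow> complex ^ 'n"
  assumes "square_integrable f" shows "square_integrable (\<lambda>x. f x $ i)"
  unfolding square_integrable_def
proof
  have [measurable]: "f \<in> borel_measurable borel" and i: "integrable lborel (\<lambda>x. (norm (f x))\<^sup>2)"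
    using assms by (auto simp: square_integrable_def)
  show "(\<lambda>x. f x $ i) \<in> borel_measurable lborel" by measurable
  show "integrable lborel (\<lambda>x. (norm (f x $ i))\<^sup>2)"
  proof (rule Bochner_Integration.integrable_bound[OF i])
    show "AE x in lborel. norm ((norm (f x $ i))\<^sup>2) \<le> norm ((norm (f x))\<^sup>2)"
      by (auto intro!: power_mono Finite_Cartesian_Product.norm_nth_le)
  qed measurable
qed

lemma square_integrable_iff:
  fixes f :: "real \<Rightarrow> 'a::euclidean_space"
  assumes "f \<in> borel_measurable lborel"
  shows "square_integrable f \<longleftrightarrow> (\<integral>\<^sup>+x. ennreal ((norm (f x))\<^sup>2) \<partial>lborel) < \<infinity>"
  using assms by (simp add: square_integrable_def integrable_norm_sq_iff)

lemma L2_norm_sq: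
  fixes f :: "real \<Rightarrow> 'a::euclidean_space"
  assumes "square_integrable f"
  shows "(\<integral>\<^sup>+x. ennreal ((norm (f x))\<^sup>2) \<partial>lborel) = ennreal ((L2_norm f)\<^sup>2)"
  using assms by (simp add: square_integrable_def L2_norm_def nn_integral_eq_integral)

lemma L2_norm_nonneg: "0 \<le> L2_norm f" by (simp add: L2_norm_def)

lemma integral_vec_nth:
  fixes f :: "'a \<Rightarrow> complex ^ 'n"
  assumes "integrable M f"
  shows "(integral\<^sup>L M f) $ i = (LINT x|M. f x $ i)"
  by (rule integral_bounded_linear[OF bounded_linear_vec_nth assms, symmetric])

lemma integrable_vec_nth:
  fixes f :: "'a \<Rightarrow> complex ^ 'n"
  shows "integrable M f \<Longrightarrow> integrable M (\<lambda>x. f x $ i)"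
  by (rule integrable_bounded_linear[OF bounded_linear_vec_nth])

lemma norm_cis_smult: "norm (cis a *s v) = norm v" for v :: "complex ^ 'n"
  unfolding norm_vec_def by (simp add: norm_mult)

lemma fourier_nth:
  fixes f :: "real \<Rightarrow> complex ^ 'n"
  assumes f: "integrable lborel f"
  shows "fourier f \<xi> $ i = ft (\<lambda>x. f x $ i) \<xi>"
proof -
  have [measurable]: "f \<in> borel_measurable borel" using f by auto
  have m: "(\<lambda>x. cis (- (\<xi> * x)) *s f x) \<in> borel_measurable lborel"
    unfolding vector_scalar_mult_def by (rule borel_measurable_vec_lambda) measurable
  have "integrable lborel (\<lambda>x. cis (- (\<xi> * x)) *s f x)"
    by (rule Bochner_Integration.integrable_bound[OF f m]) (simp add: norm_cis_smult)
  from integral_vec_nth[OF this] show ?thesis by (simp add: fourier_def ft_def)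
qed

lemma norm_fourier_le: "norm (fourier f \<xi>) \<le> L1_norm f"
  unfolding fourier_def L1_norm_def
  by (rule order_trans[OF integral_norm_bound]) (simp add: norm_cis_smult)

lemma nn_integral_norm_sq_vec:
  fixes f :: "real \<Rightarrow> complex ^ 'n"
  assumes [measurable]: "f \<in> borel_measurable borel" "c \<in> borel_measurable borel"
  shows "(\<integral>\<^sup>+x. ennreal ((c x * norm (f x))\<^sup>2) \<partial>lborel)
    = (\<Sum>i\<in>UNIV. \<integral>\<^sup>+x. ennreal ((c x * norm (f x $ i))\<^sup>2) \<partial>lborel)"
proof -
  have "ennreal ((c x * norm (f x))\<^sup>2) = (\<Sum>i\<in>UNIV. ennreal ((c x * norm (f x $ i))\<^sup>2))" for x
    unfolding power_mult_distrib norm_sq_vec[of "f x"] sum_distrib_left by (rule sum_ennreal[symmetric]) simp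
  then have "(\<integral>\<^sup>+x. ennreal ((c x * norm (f x))\<^sup>2) \<partial>lborel)
      = (\<integral>\<^sup>+x. (\<Sum>i\<in>UNIV. ennreal ((c x * norm (f x $ i))\<^sup>2)) \<partial>lborel)" by (simp only:)
  also have "\<dots> = (\<Sum>i\<in>UNIV. \<integral>\<^sup>+x. ennreal ((c x * norm (f x $ i))\<^sup>2) \<partial>lborel)"
    by (rule nn_integral_sum) measurable
  finally show ?thesis .
qed

section \<open>Weak derivatives and transforms of vector-valued functions\<close>

lemma has_weak_deriv_nth:
  fixes f g :: "real \<Rightarrow> complex ^ 'n"
  assumes w: "has_weak_deriv k f g" and p: "test_function p"
  shows "(LINT x|lborel. of_real ((deriv ^^ k) p x) * f x $ i) = (-1) ^ k * (LINT x|lborel. of_real (p x) * g x $ i)"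
proof -
  have l: "locally_integrable f" "locally_integrable g" using w by (auto simp: has_weak_deriv_def)
  have i: "integrable lborel (\<lambda>x. (deriv ^^ k) p x *\<^sub>R f x)" "integrable lborel (\<lambda>x. p x *\<^sub>R g x)"
    by (intro test_function_scaleR_integrable l p test_function_higher_deriv)+
  have "(LINT x|lborel. (deriv ^^ k) p x *\<^sub>R f x) $ i = ((-1) ^ k *\<^sub>R (LINT x|lborel. p x *\<^sub>R g x)) $ i"
    using w p by (simp add: has_weak_deriv_def)
  then show ?thesis
    unfolding vector_scaleR_component integral_vec_nth[OF i(1)] integral_vec_nth[OF i(2)]
    by (simp add: scaleR_conv_of_real)
qed

lemma has_weak_deriv_I:
  fixes f g :: "real \<Rightarrow> complex ^ 'n"
  assumes l: "locally_integrable f" "locally_integrable g"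
    and eq: "\<And>p i. test_function p \<Longrightarrow>
      (LINT x|lborel. of_real ((deriv ^^ k) p x) * f x $ i) = (-1) ^ k * (LINT x|lborel. of_real (p x) * g x $ i)"
  shows "has_weak_deriv k f g"
  unfolding has_weak_deriv_def
proof (intro conjI l allI impI)
  fix p assume p: "test_function p"
  have i: "integrable lborel (\<lambda>x. (deriv ^^ k) p x *\<^sub>R f x)" "integrable lborel (\<lambda>x. p x *\<^sub>R g x)"
    by (intro test_function_scaleR_integrable l p test_function_higher_deriv)+
  show "(LINT x|lborel. (deriv ^^ k) p x *\<^sub>R f x) = (-1) ^ k *\<^sub>R (LINT x|lborel. p x *\<^sub>R g x)"
    unfolding vec_eq_iff vector_scaleR_component integral_vec_nth[OF i(1)] integral_vec_nth[OF i(2)]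
    using eq[OF p] by (simp add: scaleR_conv_of_real)
qed

text \<open>This is how derivatives of the datum pay for a factor growing with \<xi> at high
  frequency.\<close>

lemma fourier_weak_deriv_le:
  fixes f :: "real \<Rightarrow> complex ^ 'n"
  assumes f: "f \<in> sobolev_H N" "integrable lborel f" and m: "m \<le> N"
  shows "(\<integral>\<^sup>+\<xi>. ennreal ((\<bar>\<xi>\<bar> ^ m * norm (fourier f \<xi>))\<^sup>2) \<partial>lborel)
    \<le> ennreal (2 * pi / flat 1 ^ 4 * (L2_norm (weak_deriv m f))\<^sup>2)"
proof -
  obtain g where g: "has_weak_deriv m f g" "square_integrable g"
    using f m by (auto simp: sobolev_H_def)
  have [measurable]: "f \<in> borel_measurable borel" "g \<in> borel_measurable borel"
    using f g by (auto simp: square_integrable_def)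
  have fl: "0 < flat 1 ^ 4" using flat_pos[of 1] by simp
  have [measurable]: "fourier f \<in> borel_measurable borel"
  proof -
    have "fourier f = (\<lambda>\<xi>. \<chi> i. ft (\<lambda>x. f x $ i) \<xi>)"
      by (simp add: fun_eq_iff vec_eq_iff fourier_nth[OF f(2)])
    also have "\<dots> \<in> borel_measurable borel" by (rule borel_measurable_vec_lambda) measurable
    finally show ?thesis .
  qed
  have "ennreal (flat 1 ^ 4) * (\<integral>\<^sup>+\<xi>. ennreal ((\<bar>\<xi>\<bar> ^ m * norm (fourier f \<xi>))\<^sup>2) \<partial>lborel)
    = (\<Sum>i\<in>UNIV. ennreal (flat 1 ^ 4) * (\<integral>\<^sup>+\<xi>. ennreal ((\<bar>\<xi>\<bar> ^ m * norm (ft (\<lambda>x. f x $ i) \<xi>))\<^sup>2) \<partial>lborel))"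
    by (subst nn_integral_norm_sq_vec) (auto simp: fourier_nth[OF f(2)] sum_distrib_left)
  also have "\<dots> \<le> (\<Sum>i\<in>UNIV. ennreal (2 * pi) * (\<integral>\<^sup>+x. ennreal ((norm (g x $ i))\<^sup>2) \<partial>lborel))"
    by (intro sum_mono ft_of_weak_derivative integrable_vec_nth f square_integrable_nth g has_weak_deriv_nth)
  also have "\<dots> = ennreal (2 * pi) * (\<integral>\<^sup>+x. ennreal ((norm (g x))\<^sup>2) \<partial>lborel)"
    using nn_integral_norm_sq_vec[of g "\<lambda>_. 1"] by (simp add: sum_distrib_left)
  also have "\<dots> = ennreal (flat 1 ^ 4) * ennreal (2 * pi / flat 1 ^ 4 * (L2_norm g)\<^sup>2)"
    unfolding L2_norm_sq[OF g(2)] using fl by (simp add: ennreal_mult[symmetric])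
  finally show ?thesis
    using fl unfolding L2_norm_weak_deriv[OF g(1)] by (subst (asm) ennreal_mult_le_mult_iff) auto
qed

text \<open>The existence of the weak derivative belongs to the conclusion: solutions are given on
  the frequency side, so regularity has to be read off from a finite weighted norm of the
  transform.\<close>

lemma fourier_L2_weak_deriv:
  fixes f g :: "real \<Rightarrow> complex ^ 'n"
  assumes fg: "has_fourier_L2 f g"
    and k: "(\<integral>\<^sup>+\<xi>. ennreal ((\<bar>\<xi>\<bar> ^ k * norm (g \<xi>))\<^sup>2) \<partial>lborel) < \<infinity>"
  obtains h where "has_weak_deriv k f h" "square_integrable h"
    "(\<integral>\<^sup>+x. ennreal ((norm (h x))\<^sup>2) \<partial>lborel)
      \<le> ennreal (1 / (2 * pi)) * (\<integral>\<^sup>+\<xi>. ennreal ((\<bar>\<xi>\<bar> ^ k * norm (g \<xi>))\<^sup>2) \<partial>lborel)"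
proof -
  have f: "square_integrable f" and g: "square_integrable g"
    and lim: "((\<lambda>R. \<integral>\<^sup>+ \<xi>. ennreal ((norm (fourier (\<lambda>x. indicator {-R..R} x *\<^sub>R f x) \<xi> - g \<xi>))\<^sup>2) \<partial>lborel) \<longlongrightarrow> 0) at_top"
    using fg by (auto simp: has_fourier_L2_def)
  have [measurable]: "f \<in> borel_measurable borel" "g \<in> borel_measurable borel"
    using f g by (auto simp: square_integrable_def)
  have "\<exists>h. square_integrable h \<and>
    (\<integral>\<^sup>+x. ennreal ((norm (h x))\<^sup>2) \<partial>lborel) \<le> ennreal (1 / (2 * pi)) * (\<integral>\<^sup>+\<xi>. ennreal ((\<bar>\<xi>\<bar> ^ k * norm (g \<xi> $ i))\<^sup>2) \<partial>lborel) \<and>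
    (\<forall>p. test_function p \<longrightarrow> (LINT x|lborel. of_real ((deriv ^^ k) p x) * f x $ i) = (-1) ^ k * (LINT x|lborel. of_real (p x) * h x))" for i
  proof -
    have fi: "integrable lborel (\<lambda>x. indicator {-R..R} x *\<^sub>R f x)" for R
      using square_integrable_imp_locally_integrable[OF f] by (auto simp: locally_integrable_def set_integrable_def)
    have lim': "((\<lambda>R. \<integral>\<^sup>+ \<xi>. ennreal ((norm (ft (\<lambda>x. indicator {-R..R} x *\<^sub>R f x $ i) \<xi> - g \<xi> $ i))\<^sup>2) \<partial>lborel) \<longlongrightarrow> 0) at_top"
    proof (rule tendsto_sandwich[OF always_eventually always_eventually tendsto_const lim])
      show "\<forall>R. (\<integral>\<^sup>+ \<xi>. ennreal ((norm (ft (\<lambda>x. indicator {-R..R} x *\<^sub>R f x $ i) \<xi> - g \<xi> $ i))\<^sup>2) \<partial>lborel)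
        \<le> (\<integral>\<^sup>+ \<xi>. ennreal ((norm (fourier (\<lambda>x. indicator {-R..R} x *\<^sub>R f x) \<xi> - g \<xi>))\<^sup>2) \<partial>lborel)"
      proof (intro allI nn_integral_mono ennreal_leI power_mono)
        fix R \<xi>
        show "norm (ft (\<lambda>x. indicator {-R..R} x *\<^sub>R f x $ i) \<xi> - g \<xi> $ i) \<le> norm (fourier (\<lambda>x. indicator {-R..R} x *\<^sub>R f x) \<xi> - g \<xi>)"
          using Finite_Cartesian_Product.norm_nth_le[of "fourier (\<lambda>x. indicator {-R..R} x *\<^sub>R f x) \<xi> - g \<xi>" i]
          by (simp add: fourier_nth[OF fi])
      qed simp
    qed simp
    have eqn: "(norm ((\<i> * of_real \<xi>) ^ k * g \<xi> $ i))\<^sup>2 = (\<bar>\<xi>\<bar> ^ k * norm (g \<xi> $ i))\<^sup>2" for \<xi>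
      by (simp add: norm_mult norm_power)
    have "(\<integral>\<^sup>+\<xi>. ennreal ((norm ((\<i> * of_real \<xi>) ^ k * g \<xi> $ i))\<^sup>2) \<partial>lborel)
      \<le> (\<integral>\<^sup>+\<xi>. ennreal ((\<bar>\<xi>\<bar> ^ k * norm (g \<xi>))\<^sup>2) \<partial>lborel)"
      unfolding eqn by (intro nn_integral_mono ennreal_leI power_mono mult_left_mono Finite_Cartesian_Product.norm_nth_le) auto
    then have "square_integrable (\<lambda>\<xi>. (\<i> * of_real \<xi>) ^ k * g \<xi> $ i)"
      using k by (subst square_integrable_iff) (auto intro: order.strict_trans1)
    then obtain h where "square_integrable h"
      "(\<integral>\<^sup>+x. ennreal ((norm (h x))\<^sup>2) \<partial>lborel)
        \<le> ennreal (1 / (2 * pi)) * (\<integral>\<^sup>+\<xi>. ennreal ((norm ((\<i> * of_real \<xi>) ^ k * g \<xi> $ i))\<^sup>2) \<partial>lborel)"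
      "\<And>p. test_function p \<Longrightarrow> (LINT x|lborel. of_real ((deriv ^^ k) p x) * f x $ i) = (-1) ^ k * (LINT x|lborel. of_real (p x) * h x)"
      by (rule weak_derivative_of_ft[OF square_integrable_nth[OF f] square_integrable_nth[OF g] lim']) blast
    then show ?thesis unfolding eqn by blast
  qed
  then have "\<exists>h. \<forall>i. square_integrable (h i) \<and>
    (\<integral>\<^sup>+x. ennreal ((norm (h i x))\<^sup>2) \<partial>lborel) \<le> ennreal (1 / (2 * pi)) * (\<integral>\<^sup>+\<xi>. ennreal ((\<bar>\<xi>\<bar> ^ k * norm (g \<xi> $ i))\<^sup>2) \<partial>lborel) \<and>
    (\<forall>p. test_function p \<longrightarrow> (LINT x|lborel. of_real ((deriv ^^ k) p x) * f x $ i) = (-1) ^ k * (LINT x|lborel. of_real (p x) * h i x))"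
    by (intro choice allI)
  then obtain h where h: "\<And>i. square_integrable (h i)"
    "\<And>i. (\<integral>\<^sup>+x. ennreal ((norm (h i x))\<^sup>2) \<partial>lborel) \<le> ennreal (1 / (2 * pi)) * (\<integral>\<^sup>+\<xi>. ennreal ((\<bar>\<xi>\<bar> ^ k * norm (g \<xi> $ i))\<^sup>2) \<partial>lborel)"
    "\<And>i p. test_function p \<Longrightarrow> (LINT x|lborel. of_real ((deriv ^^ k) p x) * f x $ i) = (-1) ^ k * (LINT x|lborel. of_real (p x) * h i x)"
    by blast
  define H where "H x = (\<chi> i. h i x)" for x
  have [measurable]: "h i \<in> borel_measurable borel" for i using h(1)[of i] by (auto simp: square_integrable_def)
  have [measurable]: "H \<in> borel_measurable borel" unfolding H_def by (rule borel_measurable_vec_lambda) measurable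
  have "(\<integral>\<^sup>+x. ennreal ((norm (H x))\<^sup>2) \<partial>lborel) = (\<Sum>i\<in>UNIV. \<integral>\<^sup>+x. ennreal ((norm (h i x))\<^sup>2) \<partial>lborel)"
    using nn_integral_norm_sq_vec[of H "\<lambda>_. 1"] by (simp add: H_def)
  also have "\<dots> \<le> (\<Sum>i\<in>UNIV. ennreal (1 / (2 * pi)) * (\<integral>\<^sup>+\<xi>. ennreal ((\<bar>\<xi>\<bar> ^ k * norm (g \<xi> $ i))\<^sup>2) \<partial>lborel))"
    by (intro sum_mono h)
  also have "\<dots> = ennreal (1 / (2 * pi)) * (\<integral>\<^sup>+\<xi>. ennreal ((\<bar>\<xi>\<bar> ^ k * norm (g \<xi>))\<^sup>2) \<partial>lborel)"
    by (subst nn_integral_norm_sq_vec) (auto simp: sum_distrib_left)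
  finally have le: "(\<integral>\<^sup>+x. ennreal ((norm (H x))\<^sup>2) \<partial>lborel)
      \<le> ennreal (1 / (2 * pi)) * (\<integral>\<^sup>+\<xi>. ennreal ((\<bar>\<xi>\<bar> ^ k * norm (g \<xi>))\<^sup>2) \<partial>lborel)" .
  also have "\<dots> < \<infinity>" using k by (simp add: ennreal_mult_less_top)
  finally have "square_integrable H" by (subst square_integrable_iff) auto
  moreover from this have "has_weak_deriv k f H"
    using h(3) by (intro has_weak_deriv_I square_integrable_imp_locally_integrable f) (simp_all add: H_def)
  ultimately show thesis using le by (intro that)
qed

section \<open>Frequency integrals\<close>

text \<open>The exponential series dominates each of its terms; the term of order \<open>m\<close>
  gives the constant.\<close>

lemma power_mult_exp_bound:
  fixes c :: real
  assumes c: "c > 0"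
  obtains K where "K > 0" "\<And>X. X \<ge> 0 \<Longrightarrow> X ^ m * exp (- (c * X)) \<le> K"
proof (rule that[of "fact m / c ^ m"])
  show "0 < fact m / c ^ m" using c by simp
  fix X :: real assume X: "X \<ge> 0"
  have "(\<lambda>n. (c * X) ^ n /\<^sub>R fact n) sums exp (c * X)" by (rule exp_converges)
  then have "(\<Sum>n\<in>{m}. (c * X) ^ n /\<^sub>R fact n) \<le> exp (c * X)"
    using c X sum_le_suminf[of "\<lambda>n. (c * X) ^ n /\<^sub>R fact n" "{m}"] by (simp add: sums_iff)
  then have "(c * X) ^ m \<le> fact m * exp (c * X)" by (simp add: field_simps)
  then show "X ^ m * exp (- (c * X)) \<le> fact m / c ^ m"
    using c by (simp add: exp_minus power_mult_distrib field_simps)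
qed

lemma nn_integral_power_exp_finite:
  fixes c :: real
  assumes c: "c > 0" and a: "a > 0"
  shows "(\<integral>\<^sup>+y. ennreal (\<bar>y\<bar> ^ n * exp (- (c * \<bar>y\<bar> ^ a))) \<partial>lborel) < \<infinity>"
proof -
  \<comment> \<open>The two extra powers pay for the factor 1 + y^2 of the integrable
    majorant.\<close>
  obtain K where K: "K > 0" "\<And>X. X \<ge> 0 \<Longrightarrow> X ^ (n + 2) * exp (- (c * X)) \<le> K"
    using power_mult_exp_bound[OF c] by blast
  have le: "\<bar>y\<bar> ^ n * exp (- (c * \<bar>y\<bar> ^ a)) \<le> 2 * (1 + K) * inverse (1 + y\<^sup>2)" for y :: real
  proof -
    define r where "r = \<bar>y\<bar>"
    have r0: "0 \<le> r" by (simp add: r_def)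
    have "r ^ n * (1 + r\<^sup>2) * exp (- (c * r ^ a)) \<le> 2 * (1 + K)"
    proof (cases "r \<le> 1")
      case True
      have "r ^ n * (1 + r\<^sup>2) \<le> 1 * (1 + 1)"
        using True r0 by (intro mult_mono add_mono power_le_one) auto
      then have "r ^ n * (1 + r\<^sup>2) * exp (- (c * r ^ a)) \<le> 2 * 1"
        using c r0 by (intro mult_mono) auto
      then show ?thesis using K(1) by simp
    next
      case False
      then have r1: "1 \<le> r" by simp
      have "r ^ n * (1 + r\<^sup>2) \<le> r ^ n * (2 * r\<^sup>2)" using r1 by (intro mult_left_mono) auto
      also have "\<dots> = 2 * r ^ (n + 2)" by (simp add: power_add power2_eq_square)
      also have "\<dots> \<le> 2 * (r ^ a) ^ (n + 2)"
        using r1 a by (intro mult_left_mono power_mono self_le_power) auto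
      finally have "r ^ n * (1 + r\<^sup>2) * exp (- (c * r ^ a)) \<le> 2 * ((r ^ a) ^ (n + 2) * exp (- (c * r ^ a)))"
        by (simp add: mult.assoc)
      also have "\<dots> \<le> 2 * K" using K(2)[of "r ^ a"] r0 by simp
      finally show ?thesis using K(1) by simp
    qed
    moreover have "0 < 1 + r\<^sup>2" by (simp add: add_pos_nonneg)
    ultimately have "r ^ n * exp (- (c * r ^ a)) \<le> 2 * (1 + K) * inverse (1 + r\<^sup>2)"
      by (simp add: field_simps)
    then show ?thesis by (simp add: r_def)
  qed
  have "(\<integral>\<^sup>+y. ennreal (\<bar>y\<bar> ^ n * exp (- (c * \<bar>y\<bar> ^ a))) \<partial>lborel) \<le> (\<integral>\<^sup>+y. ennreal (2 * (1 + K) * inverse (1 + y\<^sup>2)) \<partial>lborel)"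
    by (intro nn_integral_mono ennreal_leI le)
  also have "\<dots> = ennreal (LINT y|lborel. 2 * (1 + K) * inverse (1 + y\<^sup>2))"
    using K(1) integrable_inverse_1_plus_square' by (intro nn_integral_eq_integral) (auto simp: add_nonneg_nonneg)
  also have "\<dots> < \<infinity>" by simp
  finally show ?thesis .
qed

text \<open>Rescaling of \<xi> by s = (1 + t)^(1 / a). On [-1, 1] the exponent changes by at most
  \<open>c\<close> when \<open>t\<close> is replaced by \<open>1 + t\<close>, which costs the factor
  \<open>exp c\<close> and keeps the bound finite at t = 0.\<close>

lemma low_frequency_integral:
  fixes c :: real
  assumes c: "c > 0" and a: "a > 0"
  obtains K where "K > 0" "\<And>t. t \<ge> 0 \<Longrightarrow>
    (\<integral>\<^sup>+\<xi>. ennreal (\<bar>\<xi>\<bar> ^ n * exp (- (c * t * \<bar>\<xi>\<bar> ^ a))) * indicator {-1..1} \<xi> \<partial>lborel)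
      \<le> ennreal (K * (1 + t) powr (- (real n + 1) / real a))"
proof -
  define J where "J = (\<integral>\<^sup>+y. ennreal (\<bar>y\<bar> ^ n * exp (- (c * \<bar>y\<bar> ^ a))) \<partial>lborel)"
  have "J < \<infinity>" unfolding J_def by (rule nn_integral_power_exp_finite[OF c a])
  then obtain j where j: "J = ennreal j" "0 \<le> j" by (cases J) auto
  have bound: "(\<integral>\<^sup>+\<xi>. ennreal (\<bar>\<xi>\<bar> ^ n * exp (- (c * t * \<bar>\<xi>\<bar> ^ a))) * indicator {-1..1} \<xi> \<partial>lborel)
      \<le> ennreal (exp c * (j + 1) * (1 + t) powr (- (real n + 1) / real a))" if t: "t \<ge> 0" for t
  proof -
    define s where "s = (1 + t) powr (1 / real a)"
    have s: "0 < s" using t by (simp add: s_def)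
    have sa: "s ^ a = 1 + t"
    proof -
      have "s ^ a = (1 + t) powr (1 / real a * real a)"
        using t unfolding s_def by (simp add: powr_powr flip: powr_realpow)
      then show ?thesis using a t by simp
    qed
    have sn: "s ^ n * s = (1 + t) powr ((real n + 1) / real a)"
    proof -
      have "s ^ n * s = s powr (real n + 1)" using s by (simp add: powr_add powr_realpow)
      then show ?thesis by (simp add: s_def powr_powr add_divide_distrib)
    qed
    have "(\<integral>\<^sup>+\<xi>. ennreal (\<bar>\<xi>\<bar> ^ n * exp (- (c * t * \<bar>\<xi>\<bar> ^ a))) * indicator {-1..1} \<xi> \<partial>lborel)
      \<le> (\<integral>\<^sup>+\<xi>. ennreal (exp c / s ^ n) * ennreal (\<bar>s * \<xi>\<bar> ^ n * exp (- (c * \<bar>s * \<xi>\<bar> ^ a))) \<partial>lborel)"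
    proof (rule nn_integral_mono)
      fix \<xi> :: real
      show "ennreal (\<bar>\<xi>\<bar> ^ n * exp (- (c * t * \<bar>\<xi>\<bar> ^ a))) * indicator {-1..1} \<xi>
        \<le> ennreal (exp c / s ^ n) * ennreal (\<bar>s * \<xi>\<bar> ^ n * exp (- (c * \<bar>s * \<xi>\<bar> ^ a)))"
      proof (cases "\<xi> \<in> {-1..1}")
        case True
        then have "\<bar>\<xi>\<bar> ^ a \<le> 1" by (intro power_le_one) auto
        then have "c * \<bar>\<xi>\<bar> ^ a \<le> c * 1" using c by (intro mult_left_mono) auto
        then have "- (c * t * \<bar>\<xi>\<bar> ^ a) \<le> c + - (c * \<bar>s * \<xi>\<bar> ^ a)"
          using s by (simp add: abs_mult power_mult_distrib sa algebra_simps)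
        then have "exp (- (c * t * \<bar>\<xi>\<bar> ^ a)) \<le> exp c * exp (- (c * \<bar>s * \<xi>\<bar> ^ a))"
          unfolding exp_add[symmetric] by simp
        then have "\<bar>\<xi>\<bar> ^ n * exp (- (c * t * \<bar>\<xi>\<bar> ^ a)) \<le> \<bar>\<xi>\<bar> ^ n * (exp c * exp (- (c * \<bar>s * \<xi>\<bar> ^ a)))"
          by (intro mult_left_mono) auto
        also have "\<dots> = exp c / s ^ n * (\<bar>s * \<xi>\<bar> ^ n * exp (- (c * \<bar>s * \<xi>\<bar> ^ a)))"
          using s by (simp add: abs_mult[of s \<xi>] power_mult_distrib[of _ _ n])
        finally show ?thesis using True s by (simp add: ennreal_mult[symmetric] ennreal_leI)
      qed simp
    qed
    also have "\<dots> = ennreal (exp c / s ^ n) * (\<integral>\<^sup>+\<xi>. ennreal (\<bar>s * \<xi>\<bar> ^ n * exp (- (c * \<bar>s * \<xi>\<bar> ^ a))) \<partial>lborel)"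
      by (rule nn_integral_cmult) measurable
    also have "(\<integral>\<^sup>+\<xi>. ennreal (\<bar>s * \<xi>\<bar> ^ n * exp (- (c * \<bar>s * \<xi>\<bar> ^ a))) \<partial>lborel) = ennreal (1 / s) * J"
      unfolding J_def
      using nn_integral_real_affine[of "\<lambda>\<xi>. ennreal (\<bar>s * \<xi>\<bar> ^ n * exp (- (c * \<bar>s * \<xi>\<bar> ^ a)))" "1 / s" 0] s by simp
    also have "ennreal (exp c / s ^ n) * (ennreal (1 / s) * J) = ennreal (exp c * j / (s ^ n * s))"
      using s j by (simp add: ennreal_mult[symmetric])
    also have "\<dots> \<le> ennreal (exp c * (j + 1) * (1 + t) powr (- (real n + 1) / real a))"
    proof (rule ennreal_leI)
      have "exp c * j / (s ^ n * s) = exp c * j * (1 + t) powr (- ((real n + 1) / real a))"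
        unfolding sn powr_minus by (simp add: divide_inverse)
      also have "\<dots> \<le> exp c * (j + 1) * (1 + t) powr (- ((real n + 1) / real a))"
        by (intro mult_right_mono mult_left_mono) auto
      finally show "exp c * j / (s ^ n * s) \<le> exp c * (j + 1) * (1 + t) powr (- (real n + 1) / real a)"
        by (simp only: minus_divide_left)
    qed
    finally show ?thesis .
  qed
  show thesis by (rule that[of "exp c * (j + 1)"]) (use j bound in auto)
qed

text \<open>With q = sqrt (1 + t) / x^2 the left side is at most a constant times exp (- c q^2),
  which is dominated by q^-l. The rate is squared because it will be applied to squared
  norms.\<close>

lemma high_frequency_weight_4:
  fixes c :: real
  assumes c: "c > 0"
  obtains K where "K > 0" "\<And>t x. t \<ge> 0 \<Longrightarrow> x \<ge> 1 \<Longrightarrow>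
    exp (- (c * t / x ^ 4)) \<le> K * ((1 + t) powr (- real l / 4))\<^sup>2 * x ^ (2 * l)"
proof -
  obtain K where K: "K > 0" "\<And>X. X \<ge> 0 \<Longrightarrow> X ^ l * exp (- (c * X)) \<le> K"
    using power_mult_exp_bound[OF c] by blast
  have "exp (- (c * t / x ^ 4)) \<le> exp c * (1 + K) * ((1 + t) powr (- real l / 4))\<^sup>2 * x ^ (2 * l)"
    if t: "t \<ge> 0" and x: "x \<ge> 1" for t x
  proof -
    define q where "q = sqrt (1 + t) / x\<^sup>2"
    have q0: "0 < q" using t x by (simp add: q_def)
    have q2: "q\<^sup>2 = (1 + t) / x ^ 4" using t by (simp add: q_def power_divide)
    have "q ^ l * exp (- (c * q\<^sup>2)) \<le> 1 + K"
    \<comment> \<open>\<open>K\<close> controls the power \<open>l\<close> of q^2, while only the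
      power \<open>l\<close> of \<open>q\<close> is wanted; the former is the larger one exactly
      where q >= 1.\<close>
    proof (cases "q \<le> 1")
      case True
      have "q ^ l * exp (- (c * q\<^sup>2)) \<le> 1 * 1"
        using True q0 c by (intro mult_mono power_le_one) auto
      then show ?thesis using K(1) by simp
    next
      case False
      have "q ^ l \<le> (q\<^sup>2) ^ l" using False by (intro power_mono self_le_power) auto
      then have "q ^ l * exp (- (c * q\<^sup>2)) \<le> (q\<^sup>2) ^ l * exp (- (c * q\<^sup>2))" by (intro mult_right_mono) auto
      also have "\<dots> \<le> K" by (rule K) simp
      finally show ?thesis by simp
    qed
    then have 1: "exp (- (c * q\<^sup>2)) \<le> (1 + K) / q ^ l" using q0 by (simp add: field_simps)
    have "- (c * t / x ^ 4) = c / x ^ 4 + - (c * q\<^sup>2)" using x by (simp add: q2 field_simps)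
    also have "\<dots> \<le> c + - (c * q\<^sup>2)" using c x by (simp add: divide_le_eq mult_left_le_one_le[of _ "x ^ 4"] one_le_power)
    finally have "exp (- (c * t / x ^ 4)) \<le> exp c * exp (- (c * q\<^sup>2))" unfolding exp_add[symmetric] by simp
    also have "\<dots> \<le> exp c * ((1 + K) / q ^ l)" by (intro mult_left_mono 1) simp
    also have "q ^ l = (1 + t) powr (real l / 2) / x ^ (2 * l)"
      using t by (simp add: q_def power_divide power_mult powr_half_sqrt[symmetric] powr_powr flip: powr_realpow)
    also have "exp c * ((1 + K) / ((1 + t) powr (real l / 2) / x ^ (2 * l)))
        = exp c * (1 + K) * (1 + t) powr (- (real l / 2)) * x ^ (2 * l)"
      using t by (simp add: powr_minus field_simps)
    also have "(1 + t) powr (- (real l / 2)) = ((1 + t) powr (- real l / 4))\<^sup>2"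
      by (simp add: power2_eq_square flip: powr_add)
    finally show ?thesis .
  qed
  then show thesis by (intro that[of "exp c * (1 + K)"]) (use K in auto)
qed

text \<open>The same trade with X = (1 + t) / x^2, to which the exponential bound applies directly
  with the power \<open>l\<close>.\<close>

lemma high_frequency_weight_2:
  fixes c :: real
  assumes c: "c > 0"
  obtains K where "K > 0" "\<And>t x. t \<ge> 0 \<Longrightarrow> x \<ge> 1 \<Longrightarrow>
    exp (- (c * t / x\<^sup>2)) \<le> K * ((1 + t) powr (- real l / 2))\<^sup>2 * x ^ (2 * l)"
proof -
  obtain K where K: "K > 0" "\<And>X. X \<ge> 0 \<Longrightarrow> X ^ l * exp (- (c * X)) \<le> K"
    using power_mult_exp_bound[OF c] by blast
  have "exp (- (c * t / x\<^sup>2)) \<le> exp c * K * ((1 + t) powr (- real l / 2))\<^sup>2 * x ^ (2 * l)"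
    if t: "t \<ge> 0" and x: "x \<ge> 1" for t x
  proof -
    define X where "X = (1 + t) / x\<^sup>2"
    have X0: "0 < X" using t x by (simp add: X_def)
    have 1: "exp (- (c * X)) \<le> K / X ^ l" using K(2)[of X] X0 by (simp add: field_simps)
    have "- (c * t / x\<^sup>2) = c / x\<^sup>2 + - (c * X)" using x by (simp add: X_def field_simps)
    also have "\<dots> \<le> c + - (c * X)" using c x by (simp add: divide_le_eq mult_left_le_one_le[of _ "x\<^sup>2"] one_le_power)
    finally have "exp (- (c * t / x\<^sup>2)) \<le> exp c * exp (- (c * X))" unfolding exp_add[symmetric] by simp
    also have "\<dots> \<le> exp c * (K / X ^ l)" by (intro mult_left_mono 1) simp
    also have "X ^ l = (1 + t) powr real l / x ^ (2 * l)"
      using t by (simp add: X_def power_divide power_mult powr_realpow)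
    also have "exp c * (K / ((1 + t) powr real l / x ^ (2 * l))) = exp c * K * (1 + t) powr (- real l) * x ^ (2 * l)"
      using t by (simp add: powr_minus field_simps)
    also have "(1 + t) powr (- real l) = ((1 + t) powr (- real l / 2))\<^sup>2"
      by (simp add: power2_eq_square flip: powr_add)
    finally show ?thesis .
  qed
  then show thesis by (intro that[of "exp c * K"]) (use K in auto)
qed

section \<open>Decay of the beam system\<close>

lemma UNIV_8: "(UNIV :: 8 set) = {1, 2, 3, 4, 5, 6, 7, 8}"
proof (rule set_eqI)
  show "x \<in> UNIV \<longleftrightarrow> x \<in> {1, 2, 3, 4, 5, 6, 7, 8}" for x :: 8
    using exhaust_8[of x] by simp
qed

lemma sum_8: "sum f (UNIV :: 8 set) = f 1 + f 2 + f 3 + f 4 + f 5 + f 6 + f 7 + f 8"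
  unfolding UNIV_8 by (simp add: add.assoc)

text \<open>With these weights the coupled equations contribute opposite terms to the energy
  balance, see \<open>inner_A\<close>.\<close>

definition beam_weight :: "real \<Rightarrow> real \<Rightarrow> real \<Rightarrow> real \<Rightarrow> 8 \<Rightarrow> real" where
  "beam_weight k1 k2 k3 k4 i = vector [k1, 1, k2, 1, k3, 1, k4, 1] $ i"

lemma beam_weight_simps:
  "beam_weight k1 k2 k3 k4 1 = k1" "beam_weight k1 k2 k3 k4 2 = 1" "beam_weight k1 k2 k3 k4 3 = k2"
  "beam_weight k1 k2 k3 k4 4 = 1" "beam_weight k1 k2 k3 k4 5 = k3" "beam_weight k1 k2 k3 k4 6 = 1"
  "beam_weight k1 k2 k3 k4 7 = k4" "beam_weight k1 k2 k3 k4 8 = 1"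
  unfolding beam_weight_def vector_8 by (rule refl)+

locale beam =
  fixes k1 k2 k3 k4 k5 \<gamma> :: real and \<epsilon> :: nat
  assumes pos: "0 < k1" "0 < k2" "0 < k3" "0 < k4" "0 < k5" and \<gamma>: "\<gamma> \<noteq> 0" and \<epsilon>: "\<epsilon> \<in> {0, 1}"
begin

abbreviation "A \<equiv> beam_matrix k1 k2 k3 k4 k5 \<gamma> 0 1 0 \<epsilon>"

abbreviation "\<kappa> \<equiv> beam_weight k1 k2 k3 k4"

text \<open>The symbol of the dissipation term: the sign \<open>(-1) ^ \<epsilon>\<close> cancels
  that of \<open>\<i> ^ (2 * \<epsilon>)\<close>, so both kinds of damping have a nonnegative
  symbol.\<close>

definition damping :: "real \<Rightarrow> real" where
  "damping \<xi> = k5 * \<bar>\<xi>\<bar> ^ (2 * \<epsilon>)"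

lemma A_nth:
  "(A \<xi> *v x) $ 1 = \<i> * \<xi> * x $ 2 + x $ 4 + x $ 6"
  "(A \<xi> *v x) $ 2 = k1 * (\<i> * \<xi> * x $ 1)"
  "(A \<xi> *v x) $ 3 = \<i> * \<xi> * x $ 4"
  "(A \<xi> *v x) $ 4 = k2 * (\<i> * \<xi> * x $ 3) - k1 * x $ 1 - \<gamma> * (\<i> * \<xi> * x $ 8)"
  "(A \<xi> *v x) $ 5 = \<i> * \<xi> * x $ 6"
  "(A \<xi> *v x) $ 6 = k3 * (\<i> * \<xi> * x $ 5) - k1 * x $ 1"
  "(A \<xi> *v x) $ 7 = \<i> * \<xi> * x $ 8"
  "(A \<xi> *v x) $ 8 = k4 * (\<i> * \<xi> * x $ 7) - damping \<xi> * x $ 8 - \<gamma> * (\<i> * \<xi> * x $ 4)"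
proof -
  have "\<epsilon> = 0 \<or> \<epsilon> = 1" using \<epsilon> by simp
  then have d: "(-1) ^ \<epsilon> * complex_of_real k5 * ((\<i> * of_real \<xi>) ^ (2 * \<epsilon>) * \<eta>) = damping \<xi> * \<eta>" for \<eta> :: complex
    unfolding damping_def by (elim disjE) (simp_all add: power_mult_distrib mult.assoc)
  show "(A \<xi> *v x) $ 1 = \<i> * \<xi> * x $ 2 + x $ 4 + x $ 6"
    "(A \<xi> *v x) $ 2 = k1 * (\<i> * \<xi> * x $ 1)"
    "(A \<xi> *v x) $ 3 = \<i> * \<xi> * x $ 4"
    "(A \<xi> *v x) $ 4 = k2 * (\<i> * \<xi> * x $ 3) - k1 * x $ 1 - \<gamma> * (\<i> * \<xi> * x $ 8)"
    "(A \<xi> *v x) $ 5 = \<i> * \<xi> * x $ 6"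
    "(A \<xi> *v x) $ 6 = k3 * (\<i> * \<xi> * x $ 5) - k1 * x $ 1"
    "(A \<xi> *v x) $ 7 = \<i> * \<xi> * x $ 8"
    "(A \<xi> *v x) $ 8 = k4 * (\<i> * \<xi> * x $ 7) - damping \<xi> * x $ 8 - \<gamma> * (\<i> * \<xi> * x $ 4)"
    unfolding beam_matrix_mult beam_rhs_def Let_def vector_8 using d[of "x $ 8"] by (simp_all add: mult.assoc)
qed

lemma damping_pos: "\<xi> \<noteq> 0 \<Longrightarrow> 0 < damping \<xi>" and damping_nonneg: "0 \<le> damping \<xi>"
  using pos by (simp_all add: damping_def)

text \<open>Multiplication by \<i> \<xi> is skew for the real inner product on complex numbers, so
  the wave terms and the coupling by \<gamma> cancel in pairs. The terms of order zero cancel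
  because \<open>v\<close> has the weight \<open>k1\<close>.\<close>

lemma inner_A: "(\<Sum>i\<in>UNIV. \<kappa> i * (x $ i \<bullet> (A \<xi> *v x) $ i)) = - (damping \<xi> * (norm (x $ 8))\<^sup>2)"
proof -
  have skew: "a \<bullet> (\<i> * \<xi> * b) = - (b \<bullet> (\<i> * \<xi> * a))" for a b :: complex
    by (simp add: inner_complex_def)
  have re: "a \<bullet> (of_real k * b) = k * (a \<bullet> b)" for a b :: complex and k
    by (simp flip: scaleR_conv_of_real)
  show ?thesis
    unfolding sum_8 A_nth beam_weight_simps inner_add_right inner_diff_right re power2_norm_eq_inner
      skew[of "x $ 2" "x $ 1"] skew[of "x $ 4" "x $ 3"] skew[of "x $ 6" "x $ 5"]
      skew[of "x $ 8" "x $ 7"] skew[of "x $ 8" "x $ 4"]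
      inner_commute[of "x $ 4" "x $ 1"] inner_commute[of "x $ 6" "x $ 1"]
    by (simp add: algebra_simps)
qed

text \<open>A sum of 1, the coefficients and their reciprocals: a crude constant that meets all
  requirements on \<open>B\<close> at once.\<close>

definition bnd :: real where
  "bnd = 1 + k1 + k2 + k3 + k4 + k5 + \<bar>\<gamma>\<bar> + 1 / k1 + 1 / k2 + 1 / k3 + 1 / k4 + 1 / k5 + 1 / \<bar>\<gamma>\<bar>"

lemma bnd:
  "1 \<le> bnd" "k1 \<le> bnd" "k2 \<le> bnd" "k3 \<le> bnd" "k4 \<le> bnd" "k5 \<le> bnd" "\<bar>\<gamma>\<bar> \<le> bnd"
  "1 \<le> bnd * k1" "1 \<le> bnd * k2" "1 \<le> bnd * k3" "1 \<le> bnd * k4" "1 \<le> bnd * k5" "1 \<le> bnd * \<bar>\<gamma>\<bar>"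
proof -
  have p: "0 < \<bar>\<gamma>\<bar>" "0 < 1 / k1" "0 < 1 / k2" "0 < 1 / k3" "0 < 1 / k4" "0 < 1 / k5" "0 < 1 / \<bar>\<gamma>\<bar>"
    using pos \<gamma> by simp_all
  show "1 \<le> bnd" "k1 \<le> bnd" "k2 \<le> bnd" "k3 \<le> bnd" "k4 \<le> bnd" "k5 \<le> bnd" "\<bar>\<gamma>\<bar> \<le> bnd"
    using p pos unfolding bnd_def by linarith+
  have *: "1 \<le> bnd * k" if "1 / k \<le> bnd" "0 < k" for k
    using that by (simp add: field_simps)
  have "1 / k1 \<le> bnd" "1 / k2 \<le> bnd" "1 / k3 \<le> bnd" "1 / k4 \<le> bnd" "1 / k5 \<le> bnd" "1 / \<bar>\<gamma>\<bar> \<le> bnd"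
    using p pos unfolding bnd_def by linarith+
  with p pos show "1 \<le> bnd * k1" "1 \<le> bnd * k2" "1 \<le> bnd * k3" "1 \<le> bnd * k4" "1 \<le> bnd * k5" "1 \<le> bnd * \<bar>\<gamma>\<bar>"
    by (auto intro!: *)
qed

abbreviation resid :: "real \<Rightarrow> real \<Rightarrow> complex ^ 8 \<Rightarrow> complex ^ 8" where
  "resid \<xi> \<omega> x \<equiv> (\<i> * of_real \<omega>) *s x - A \<xi> *v x"

definition comp_sum :: "complex ^ 8 \<Rightarrow> real" where
  "comp_sum x = norm (x $ 1) + norm (x $ 2) + norm (x $ 3) + norm (x $ 4) + norm (x $ 5) + norm (x $ 6)
    + norm (x $ 7) + norm (x $ 8)"

lemma norm_le_comp_sum: "norm x \<le> comp_sum x"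
  using L2_set_le_sum[of UNIV "\<lambda>i. norm (x $ i)"] by (simp add: norm_vec_def comp_sum_def sum_8)

lemma comp_sum_nonneg: "0 \<le> comp_sum x" by (simp add: comp_sum_def)

text \<open>\<open>B\<close> is left free because different ranges of \<omega> are treated with
  different constants.\<close>

lemma resolvent_interp:
  assumes "\<xi> \<noteq> 0" "bnd \<le> B"
  shows "beam_resolvent k1 k2 k3 k4 \<gamma> (damping \<xi>) B \<xi> \<omega> (norm (resid \<xi> \<omega> x)) \<bar>\<xi>\<bar> \<bar>\<omega>\<bar>
    (x $ 1) (x $ 2) (x $ 3) (x $ 4) (x $ 5) (x $ 6) (x $ 7) (x $ 8)
    (resid \<xi> \<omega> x $ 1) (resid \<xi> \<omega> x $ 2) (resid \<xi> \<omega> x $ 3) (resid \<xi> \<omega> x $ 4)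
    (resid \<xi> \<omega> x $ 5) (resid \<xi> \<omega> x $ 6) (resid \<xi> \<omega> x $ 7) (resid \<xi> \<omega> x $ 8)"
proof -
  have B: "bnd * k \<le> B * k" if "0 \<le> k" for k by (rule mult_right_mono[OF assms(2) that])
  have low: "1 \<le> B * k1" "1 \<le> B * k2" "1 \<le> B * k3" "1 \<le> B * k4" "1 \<le> B * \<bar>\<gamma>\<bar>"
    using pos by (intro order_trans[OF bnd(8) B] order_trans[OF bnd(9) B] order_trans[OF bnd(10) B]
      order_trans[OF bnd(11) B] order_trans[OF bnd(13) B]; simp)+
  have up: "k1 \<le> B" "k2 \<le> B" "k3 \<le> B" "k4 \<le> B" "\<bar>\<gamma>\<bar> \<le> B" "1 \<le> B"
    by (rule order_trans[OF _ assms(2)], rule bnd)+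
  show ?thesis
    using low up pos damping_nonneg assms(1)
    by unfold_locales
      (simp_all add: A_nth Finite_Cartesian_Product.norm_nth_le del: vector_minus_component,
       simp_all add: A_nth)
qed

text \<open>The resolvent equation is tested with the weighted solution: the term \<i> \<omega> is
  orthogonal to it and the conservative part cancels, so the dissipation is left against the
  data.\<close>

lemma resolvent_dissipation:
  "damping \<xi> * (norm (x $ 8))\<^sup>2 \<le> bnd * (comp_sum x * norm (resid \<xi> \<omega> x))"
proof -
  let ?F = "resid \<xi> \<omega> x"
  have i0: "z \<bullet> (\<i> * of_real \<omega> * z) = 0" for z
    by (simp add: inner_complex_def algebra_simps)
  have "(\<Sum>i\<in>UNIV. \<kappa> i * (x $ i \<bullet> ?F $ i)) = - (\<Sum>i\<in>UNIV. \<kappa> i * (x $ i \<bullet> (A \<xi> *v x) $ i))"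
    by (simp add: inner_diff_right i0 sum_negf)
  then have "damping \<xi> * (norm (x $ 8))\<^sup>2 = (\<Sum>i\<in>UNIV. \<kappa> i * (x $ i \<bullet> ?F $ i))"
    by (simp add: inner_A)
  also have "\<dots> \<le> (\<Sum>i\<in>UNIV. bnd * (norm (x $ i) * norm ?F))"
  proof (rule sum_mono)
    fix i :: 8
    have k: "0 \<le> \<kappa> i" "\<kappa> i \<le> bnd"
      using exhaust_8[of i] pos bnd by (auto simp: beam_weight_simps)
    have "x $ i \<bullet> ?F $ i \<le> norm (x $ i) * norm (?F $ i)" by (rule norm_cauchy_schwarz)
    also have "\<dots> \<le> norm (x $ i) * norm ?F"
      by (intro mult_left_mono Finite_Cartesian_Product.norm_nth_le) auto
    finally have "\<kappa> i * (x $ i \<bullet> ?F $ i) \<le> \<kappa> i * (norm (x $ i) * norm ?F)" using k by (intro mult_left_mono)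
    also have "\<dots> \<le> bnd * (norm (x $ i) * norm ?F)" using k by (intro mult_right_mono) auto
    finally show "\<kappa> i * (x $ i \<bullet> ?F $ i) \<le> bnd * (norm (x $ i) * norm ?F)" .
  qed
  also have "\<dots> = bnd * (comp_sum x * norm ?F)"
    by (simp add: comp_sum_def sum_8 algebra_simps)
  finally show ?thesis .
qed

text \<open>The constant in the condition of \<open>small_frequency\<close>. Used as
  \<open>B\<close> in the intermediate range, it makes the three ranges cover all \<omega>.\<close>

definition big :: real where "big = 48 * bnd ^ 3"

lemma big: "bnd \<le> big" "1 \<le> big" "32 * bnd \<le> big"
proof -
  have b: "bnd * 1 \<le> bnd * bnd\<^sup>2" using bnd(1) by (intro mult_left_mono one_le_power) auto
  then have "32 * bnd \<le> big"
    using bnd(1) by (simp add: big_def power2_eq_square power3_eq_cube)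
  then show "bnd \<le> big" "1 \<le> big" "32 * bnd \<le> big"
    using bnd(1) by linarith+
qed

section \<open>Resolvent bounds for the beam\<close>

lemma damping_le: "\<bar>\<xi>\<bar> \<le> 1 \<Longrightarrow> damping \<xi> \<le> bnd"
proof -
  assume "\<bar>\<xi>\<bar> \<le> 1"
  then have "damping \<xi> \<le> k5 * 1" unfolding damping_def using pos by (intro mult_left_mono power_le_one) auto
  then show ?thesis using bnd(6) by simp
qed

lemma low_frequency_static:
  assumes \<xi>: "\<xi> \<noteq> 0" "\<bar>\<xi>\<bar> \<le> 1"
  shows "\<xi>\<^sup>2 * comp_sum x \<le> 100 * big ^ 9 * (norm (x $ 8) + norm (resid \<xi> \<omega> x) / \<bar>\<xi>\<bar>)"
proof -
  let ?E = "norm (resid \<xi> \<omega> x)" and ?r = "\<bar>\<xi>\<bar>" and ?e = "norm (x $ 8)"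
  interpret b: beam_resolvent k1 k2 k3 k4 \<gamma> "damping \<xi>" bnd \<xi> \<omega> ?E ?r "\<bar>\<omega>\<bar>"
    "x $ 1" "x $ 2" "x $ 3" "x $ 4" "x $ 5" "x $ 6" "x $ 7" "x $ 8"
    "resid \<xi> \<omega> x $ 1" "resid \<xi> \<omega> x $ 2" "resid \<xi> \<omega> x $ 3" "resid \<xi> \<omega> x $ 4"
    "resid \<xi> \<omega> x $ 5" "resid \<xi> \<omega> x $ 6" "resid \<xi> \<omega> x $ 7" "resid \<xi> \<omega> x $ 8"
    by (rule resolvent_interp[OF \<xi>(1) order_refl])
  \<comment> \<open>The outer ranges of \<omega> are treated with \<open>bnd\<close>. The ends of
    the intermediate range involve the constants of the outer ones, so there the larger
    \<open>big\<close> takes the place of \<open>B\<close>.\<close>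
  interpret c: beam_resolvent k1 k2 k3 k4 \<gamma> "damping \<xi>" big \<xi> \<omega> ?E ?r "\<bar>\<omega>\<bar>"
    "x $ 1" "x $ 2" "x $ 3" "x $ 4" "x $ 5" "x $ 6" "x $ 7" "x $ 8"
    "resid \<xi> \<omega> x $ 1" "resid \<xi> \<omega> x $ 2" "resid \<xi> \<omega> x $ 3" "resid \<xi> \<omega> x $ 4"
    "resid \<xi> \<omega> x $ 5" "resid \<xi> \<omega> x $ 6" "resid \<xi> \<omega> x $ 7" "resid \<xi> \<omega> x $ 8"
    by (rule resolvent_interp[OF \<xi>(1) big(1)])
  have r: "0 < ?r" using \<xi> by simp
  have rr: "?r * ?r = \<xi>\<^sup>2" by (simp add: power2_eq_square)
  have alg: "r * r * (b * (E / (r * r) + (1 + d / r) * e)) = b * (E + (r * r + r * d) * e)" if "0 < r" for r b E d e :: real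
    using that by (simp add: field_simps)
  have rle: "\<xi>\<^sup>2 \<le> ?r" using mult_left_le[OF \<xi>(2), of ?r] rr by simp
  have big9: "big * big \<le> big ^ 9"
    using big(2) power_increasing[of 2 9 big] by (simp add: power2_eq_square)
  have r1: "1 * ?E \<le> ?E / ?r" using \<xi> r by (simp add: le_divide_eq mult_left_le)
  consider "48 * bnd ^ 3 * \<bar>\<omega>\<bar> \<le> \<xi>\<^sup>2" | "16 * bnd * (1 + ?r) \<le> \<bar>\<omega>\<bar>"
    | "\<xi>\<^sup>2 \<le> big * \<bar>\<omega>\<bar>" "\<bar>\<omega>\<bar> \<le> 16 * bnd * (1 + ?r)"
    unfolding big_def by linarith
  then show ?thesis
  proof cases
    case 1
    have "comp_sum x \<le> big * (?E / \<xi>\<^sup>2 + (1 + damping \<xi> / ?r) * ?e)"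
      using b.small_frequency[of "\<xi>\<^sup>2"] 1 \<xi> rle rr unfolding comp_sum_def big_def by simp
    then have "\<xi>\<^sup>2 * comp_sum x \<le> \<xi>\<^sup>2 * (big * (?E / \<xi>\<^sup>2 + (1 + damping \<xi> / ?r) * ?e))"
      by (intro mult_left_mono) auto
    also have "\<dots> = big * (?E + (\<xi>\<^sup>2 + ?r * damping \<xi>) * ?e)"
      using alg[OF r, of big ?E "damping \<xi>" ?e] unfolding rr .
    also have "\<dots> \<le> big * (big * (?E / ?r) + (2 * big) * ?e)"
    proof (intro mult_left_mono add_mono mult_right_mono)
      show "?E \<le> big * (?E / ?r)" using r1 mult_right_mono[OF big(2), of "?E / ?r"] r by simp
      have "?r * damping \<xi> \<le> 1 * bnd" using \<xi> damping_le damping_nonneg by (intro mult_mono) auto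
      moreover have "\<xi>\<^sup>2 \<le> 1" using rle \<xi> by simp
      ultimately show "\<xi>\<^sup>2 + ?r * damping \<xi> \<le> 2 * big" using big by simp
    qed (use big in auto)
    also have "\<dots> = (big * big) * (?E / ?r + 2 * ?e)" by (simp add: algebra_simps)
    also have "\<dots> \<le> big ^ 9 * (100 * (?e + ?E / ?r))"
    proof (intro mult_mono)
      have "0 \<le> ?E / ?r" using r by simp
      then show "?E / ?r + 2 * ?e \<le> 100 * (?e + ?E / ?r)" using norm_ge_zero[of "x $ 8"] unfolding distrib_left by linarith
    qed (use big big9 in auto)
    finally show ?thesis by (simp only: mult_ac)
  next
    case 2
    have "comp_sum x \<le> ?E" using b.large_frequency[OF 2] by (simp add: comp_sum_def)
    then have "\<xi>\<^sup>2 * comp_sum x \<le> 1 * ?E" using rle \<xi> comp_sum_nonneg[of x] by (intro mult_mono) auto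
    also have "\<dots> \<le> ?E / ?r" by (rule r1)
    also have "\<dots> \<le> (100 * big ^ 9) * (?E / ?r)"
      using mult_right_mono[of 1 "100 * big ^ 9" "?E / ?r"] one_le_power[OF big(2), of 9] r by simp
    also have "\<dots> \<le> 100 * big ^ 9 * (?e + ?E / ?r)"
      using big by (intro mult_left_mono) auto
    finally show ?thesis .
  next
    case 3
    have "16 * bnd * (1 + ?r) \<le> 16 * bnd * 2" using \<xi> bnd(1) by (intro mult_left_mono) auto
    then have "\<bar>\<omega>\<bar> \<le> big" using 3(2) big(3) by linarith
    then show ?thesis
      using c.low_frequency_middle 3(1) \<xi> rr damping_le[OF \<xi>(2)] big unfolding comp_sum_def by simp
  qed
qed

lemma high_frequency_static:
  fixes \<xi> \<omega> :: real and x :: "complex ^ 8"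
  assumes \<xi>: "1 \<le> \<bar>\<xi>\<bar>"
  defines "e \<equiv> norm (x $ 8)" and "E \<equiv> norm (resid \<xi> \<omega> x)" and "r \<equiv> \<bar>\<xi>\<bar>" and "d \<equiv> damping \<xi>"
  shows "comp_sum x \<le> 60 * big ^ 9 * (r * ((r + d) * e + 2 * E))"
    and "k1 = k3 \<Longrightarrow> comp_sum x \<le> 60 * big ^ 9 * ((r + d) * e + 2 * E)"
    and "k1 = k2 \<Longrightarrow> k1 = k3 \<Longrightarrow> \<epsilon> = 1 \<Longrightarrow> comp_sum x \<le> 63 * big ^ 9 * ((1 + d / r) * e + 2 * E)"
proof -
  have \<xi>0: "\<xi> \<noteq> 0" using \<xi> by auto
  interpret b: beam_resolvent k1 k2 k3 k4 \<gamma> d bnd \<xi> \<omega> E r "\<bar>\<omega>\<bar>"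
    "x $ 1" "x $ 2" "x $ 3" "x $ 4" "x $ 5" "x $ 6" "x $ 7" "x $ 8"
    "resid \<xi> \<omega> x $ 1" "resid \<xi> \<omega> x $ 2" "resid \<xi> \<omega> x $ 3" "resid \<xi> \<omega> x $ 4"
    "resid \<xi> \<omega> x $ 5" "resid \<xi> \<omega> x $ 6" "resid \<xi> \<omega> x $ 7" "resid \<xi> \<omega> x $ 8"
    unfolding d_def E_def r_def by (rule resolvent_interp[OF \<xi>0 order_refl])
  interpret c: beam_resolvent k1 k2 k3 k4 \<gamma> d big \<xi> \<omega> E r "\<bar>\<omega>\<bar>"
    "x $ 1" "x $ 2" "x $ 3" "x $ 4" "x $ 5" "x $ 6" "x $ 7" "x $ 8"
    "resid \<xi> \<omega> x $ 1" "resid \<xi> \<omega> x $ 2" "resid \<xi> \<omega> x $ 3" "resid \<xi> \<omega> x $ 4"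
    "resid \<xi> \<omega> x $ 5" "resid \<xi> \<omega> x $ 6" "resid \<xi> \<omega> x $ 7" "resid \<xi> \<omega> x $ 8"
    unfolding d_def E_def r_def by (rule resolvent_interp[OF \<xi>0 big(1)])
  have r: "1 \<le> r" using \<xi> by (simp add: r_def)
  have d0: "0 < d" unfolding d_def by (rule damping_pos[OF \<xi>0])
  have e0: "0 \<le> e" and E0: "0 \<le> E" by (simp_all add: e_def E_def)
  have bp: "big ^ n \<le> big ^ 9" if "n \<le> 9" for n using big(2) that by (intro power_increasing)
  define Y where "Y = (1 + d / r) * e + 2 * E"
  define Q where "Q = (r + d) * e + 2 * E"
  have Y0: "0 \<le> Y" using e0 E0 r d0 by (simp add: Y_def)
  have "1 + d / r \<le> r + d" using r d0 by (intro add_mono) (auto simp: divide_le_eq)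
  then have YQ: "Y \<le> Q" using mult_right_mono[OF _ e0] by (simp add: Y_def Q_def)
  have Q0: "0 \<le> Q" using Y0 YQ by simp
  have QrQ: "Q \<le> r * Q" using mult_right_mono[OF r Q0] by simp
  have c9: "c * big ^ n * t \<le> c' * big ^ 9 * t'" if "n \<le> 9" "c \<le> c'" "0 \<le> c" "0 \<le> t" "t \<le> t'" for c c' t t' n
    using that big bp[OF that(1)] by (intro mult_mono) auto
  have QQ: "(r + d) * e + E \<le> Q" "0 \<le> (r + d) * e + E" using E0 e0 r d0 by (simp_all add: Q_def)
  \<comment> \<open>Small and large \<omega> share a bound by \<open>Y\<close> that implies all
    three claims; only the intermediate range tells them apart.\<close>
  consider (edge) "comp_sum x \<le> 48 * big ^ 9 * Y" | (middle) "r \<le> big * \<bar>\<omega>\<bar>" "\<bar>\<omega>\<bar> \<le> big * r"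
  proof -
    consider "48 * bnd ^ 3 * \<bar>\<omega>\<bar> \<le> r" | "16 * bnd * (1 + r) \<le> \<bar>\<omega>\<bar>"
      | "r \<le> big * \<bar>\<omega>\<bar>" "\<bar>\<omega>\<bar> \<le> 16 * bnd * (1 + r)"
      unfolding big_def by linarith
    then show thesis
    proof cases
      case 1
      have "comp_sum x \<le> big * (E / r + (1 + d / r) * e)"
        using b.small_frequency[OF 1] r unfolding comp_sum_def big_def e_def by simp
      also have "\<dots> \<le> big * Y"
      proof (rule mult_left_mono)
        have "E / r \<le> E" using r E0 by (simp add: divide_le_eq mult_le_cancel_left1)
        then show "E / r + (1 + d / r) * e \<le> Y" using E0 by (simp add: Y_def)
      qed (use big in simp)
      also have "\<dots> \<le> 48 * big ^ 9 * Y" using c9[of 1 1 48 Y Y] Y0 by simp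
      finally show thesis by (rule edge)
    next
      case 2
      have "comp_sum x \<le> E" using b.large_frequency[OF 2] by (simp add: comp_sum_def)
      also have "\<dots> \<le> Y" using E0 e0 r d0 by (simp add: Y_def)
      also have "\<dots> \<le> 48 * big ^ 9 * Y" using c9[of 0 1 48 Y Y] Y0 by simp
      finally show thesis by (rule edge)
    next
      case 3
      have "16 * bnd * (1 + r) \<le> 16 * bnd * (2 * r)" using r bnd(1) by (intro mult_left_mono) auto
      also have "\<dots> \<le> big * r" using mult_right_mono[OF big(3), of r] r by simp
      finally have "\<bar>\<omega>\<bar> \<le> big * r" using 3 by linarith
      with 3(1) show thesis by (rule middle)
    qed
  qed
  note cases' = this
  show "comp_sum x \<le> 60 * big ^ 9 * (r * Q)"
  proof (cases rule: cases')
    case edge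
    also have "48 * big ^ 9 * Y \<le> 60 * big ^ 9 * (r * Q)" using c9[of 9 48 60 Y "r * Q"] Y0 YQ QrQ by simp
    finally show ?thesis .
  next
    case middle
    have "comp_sum x \<le> 60 * big ^ 9 * (r * ((r + d) * e + E))"
      using c.high_frequency_middle(6)[OF middle r] unfolding comp_sum_def e_def by simp
    also have "\<dots> \<le> 60 * big ^ 9 * (r * Q)"
      using big r QQ by (intro mult_left_mono) auto
    finally show ?thesis .
  qed
  show "comp_sum x \<le> 60 * big ^ 9 * Q" if "k1 = k3"
  proof (cases rule: cases')
    case edge
    also have "48 * big ^ 9 * Y \<le> 60 * big ^ 9 * Q" using c9[of 9 48 60 Y Q] Y0 YQ by simp
    finally show ?thesis .
  next
    case middle
    have "comp_sum x \<le> 45 * big ^ 8 * ((r + d) * e + E)"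
      using c.high_frequency_equal_13[OF middle r that] unfolding comp_sum_def e_def by simp
    also have "\<dots> \<le> 60 * big ^ 9 * Q" by (rule c9) (use QQ in auto)
    finally show ?thesis .
  qed
  show "comp_sum x \<le> 63 * big ^ 9 * Y" if k: "k1 = k2" "k1 = k3" and eps: "\<epsilon> = 1"
  proof (cases rule: cases')
    case edge
    also have "48 * big ^ 9 * Y \<le> 63 * big ^ 9 * Y" using c9[of 9 48 63 Y Y] Y0 by simp
    finally show ?thesis .
  next
    case middle
    have "1 * (r * r) \<le> (bnd * k5) * (r * r)" using bnd(12) by (intro mult_right_mono) auto
    also have "\<dots> \<le> (big * k5) * (r * r)" using big pos by (intro mult_right_mono) auto
    also have "\<dots> = big * d" unfolding d_def damping_def r_def by (simp add: eps power2_eq_square)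
    finally have "comp_sum x \<le> 63 * big ^ 7 * Y"
      using c.high_frequency_equal[OF middle r k] unfolding comp_sum_def e_def Y_def by simp
    also have "\<dots> \<le> 63 * big ^ 9 * Y" by (rule c9) (use Y0 in auto)
    finally show ?thesis .
  qed
qed

text \<open>The static bound loses \<xi>^-2 on the damped component; absorption squares this and
  divides by the damping, of order \<bar>\<xi>\<bar>^(2 \<epsilon>). The term with the data alone
  loses only \<bar>\<xi>\<bar>^-3 and is dominated, since \<bar>\<xi>\<bar> is at most 1.\<close>

lemma low_frequency_resolvent:
  obtains C where "C > 0" "\<And>\<xi> \<omega> x. \<xi> \<noteq> 0 \<Longrightarrow> \<bar>\<xi>\<bar> \<le> 1 \<Longrightarrow>
    norm x \<le> C / \<bar>\<xi>\<bar> ^ (4 + 2 * \<epsilon>) * norm (resid \<xi> \<omega> x)"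
proof -
  define c where "c = 100 * big ^ 9"
  have c0: "0 < c" using big by (simp add: c_def)
  have b0: "0 < bnd" using bnd(1) by simp
  have main: "norm x \<le> (c\<^sup>2 * bnd / k5 + 2 * c) / \<bar>\<xi>\<bar> ^ (4 + 2 * \<epsilon>) * norm (resid \<xi> \<omega> x)"
    if \<xi>: "\<xi> \<noteq> 0" "\<bar>\<xi>\<bar> \<le> 1" for \<xi> \<omega> x
  proof -
    define r where "r = \<bar>\<xi>\<bar>"
    define e where "e = norm (x $ 8)"
    define E where "E = norm (resid \<xi> \<omega> x)"
    have r: "0 < r" "r \<le> 1" using \<xi> by (simp_all add: r_def)
    have r2: "\<xi>\<^sup>2 = r\<^sup>2" by (simp add: r_def)
    have d: "damping \<xi> = k5 * r ^ (2 * \<epsilon>)" by (simp add: damping_def r_def)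
    have "r\<^sup>2 * comp_sum x \<le> c * (e + E / r)"
      using low_frequency_static[OF \<xi>] unfolding r2 c_def e_def E_def r_def .
    then have "comp_sum x \<le> c / r\<^sup>2 * e + c / r ^ 3 * E"
      using r by (simp add: field_simps power2_eq_square power3_eq_cube)
    moreover have "damping \<xi> * e\<^sup>2 \<le> bnd * (comp_sum x * E)"
      unfolding e_def E_def by (rule resolvent_dissipation)
    ultimately have "comp_sum x \<le> ((c / r\<^sup>2)\<^sup>2 * bnd / damping \<xi> + 2 * (c / r ^ 3)) * E"
      using damping_pos[OF \<xi>(1)] comp_sum_nonneg b0
      by (intro dissipative_absorption) (auto simp: E_def)
    also have "\<dots> \<le> ((c\<^sup>2 * bnd / k5 + 2 * c) / r ^ (4 + 2 * \<epsilon>)) * E"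
    proof (rule mult_right_mono)
      have "(c / r\<^sup>2)\<^sup>2 * bnd / damping \<xi> = c\<^sup>2 * bnd / k5 / r ^ (4 + 2 * \<epsilon>)"
        unfolding d by (simp add: power_divide power_add flip: power_mult)
      moreover have "2 * (c / r ^ 3) \<le> 2 * c / r ^ (4 + 2 * \<epsilon>)"
      proof -
        have "r ^ (4 + 2 * \<epsilon>) \<le> r ^ 3" using r by (intro power_decreasing) auto
        then show ?thesis using r c0 by (simp add: frac_le)
      qed
      ultimately show "(c / r\<^sup>2)\<^sup>2 * bnd / damping \<xi> + 2 * (c / r ^ 3) \<le> (c\<^sup>2 * bnd / k5 + 2 * c) / r ^ (4 + 2 * \<epsilon>)"
        by (simp add: add_divide_distrib)
    qed (simp add: E_def)
    finally show ?thesis using norm_le_comp_sum[of x] by (simp add: E_def r_def)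
  qed
  have "0 < c\<^sup>2 * bnd / k5 + 2 * c" using c0 b0 pos by (simp add: add_pos_pos)
  then show thesis using main by (rule that)
qed

text \<open>Both kinds of damping end with the same order: for a constant damping the numerator is
  of order \<xi>^2, and for second-order damping the quotient is of order \<xi>^4 / \<xi>^2.\<close>

lemma damping_ratio:
  assumes "1 \<le> \<bar>\<xi>\<bar>"
  shows "(\<bar>\<xi>\<bar> + damping \<xi>)\<^sup>2 / damping \<xi> \<le> (1 + k5)\<^sup>2 / k5 * \<xi>\<^sup>2"
proof -
  define r where "r = \<bar>\<xi>\<bar>"
  have r: "1 \<le> r" using assms by (simp add: r_def)
  have r2: "\<xi>\<^sup>2 = r\<^sup>2" by (simp add: r_def)
  have "\<epsilon> = 0 \<or> \<epsilon> = 1" using \<epsilon> by simp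
  then have "(r + k5 * r ^ (2 * \<epsilon>))\<^sup>2 / (k5 * r ^ (2 * \<epsilon>)) \<le> (1 + k5)\<^sup>2 / k5 * r\<^sup>2"
  proof
    assume e: "\<epsilon> = 0"
    have "r + k5 \<le> (1 + k5) * r" using r pos by (simp add: distrib_right)
    then have "(r + k5)\<^sup>2 \<le> ((1 + k5) * r)\<^sup>2" using r pos by (intro power_mono) auto
    then have "(r + k5)\<^sup>2 / k5 \<le> ((1 + k5) * r)\<^sup>2 / k5" using pos by (intro divide_right_mono) auto
    then show ?thesis by (simp add: e power_mult_distrib)
  next
    assume e: "\<epsilon> = 1"
    have "r + k5 * r\<^sup>2 \<le> (1 + k5) * r\<^sup>2" using r by (simp add: distrib_right power2_eq_square)
    then have "(r + k5 * r\<^sup>2)\<^sup>2 \<le> ((1 + k5) * r\<^sup>2)\<^sup>2" using r pos by (intro power_mono) auto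
    then have "(r + k5 * r\<^sup>2)\<^sup>2 / (k5 * r\<^sup>2) \<le> ((1 + k5) * r\<^sup>2)\<^sup>2 / (k5 * r\<^sup>2)"
      using pos r by (intro divide_right_mono) auto
    also have "\<dots> = (1 + k5)\<^sup>2 / k5 * r\<^sup>2"
      using pos r by (simp add: power_mult_distrib power2_eq_square)
    finally show ?thesis by (simp add: e)
  qed
  then show ?thesis by (simp add: damping_def r2 r_def[symmetric])
qed

definition damping_const :: real where "damping_const = (1 + k5)\<^sup>2 / k5"

text \<open>\<open>s\<close> records the power of \<xi> lost or gained in the static bound; it will
  be \<bar>\<xi>\<bar>, 1 or 1 / \<bar>\<xi>\<bar>.\<close>

lemma high_frequency_absorption:
  assumes \<xi>: "1 \<le> \<bar>\<xi>\<bar>" and c: "0 \<le> c" and s: "0 \<le> s"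
    and le: "comp_sum x \<le> c * (s * ((\<bar>\<xi>\<bar> + damping \<xi>) * norm (x $ 8)) + b * norm (resid \<xi> \<omega> x))"
  shows "comp_sum x \<le> (c\<^sup>2 * bnd * damping_const * (s\<^sup>2 * \<xi>\<^sup>2) + 2 * (c * b)) * norm (resid \<xi> \<omega> x)"
proof -
  let ?E = "norm (resid \<xi> \<omega> x)" and ?d = "damping \<xi>" and ?r = "\<bar>\<xi>\<bar>"
  have d: "0 < ?d" using \<xi> by (intro damping_pos) auto
  have "comp_sum x \<le> ((c * s * (?r + ?d))\<^sup>2 * bnd / ?d + 2 * (c * b)) * ?E"
    using d comp_sum_nonneg bnd(1) le resolvent_dissipation
    by (intro dissipative_absorption) (auto simp: algebra_simps)
  also have "(c * s * (?r + ?d))\<^sup>2 * bnd / ?d = c\<^sup>2 * bnd * s\<^sup>2 * ((?r + ?d)\<^sup>2 / ?d)"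
    by (simp add: power_mult_distrib)
  also have "\<dots> \<le> c\<^sup>2 * bnd * s\<^sup>2 * (damping_const * \<xi>\<^sup>2)"
    unfolding damping_const_def using damping_ratio[OF \<xi>] bnd(1) by (intro mult_left_mono) auto
  finally show ?thesis by (simp add: mult_ac mult_right_mono)
qed

text \<open>The exponent \<open>h\<close> is the order of s^2 \<xi>^2 for the factor
  \<open>s\<close> that \<open>high_frequency_static\<close> allows in each case.\<close>

lemma high_frequency_resolvent:
  assumes h: "h = 4 \<or> h = 2 \<and> k1 = k3 \<or> h = 0 \<and> k1 = k2 \<and> k1 = k3 \<and> \<epsilon> = 1"
  obtains C where "C > 0" "\<And>\<xi> \<omega> x. 1 \<le> \<bar>\<xi>\<bar> \<Longrightarrow> norm x \<le> C * \<bar>\<xi>\<bar> ^ h * norm (resid \<xi> \<omega> x)"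
proof -
  define c where "c = 63 * big ^ 9"
  define C where "C = c\<^sup>2 * bnd * damping_const + 4 * c"
  have c0: "0 < c" using big by (simp add: c_def)
  have c1: "60 * big ^ 9 \<le> c" using big by (simp add: c_def)
  have r0: "0 < damping_const" using pos by (simp add: damping_const_def)
  have Cp: "0 < C" using c0 bnd(1) r0 by (simp add: C_def add_nonneg_pos)
  have "norm x \<le> C * \<bar>\<xi>\<bar> ^ h * norm (resid \<xi> \<omega> x)" if \<xi>: "1 \<le> \<bar>\<xi>\<bar>" for \<xi> \<omega> x
  proof -
    let ?E = "norm (resid \<xi> \<omega> x)" and ?d = "damping \<xi>" and ?r = "\<bar>\<xi>\<bar>" and ?e = "norm (x $ 8)"
    note st = high_frequency_static[OF \<xi>, of x \<omega>]
    have d: "0 \<le> ?d" by (rule damping_nonneg)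
    have c_le: "60 * big ^ 9 * t \<le> c * t" if "0 \<le> t" for t using c1 that by (rule mult_right_mono)
    have Q: "0 \<le> (?r + ?d) * ?e + 2 * ?E" using d by simp
    have "\<exists>s b. comp_sum x \<le> c * (s * ((?r + ?d) * ?e) + b * ?E) \<and> 0 \<le> s \<and> s\<^sup>2 * \<xi>\<^sup>2 \<le> ?r ^ h \<and> b \<le> 2 * ?r ^ h"
      using h
    proof (elim disjE conjE)
      assume h4: "h = 4"
      have "comp_sum x \<le> c * (?r * ((?r + ?d) * ?e + 2 * ?E))"
        using st(1) c_le[of "?r * ((?r + ?d) * ?e + 2 * ?E)"] Q by simp
      moreover have "?r ^ 1 \<le> ?r ^ 4" using \<xi> by (intro power_increasing) auto
      moreover have "?r\<^sup>2 * \<xi>\<^sup>2 = ?r ^ 4" by (simp flip: power_add)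
      ultimately show ?thesis
        using h4 by (intro exI[of _ ?r] exI[of _ "2 * ?r"]) (simp add: distrib_left mult_ac)
    next
      assume h2: "h = 2" and k: "k1 = k3"
      have "comp_sum x \<le> c * ((?r + ?d) * ?e + 2 * ?E)" using st(2)[OF k] c_le[OF Q] by simp
      moreover have "1 \<le> ?r\<^sup>2" using \<xi> by (intro one_le_power) auto
      ultimately show ?thesis
        using h2 by (intro exI[of _ 1] exI[of _ 2]) simp
    next
      assume h0: "h = 0" and k: "k1 = k2" "k1 = k3" "\<epsilon> = 1"
      have "comp_sum x \<le> c * ((1 + ?d / ?r) * ?e + 2 * ?E)" using st(3)[OF k] by (simp add: c_def)
      moreover have "1 + ?d / ?r = 1 / ?r * (?r + ?d)" using \<xi> by (simp add: field_simps)
      moreover have "(1 / ?r)\<^sup>2 * \<xi>\<^sup>2 = 1" using \<xi> by (simp add: power_divide)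
      ultimately show ?thesis
        using h0 by (intro exI[of _ "1 / ?r"] exI[of _ 2]) (simp add: mult.assoc)
    qed
    then obtain s b where sb: "comp_sum x \<le> c * (s * ((?r + ?d) * ?e) + b * ?E)" "0 \<le> s" "s\<^sup>2 * \<xi>\<^sup>2 \<le> ?r ^ h" "b \<le> 2 * ?r ^ h"
      by blast
    have "comp_sum x \<le> (c\<^sup>2 * bnd * damping_const * (s\<^sup>2 * \<xi>\<^sup>2) + 2 * (c * b)) * ?E"
      by (rule high_frequency_absorption[OF \<xi> less_imp_le[OF c0] sb(2) sb(1)])
    also have "\<dots> \<le> (c\<^sup>2 * bnd * damping_const * ?r ^ h + 2 * (c * (2 * ?r ^ h))) * ?E"
      using sb c0 bnd(1) r0 by (intro mult_right_mono add_mono mult_left_mono) auto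
    also have "\<dots> = C * ?r ^ h * ?E" by (simp add: C_def algebra_simps)
    finally show ?thesis using norm_le_comp_sum[of x] by simp
  qed
  with Cp show thesis by (rule that)
qed

section \<open>Pointwise decay of the propagator\<close>

lemma decay_of_resolvent:
  assumes M: "0 < M" and res: "\<And>\<omega> x. norm x \<le> M * norm (resid \<xi> \<omega> x)" and t: "0 \<le> t"
  shows "(norm (mat_exp (t *\<^sub>R A \<xi>) *v v))\<^sup>2 \<le> 3 * bnd\<^sup>2 * exp (- (t / (32 * bnd * M))) * (norm v)\<^sup>2"
proof -
  have b0: "0 < bnd" using bnd(1) by simp
  \<comment> \<open>The weights lie between 1 / bnd and bnd, so their ratio is at most bnd^2; its
    root is the factor bnd in the exponent.\<close>
  have k: "1 / bnd \<le> \<kappa> i" "\<kappa> i \<le> bnd" for i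
    using exhaust_8[of i] bnd b0 by (auto simp: beam_weight_simps field_simps)
  have "(norm (mat_exp (t *\<^sub>R A \<xi>) *v v))\<^sup>2
    \<le> 3 * (bnd / (1 / bnd)) * exp (- (t / (32 * sqrt (bnd / (1 / bnd)) * M))) * (norm (mat_exp (0 *\<^sub>R A \<xi>) *v v))\<^sup>2"
  proof (rule resolvent_bound_imp_decay[where A = "A \<xi>" and \<kappa> = \<kappa>])
    show "(\<Sum>i\<in>UNIV. \<kappa> i * (x $ i \<bullet> (A \<xi> *v x) $ i)) \<le> 0" for x
      unfolding inner_A using damping_nonneg by simp
  qed (use k b0 M t res in \<open>auto intro: mat_exp_ode\<close>)
  moreover have "bnd / (1 / bnd) = bnd\<^sup>2" using b0 by (simp add: power2_eq_square)
  ultimately show ?thesis using b0 unfolding mat_exp_0_vec by simp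
qed

lemma low_frequency_decay:
  obtains C c where "C > 0" "c > 0" "\<And>t \<xi> v. 0 \<le> t \<Longrightarrow> \<xi> \<noteq> 0 \<Longrightarrow> \<bar>\<xi>\<bar> \<le> 1 \<Longrightarrow>
    (norm (mat_exp (t *\<^sub>R A \<xi>) *v v))\<^sup>2 \<le> C * exp (- (c * t * \<bar>\<xi>\<bar> ^ (4 + 2 * \<epsilon>))) * (norm v)\<^sup>2"
proof -
  obtain K where K: "K > 0" "\<And>\<xi> \<omega> x. \<xi> \<noteq> 0 \<Longrightarrow> \<bar>\<xi>\<bar> \<le> 1 \<Longrightarrow>
    norm x \<le> K / \<bar>\<xi>\<bar> ^ (4 + 2 * \<epsilon>) * norm (resid \<xi> \<omega> x)"
    using low_frequency_resolvent by blast
  have b0: "0 < bnd" using bnd(1) by simp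
  show thesis
  proof (rule that)
    show "0 < 3 * bnd\<^sup>2" "0 < 1 / (32 * bnd * K)" using K b0 by simp_all
    fix t \<xi> :: real and v assume a: "0 \<le> t" "\<xi> \<noteq> 0" "\<bar>\<xi>\<bar> \<le> 1"
    have "(norm (mat_exp (t *\<^sub>R A \<xi>) *v v))\<^sup>2
      \<le> 3 * bnd\<^sup>2 * exp (- (t / (32 * bnd * (K / \<bar>\<xi>\<bar> ^ (4 + 2 * \<epsilon>))))) * (norm v)\<^sup>2"
      using a K by (intro decay_of_resolvent) auto
    then show "(norm (mat_exp (t *\<^sub>R A \<xi>) *v v))\<^sup>2
      \<le> 3 * bnd\<^sup>2 * exp (- (1 / (32 * bnd * K) * t * \<bar>\<xi>\<bar> ^ (4 + 2 * \<epsilon>))) * (norm v)\<^sup>2"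
      by simp
  qed
qed

lemma high_frequency_decay:
  assumes h: "h = 4 \<or> h = 2 \<and> k1 = k3 \<or> h = 0 \<and> k1 = k2 \<and> k1 = k3 \<and> \<epsilon> = 1"
  obtains C c where "C > 0" "c > 0" "\<And>t \<xi> v. 0 \<le> t \<Longrightarrow> 1 \<le> \<bar>\<xi>\<bar> \<Longrightarrow>
    (norm (mat_exp (t *\<^sub>R A \<xi>) *v v))\<^sup>2 \<le> C * exp (- (c * t / \<bar>\<xi>\<bar> ^ h)) * (norm v)\<^sup>2"
proof -
  obtain K where K: "K > 0" "\<And>\<xi> \<omega> x. 1 \<le> \<bar>\<xi>\<bar> \<Longrightarrow> norm x \<le> K * \<bar>\<xi>\<bar> ^ h * norm (resid \<xi> \<omega> x)"
    using high_frequency_resolvent[OF h] by blast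
  have b0: "0 < bnd" using bnd(1) by simp
  show thesis
  proof (rule that)
    show "0 < 3 * bnd\<^sup>2" "0 < 1 / (32 * bnd * K)" using K b0 by simp_all
    fix t \<xi> :: real and v assume a: "0 \<le> t" "1 \<le> \<bar>\<xi>\<bar>"
    have "(norm (mat_exp (t *\<^sub>R A \<xi>) *v v))\<^sup>2
      \<le> 3 * bnd\<^sup>2 * exp (- (t / (32 * bnd * (K * \<bar>\<xi>\<bar> ^ h)))) * (norm v)\<^sup>2"
      using a K by (intro decay_of_resolvent) (auto simp: zero_less_mult_iff)
    then show "(norm (mat_exp (t *\<^sub>R A \<xi>) *v v))\<^sup>2
      \<le> 3 * bnd\<^sup>2 * exp (- (1 / (32 * bnd * K) * t / \<bar>\<xi>\<bar> ^ h)) * (norm v)\<^sup>2"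
      by (simp add: mult.assoc)
  qed
qed

text \<open>The constant is chosen before the datum, the solution and the time. The order
  \<open>k\<close> varies because membership of the solution in \<open>sobolev_H j\<close> requires
  weak derivatives of all orders up to \<open>j\<close>, while the norm is estimated at the order
  \<open>j\<close> alone.\<close>

lemma propagated_estimate:
  fixes \<rho> :: "real \<Rightarrow> real" and l :: nat
  assumes low: "0 < C" "0 < c" "\<And>t \<xi> v. 0 \<le> t \<Longrightarrow> \<xi> \<noteq> 0 \<Longrightarrow> \<bar>\<xi>\<bar> \<le> 1 \<Longrightarrow>
      (norm (mat_exp (t *\<^sub>R A \<xi>) *v v))\<^sup>2 \<le> C * exp (- (c * t * \<bar>\<xi>\<bar> ^ a)) * (norm v)\<^sup>2" and a: "0 < a"
    and high: "0 < D" "\<And>t \<xi> v. 0 \<le> t \<Longrightarrow> 1 \<le> \<bar>\<xi>\<bar> \<Longrightarrow>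
      (norm (mat_exp (t *\<^sub>R A \<xi>) *v v))\<^sup>2 \<le> D * (\<rho> t)\<^sup>2 * \<bar>\<xi>\<bar> ^ (2 * l) * (norm v)\<^sup>2"
    and \<rho>: "\<And>t. 0 \<le> \<rho> t"
  obtains K where "0 < K" "\<And>N k U0 U t. k + l \<le> N \<Longrightarrow> U0 \<in> sobolev_H N \<Longrightarrow> integrable lborel U0 \<Longrightarrow>
    beam_solution k1 k2 k3 k4 k5 \<gamma> 0 1 0 \<epsilon> U0 U \<Longrightarrow> 0 \<le> t \<Longrightarrow>
    (\<exists>g. has_weak_deriv k (\<lambda>x. U x t) g \<and> square_integrable g) \<and>
    (k = j \<longrightarrow> L2_norm (weak_deriv j (\<lambda>x. U x t))
      \<le> K * (1 + t) powr (- (2 * real j + 1) / (2 * real a)) * L1_norm U0 + K * \<rho> t * L2_norm (weak_deriv (j + l) U0))"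
proof -
  \<comment> \<open>The constant of the frequency integral depends on the order \<open>k\<close>,
    over which the conclusion still quantifies, so one is fixed for every \<open>k\<close>.\<close>
  obtain J where J: "\<And>k. J k > 0" "\<And>k t. t \<ge> 0 \<Longrightarrow>
    (\<integral>\<^sup>+\<xi>. ennreal (\<bar>\<xi>\<bar> ^ (2 * k) * exp (- (c * t * \<bar>\<xi>\<bar> ^ a))) * indicator {-1..1} \<xi> \<partial>lborel)
      \<le> ennreal (J k * (1 + t) powr (- (real (2 * k) + 1) / real a))"
  proof -
    have "\<exists>K>0. \<forall>t\<ge>0. (\<integral>\<^sup>+\<xi>. ennreal (\<bar>\<xi>\<bar> ^ (2 * k) * exp (- (c * t * \<bar>\<xi>\<bar> ^ a))) * indicator {-1..1} \<xi> \<partial>lborel)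
      \<le> ennreal (K * (1 + t) powr (- (real (2 * k) + 1) / real a))" for k
    proof -
      obtain K where "K > 0" "\<And>t. t \<ge> 0 \<Longrightarrow>
        (\<integral>\<^sup>+\<xi>. ennreal (\<bar>\<xi>\<bar> ^ (2 * k) * exp (- (c * t * \<bar>\<xi>\<bar> ^ a))) * indicator {-1..1} \<xi> \<partial>lborel)
          \<le> ennreal (K * (1 + t) powr (- (real (2 * k) + 1) / real a))"
        by (rule low_frequency_integral[OF low(2) a, of "2 * k"]) blast
      then show ?thesis by blast
    qed
    then have "\<exists>J. \<forall>k. 0 < J k \<and> (\<forall>t\<ge>0. (\<integral>\<^sup>+\<xi>. ennreal (\<bar>\<xi>\<bar> ^ (2 * k) * exp (- (c * t * \<bar>\<xi>\<bar> ^ a))) * indicator {-1..1} \<xi> \<partial>lborel)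
      \<le> ennreal (J k * (1 + t) powr (- (real (2 * k) + 1) / real a)))"
      by (intro choice allI)
    then obtain J where "\<forall>k. 0 < J k \<and> (\<forall>t\<ge>0. (\<integral>\<^sup>+\<xi>. ennreal (\<bar>\<xi>\<bar> ^ (2 * k) * exp (- (c * t * \<bar>\<xi>\<bar> ^ a))) * indicator {-1..1} \<xi> \<partial>lborel)
      \<le> ennreal (J k * (1 + t) powr (- (real (2 * k) + 1) / real a)))" ..
    then show thesis by (intro that[of J]) auto
  qed
  define F where "F = 2 * pi / flat 1 ^ 4"
  have F0: "0 < F" using flat_pos[of 1] by (simp add: F_def)
  have main: "\<exists>g. has_weak_deriv k (\<lambda>x. U x t) g \<and> square_integrable g \<and>
      (L2_norm g)\<^sup>2 \<le> (1 / (2 * pi)) * (C * (L1_norm U0)\<^sup>2 * (J k * (1 + t) powr (- (real (2 * k) + 1) / real a))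
        + D * (\<rho> t)\<^sup>2 * (F * (L2_norm (weak_deriv (k + l) U0))\<^sup>2))"
    if kN: "k + l \<le> N" and U0: "U0 \<in> sobolev_H N" "integrable lborel U0"
      and U: "beam_solution k1 k2 k3 k4 k5 \<gamma> 0 1 0 \<epsilon> U0 U" and t: "0 \<le> t" for N k U0 U t
  proof -
    let ?g = "\<lambda>\<xi>. mat_exp (t *\<^sub>R A \<xi>) *v fourier U0 \<xi>"
    have fg: "has_fourier_L2 (\<lambda>x. U x t) ?g" using U t by (simp add: beam_solution_def)
    have [measurable]: "?g \<in> borel_measurable borel"
      using fg by (auto simp: has_fourier_L2_def square_integrable_def)
    have [measurable]: "fourier U0 \<in> borel_measurable borel"
    proof -
      have [measurable]: "U0 \<in> borel_measurable borel" using U0 by auto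
      have "fourier U0 = (\<lambda>\<xi>. \<chi> i. ft (\<lambda>x. U0 x $ i) \<xi>)"
        by (simp add: fun_eq_iff vec_eq_iff fourier_nth[OF U0(2)])
      also have "\<dots> \<in> borel_measurable borel" by (rule borel_measurable_vec_lambda) measurable
      finally show ?thesis .
    qed
    let ?R = "C * (L1_norm U0)\<^sup>2 * (J k * (1 + t) powr (- (real (2 * k) + 1) / real a))"
    let ?S = "D * (\<rho> t)\<^sup>2 * (F * (L2_norm (weak_deriv (k + l) U0))\<^sup>2)"
    let ?p = "\<lambda>\<xi>. ennreal (C * (L1_norm U0)\<^sup>2) * (ennreal (\<bar>\<xi>\<bar> ^ (2 * k) * exp (- (c * t * \<bar>\<xi>\<bar> ^ a))) * indicator {-1..1} \<xi>)"
    let ?q = "\<lambda>\<xi>. ennreal (D * (\<rho> t)\<^sup>2) * ennreal ((\<bar>\<xi>\<bar> ^ (k + l) * norm (fourier U0 \<xi>))\<^sup>2)"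
    \<comment> \<open>The low-frequency bound excludes \<xi> = 0, where the resolvent bound
      degenerates; this point is a null set.\<close>
    have "AE \<xi> in lborel. \<xi> \<noteq> (0::real)" by (rule AE_lborel_singleton)
    then have pw: "AE \<xi> in lborel. ennreal ((\<bar>\<xi>\<bar> ^ k * norm (?g \<xi>))\<^sup>2) \<le> ?p \<xi> + ?q \<xi>"
    proof eventually_elim
      case (elim \<xi>)
      show ?case
      proof (cases "\<bar>\<xi>\<bar> \<le> 1")
        case True
        have "(\<bar>\<xi>\<bar> ^ k * norm (?g \<xi>))\<^sup>2 = \<bar>\<xi>\<bar> ^ (2 * k) * (norm (?g \<xi>))\<^sup>2"
          by (simp add: power_mult_distrib power_mult mult.commute[of 2])
        also have "\<dots> \<le> \<bar>\<xi>\<bar> ^ (2 * k) * (C * exp (- (c * t * \<bar>\<xi>\<bar> ^ a)) * (norm (fourier U0 \<xi>))\<^sup>2)"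
          by (intro mult_left_mono low(3) t elim True) auto
        also have "\<dots> \<le> \<bar>\<xi>\<bar> ^ (2 * k) * (C * exp (- (c * t * \<bar>\<xi>\<bar> ^ a)) * (L1_norm U0)\<^sup>2)"
          using low(1) by (intro mult_left_mono power_mono norm_fourier_le) auto
        finally have "(\<bar>\<xi>\<bar> ^ k * norm (?g \<xi>))\<^sup>2 \<le> (C * (L1_norm U0)\<^sup>2) * (\<bar>\<xi>\<bar> ^ (2 * k) * exp (- (c * t * \<bar>\<xi>\<bar> ^ a)))"
          by (simp add: mult_ac)
        then have "ennreal ((\<bar>\<xi>\<bar> ^ k * norm (?g \<xi>))\<^sup>2) \<le> ?p \<xi>"
          using True low(1) by (auto intro: ennreal_leI simp: ennreal_mult[symmetric] indicator_def abs_le_iff)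
        then show ?thesis by (rule order_trans) simp
      next
        case False
        then have x1: "1 \<le> \<bar>\<xi>\<bar>" by simp
        have "(\<bar>\<xi>\<bar> ^ k * norm (?g \<xi>))\<^sup>2 = \<bar>\<xi>\<bar> ^ (2 * k) * (norm (?g \<xi>))\<^sup>2"
          by (simp add: power_mult_distrib power_mult mult.commute[of 2])
        also have "\<dots> \<le> \<bar>\<xi>\<bar> ^ (2 * k) * (D * (\<rho> t)\<^sup>2 * \<bar>\<xi>\<bar> ^ (2 * l) * (norm (fourier U0 \<xi>))\<^sup>2)"
          by (intro mult_left_mono high(2) t x1) auto
        also have "\<dots> = D * (\<rho> t)\<^sup>2 * (\<bar>\<xi>\<bar> ^ (k + l) * norm (fourier U0 \<xi>))\<^sup>2"
        proof -
          have e: "\<bar>\<xi>\<bar> ^ (2 * k) * \<bar>\<xi>\<bar> ^ (2 * l) = (\<bar>\<xi>\<bar> ^ (k + l))\<^sup>2"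
            by (simp add: power_mult[symmetric] power_add[symmetric] algebra_simps del: power_even_abs)
          show ?thesis unfolding power_mult_distrib e[symmetric] by (simp only: mult_ac)
        qed
        finally have "ennreal ((\<bar>\<xi>\<bar> ^ k * norm (?g \<xi>))\<^sup>2) \<le> ?q \<xi>"
          using high(1) by (subst ennreal_mult[symmetric]) (auto intro: ennreal_leI)
        then show ?thesis by (rule order_trans) simp
      qed
    qed
    have "(\<integral>\<^sup>+\<xi>. ennreal ((\<bar>\<xi>\<bar> ^ k * norm (?g \<xi>))\<^sup>2) \<partial>lborel) \<le> (\<integral>\<^sup>+\<xi>. ?p \<xi> + ?q \<xi> \<partial>lborel)"
      by (rule nn_integral_mono_AE[OF pw])
    also have "\<dots> = (\<integral>\<^sup>+\<xi>. ?p \<xi> \<partial>lborel) + (\<integral>\<^sup>+\<xi>. ?q \<xi> \<partial>lborel)"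
      by (rule nn_integral_add) measurable
    also have "\<dots> = ennreal (C * (L1_norm U0)\<^sup>2) * (\<integral>\<^sup>+\<xi>. ennreal (\<bar>\<xi>\<bar> ^ (2 * k) * exp (- (c * t * \<bar>\<xi>\<bar> ^ a))) * indicator {-1..1} \<xi> \<partial>lborel)
      + ennreal (D * (\<rho> t)\<^sup>2) * (\<integral>\<^sup>+\<xi>. ennreal ((\<bar>\<xi>\<bar> ^ (k + l) * norm (fourier U0 \<xi>))\<^sup>2) \<partial>lborel)"
      by (intro arg_cong2[where f = "(+)"] nn_integral_cmult) measurable
    also have "\<dots> \<le> ennreal (C * (L1_norm U0)\<^sup>2) * ennreal (J k * (1 + t) powr (- (real (2 * k) + 1) / real a))
      + ennreal (D * (\<rho> t)\<^sup>2) * ennreal (F * (L2_norm (weak_deriv (k + l) U0))\<^sup>2)"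
      unfolding F_def by (intro add_mono mult_left_mono J(2) t fourier_weak_deriv_le[OF U0 kN]) auto
    also have "\<dots> = ennreal (?R + ?S)"
      using low(1) high(1) J(1)[of k] F0 by (simp add: ennreal_mult[symmetric] ennreal_plus[symmetric] less_imp_le del: ennreal_plus)
    finally have le: "(\<integral>\<^sup>+\<xi>. ennreal ((\<bar>\<xi>\<bar> ^ k * norm (?g \<xi>))\<^sup>2) \<partial>lborel) \<le> ennreal (?R + ?S)" .
    obtain h where h: "has_weak_deriv k (\<lambda>x. U x t) h" "square_integrable h"
      "(\<integral>\<^sup>+x. ennreal ((norm (h x))\<^sup>2) \<partial>lborel)
        \<le> ennreal (1 / (2 * pi)) * (\<integral>\<^sup>+\<xi>. ennreal ((\<bar>\<xi>\<bar> ^ k * norm (?g \<xi>))\<^sup>2) \<partial>lborel)"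
      by (rule fourier_L2_weak_deriv[OF fg, of k]) (use order.strict_trans1[OF le] in auto)
    have RS: "0 \<le> ?R + ?S" using low(1) high(1) J(1)[of k] F0 by (simp add: less_imp_le)
    have "ennreal ((L2_norm h)\<^sup>2) \<le> ennreal (1 / (2 * pi)) * ennreal (?R + ?S)"
      using h(3) unfolding L2_norm_sq[OF h(2)] by (rule order_trans) (intro mult_left_mono le, simp)
    also have "\<dots> = ennreal (1 / (2 * pi) * (?R + ?S))"
      using RS by (intro ennreal_mult[symmetric]) auto
    finally have "(L2_norm h)\<^sup>2 \<le> 1 / (2 * pi) * (?R + ?S)"
      using RS by (subst (asm) ennreal_le_iff) auto
    with h show ?thesis by blast
  qed
  \<comment> \<open>The roots of the two factors, as sqrt (p + q) <= sqrt p + sqrt q; the summand 1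
    makes positivity immediate.\<close>
  define K where "K = sqrt (1 / (2 * pi) * (C * J j)) + sqrt (1 / (2 * pi) * (D * F)) + 1"
  have K0: "0 < K" using low(1) high(1) J(1)[of j] F0 by (simp add: K_def add_nonneg_pos less_imp_le)
  show thesis
  proof (rule that[OF K0], intro conjI impI)
    fix N k U0 U t
    assume *: "k + l \<le> N" "U0 \<in> sobolev_H N" "integrable lborel U0"
      "beam_solution k1 k2 k3 k4 k5 \<gamma> 0 1 0 \<epsilon> U0 U" "0 \<le> (t::real)"
    obtain g where g: "has_weak_deriv k (\<lambda>x. U x t) g" "square_integrable g"
      "(L2_norm g)\<^sup>2 \<le> (1 / (2 * pi)) * (C * (L1_norm U0)\<^sup>2 * (J k * (1 + t) powr (- (real (2 * k) + 1) / real a))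
        + D * (\<rho> t)\<^sup>2 * (F * (L2_norm (weak_deriv (k + l) U0))\<^sup>2))"
      using main[OF *] by blast
    show "\<exists>g. has_weak_deriv k (\<lambda>x. U x t) g \<and> square_integrable g" using g by blast
    assume k: "k = j"
    define P where "P = (1 + t) powr (- (2 * real j + 1) / (2 * real a))"
    define n1 where "n1 = L1_norm U0"
    define n2 where "n2 = L2_norm (weak_deriv (j + l) U0)"
    have nn: "0 \<le> n1" "0 \<le> n2" "0 \<le> P" by (simp_all add: n1_def n2_def P_def L1_norm_def L2_norm_nonneg)
    \<comment> \<open>The frequency integral bounds the squared norm, so taking the root halves the
      exponent.\<close>
    have P2: "(1 + t) powr (- (real (2 * j) + 1) / real a) = P\<^sup>2"
      unfolding P_def power2_eq_square powr_add[symmetric] by (simp add: field_simps)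
    have "L2_norm g = sqrt ((L2_norm g)\<^sup>2)" by (simp add: L2_norm_nonneg)
    also have "\<dots> \<le> sqrt ((1 / (2 * pi)) * (C * J j) * (P * n1)\<^sup>2 + (1 / (2 * pi)) * (D * F) * (\<rho> t * n2)\<^sup>2)"
      using g(3) unfolding k P2 n1_def[symmetric] n2_def[symmetric]
      by (intro real_sqrt_le_mono) (simp add: algebra_simps power_mult_distrib)
    also have "\<dots> \<le> sqrt ((1 / (2 * pi)) * (C * J j) * (P * n1)\<^sup>2) + sqrt ((1 / (2 * pi)) * (D * F) * (\<rho> t * n2)\<^sup>2)"
      using low(1) high(1) J(1)[of j] F0 by (intro sqrt_add_le_add_sqrt mult_nonneg_nonneg) (auto simp: less_imp_le)
    also have "\<dots> = sqrt (1 / (2 * pi) * (C * J j)) * (P * n1) + sqrt (1 / (2 * pi) * (D * F)) * (\<rho> t * n2)"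
      using nn \<rho>[of t] by (simp only: real_sqrt_mult real_sqrt_abs) simp
    also have "\<dots> \<le> K * (P * n1) + K * (\<rho> t * n2)"
      using nn \<rho>[of t] low(1) high(1) J(1)[of j] F0
      by (intro add_mono mult_right_mono mult_nonneg_nonneg) (auto simp: K_def less_imp_le)
    finally show "L2_norm (weak_deriv j (\<lambda>x. U x t))
      \<le> K * (1 + t) powr (- (2 * real j + 1) / (2 * real a)) * L1_norm U0 + K * \<rho> t * L2_norm (weak_deriv (j + l) U0)"
      using L2_norm_weak_deriv[OF g(1)] unfolding k P_def n1_def n2_def by (simp add: mult.assoc)
  qed
qed

definition high_rate :: "nat \<Rightarrow> real \<Rightarrow> real \<Rightarrow> real" where
  "high_rate l c t = (if k1 = k2 \<and> k2 = k3 then if \<epsilon> = 1 then exp (- c * t) else (1 + t) powr (- real l / 2)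
     else (1 + t) powr (- real l / 4))"

lemma high_frequency_rate:
  obtains c D where "0 < c" "0 < D" "\<And>t \<xi> v. 0 \<le> t \<Longrightarrow> 1 \<le> \<bar>\<xi>\<bar> \<Longrightarrow>
    (norm (mat_exp (t *\<^sub>R A \<xi>) *v v))\<^sup>2 \<le> D * (high_rate l c t)\<^sup>2 * \<bar>\<xi>\<bar> ^ (2 * l) * (norm v)\<^sup>2"
proof -
  have combine: "n \<le> C * K * R * X * V"
    if "n \<le> C * e * V" "e \<le> K * R * X" "0 < C" "0 \<le> V" for n C e V K R X :: real
  proof -
    have "C * e * V \<le> C * (K * R * X) * V" using that by (intro mult_right_mono mult_left_mono) auto
    with that(1) show ?thesis by (simp add: mult.assoc)
  qed
  consider (exp) "k1 = k2 \<and> k2 = k3" "\<epsilon> = 1" | (two) "k1 = k2 \<and> k2 = k3" "\<epsilon> \<noteq> 1" | (four) "\<not> (k1 = k2 \<and> k2 = k3)"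
    by blast
  then show thesis
  proof cases
    case exp
    obtain C c where C: "C > 0" "c > 0" "\<And>t \<xi> v. 0 \<le> t \<Longrightarrow> 1 \<le> \<bar>\<xi>\<bar> \<Longrightarrow>
      (norm (mat_exp (t *\<^sub>R A \<xi>) *v v))\<^sup>2 \<le> C * exp (- (c * t / \<bar>\<xi>\<bar> ^ 0)) * (norm v)\<^sup>2"
      using high_frequency_decay[of 0] exp by blast
    show thesis
    \<comment> \<open>The rate enters the estimate squared, so its exponent is half of that of the
      propagator bound.\<close>
    proof (rule that[of "c / 2" "C * 1"])
      fix t \<xi> :: real and v :: "complex ^ 8" assume a: "0 \<le> t" "1 \<le> \<bar>\<xi>\<bar>"
      have "high_rate l (c / 2) t = exp (- (c / 2) * t)"
        unfolding high_rate_def using exp by (simp only: if_True simp_thms)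
      then have "exp (- (c * t / \<bar>\<xi>\<bar> ^ 0)) = 1 * (high_rate l (c / 2) t)\<^sup>2 * 1"
        by (simp add: power2_eq_square flip: exp_add)
      also have "\<dots> \<le> 1 * (high_rate l (c / 2) t)\<^sup>2 * \<bar>\<xi>\<bar> ^ (2 * l)"
        using a by (intro mult_left_mono one_le_power) auto
      finally show "(norm (mat_exp (t *\<^sub>R A \<xi>) *v v))\<^sup>2 \<le> C * 1 * (high_rate l (c / 2) t)\<^sup>2 * \<bar>\<xi>\<bar> ^ (2 * l) * (norm v)\<^sup>2"
        by (intro combine[OF C(3)[OF a]] C(1)) auto
    qed (use C in auto)
  next
    case two
    obtain C c where C: "C > 0" "c > 0" "\<And>t \<xi> v. 0 \<le> t \<Longrightarrow> 1 \<le> \<bar>\<xi>\<bar> \<Longrightarrow>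
      (norm (mat_exp (t *\<^sub>R A \<xi>) *v v))\<^sup>2 \<le> C * exp (- (c * t / \<bar>\<xi>\<bar>\<^sup>2)) * (norm v)\<^sup>2"
      using high_frequency_decay[of 2] two by blast
    obtain K where K: "K > 0" "\<And>t x. t \<ge> 0 \<Longrightarrow> x \<ge> 1 \<Longrightarrow>
      exp (- (c * t / x\<^sup>2)) \<le> K * ((1 + t) powr (- real l / 2))\<^sup>2 * x ^ (2 * l)"
      using high_frequency_weight_2[OF C(2)] by blast
    show thesis
    \<comment> \<open>The value 1 stands in for an exponential rate, which only the previous case
      produces.\<close>
    proof (rule that[of 1 "C * K"])
      fix t \<xi> :: real and v :: "complex ^ 8" assume a: "0 \<le> t" "1 \<le> \<bar>\<xi>\<bar>"
      have "exp (- (c * t / \<bar>\<xi>\<bar>\<^sup>2)) \<le> K * (high_rate l 1 t)\<^sup>2 * \<bar>\<xi>\<bar> ^ (2 * l)"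
        unfolding high_rate_def using K(2)[OF a] two by (simp only: if_True if_False simp_thms)
      then show "(norm (mat_exp (t *\<^sub>R A \<xi>) *v v))\<^sup>2 \<le> C * K * (high_rate l 1 t)\<^sup>2 * \<bar>\<xi>\<bar> ^ (2 * l) * (norm v)\<^sup>2"
        by (intro combine[OF C(3)[OF a]] C(1)) auto
    qed (use C K in auto)
  next
    case four
    obtain C c where C: "C > 0" "c > 0" "\<And>t \<xi> v. 0 \<le> t \<Longrightarrow> 1 \<le> \<bar>\<xi>\<bar> \<Longrightarrow>
      (norm (mat_exp (t *\<^sub>R A \<xi>) *v v))\<^sup>2 \<le> C * exp (- (c * t / \<bar>\<xi>\<bar> ^ 4)) * (norm v)\<^sup>2"
      using high_frequency_decay[of 4] by blast
    obtain K where K: "K > 0" "\<And>t x. t \<ge> 0 \<Longrightarrow> x \<ge> 1 \<Longrightarrow>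
      exp (- (c * t / x ^ 4)) \<le> K * ((1 + t) powr (- real l / 4))\<^sup>2 * x ^ (2 * l)"
      using high_frequency_weight_4[OF C(2)] by blast
    show thesis
    proof (rule that[of 1 "C * K"])
      fix t \<xi> :: real and v :: "complex ^ 8" assume a: "0 \<le> t" "1 \<le> \<bar>\<xi>\<bar>"
      have "exp (- (c * t / \<bar>\<xi>\<bar> ^ 4)) \<le> K * (high_rate l 1 t)\<^sup>2 * \<bar>\<xi>\<bar> ^ (2 * l)"
        unfolding high_rate_def using K(2)[OF a] four by (simp only: if_False)
      then show "(norm (mat_exp (t *\<^sub>R A \<xi>) *v v))\<^sup>2 \<le> C * K * (high_rate l 1 t)\<^sup>2 * \<bar>\<xi>\<bar> ^ (2 * l) * (norm v)\<^sup>2"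
        by (intro combine[OF C(3)[OF a]] C(1)) auto
    qed (use C K in auto)
  qed
qed

end

theorem theorem4p5:
  fixes k1 k2 k3 k4 k5 \<gamma> \<tau>1 \<tau>2 \<tau>3 :: real and \<epsilon>0 N l j :: nat
  assumes "k1 > 0" "k2 > 0" "k3 > 0" "k4 > 0" "k5 > 0" and "\<gamma> \<noteq> 0"
    and "(\<tau>1, \<tau>2, \<tau>3) = (0, 1, 0)" and "\<epsilon>0 \<in> {0, 1}"
    and "0 < l" "l \<le> N" and "j \<in> {0..N - l}"
  shows "\<exists>c0>0. \<exists>c1>0.
    \<forall>(U0 :: real \<Rightarrow> complex ^ 8) (U :: real \<Rightarrow> real \<Rightarrow> complex ^ 8).
      U0 \<in> sobolev_H N \<and> integrable lborel U0 \<and>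
      beam_solution k1 k2 k3 k4 k5 \<gamma> \<tau>1 \<tau>2 \<tau>3 \<epsilon>0 U0 U \<longrightarrow>
      (\<forall>t\<ge>0. (\<lambda>x. U x t) \<in> sobolev_H j \<and>
        (\<epsilon>0 = 1 \<longrightarrow>
          (if k1 = k2 \<and> k2 = k3 then
            L2_norm (weak_deriv j (\<lambda>x. U x t)) \<le>
              c0 * (1 + t) powr (- 1 / 12 - real j / 6) * L1_norm U0
              + c0 * exp (- c1 * t) * L2_norm (weak_deriv (j + l) U0)
          else
            L2_norm (weak_deriv j (\<lambda>x. U x t)) \<le>
              c0 * (1 + t) powr (- 1 / 12 - real j / 6) * L1_norm U0
              + c0 * (1 + t) powr (- real l / 4) * L2_norm (weak_deriv (j + l) U0))) \<and>
        (\<epsilon>0 = 0 \<longrightarrow>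
          (if k1 = k2 \<and> k2 = k3 then
            L2_norm (weak_deriv j (\<lambda>x. U x t)) \<le>
              c0 * (1 + t) powr (- 1 / 8 - real j / 4) * L1_norm U0
              + c0 * (1 + t) powr (- real l / 2) * L2_norm (weak_deriv (j + l) U0)
          else
            L2_norm (weak_deriv j (\<lambda>x. U x t)) \<le>
              c0 * (1 + t) powr (- 1 / 8 - real j / 4) * L1_norm U0
              + c0 * (1 + t) powr (- real l / 4) * L2_norm (weak_deriv (j + l) U0))))"
proof -
  have \<tau>: "\<tau>1 = 0" "\<tau>2 = 1" "\<tau>3 = 0" using assms by simp_all
  interpret beam k1 k2 k3 k4 k5 \<gamma> \<epsilon>0
    using assms by unfold_locales
  obtain C c where low: "C > 0" "c > 0" "\<And>t \<xi> v. 0 \<le> t \<Longrightarrow> \<xi> \<noteq> 0 \<Longrightarrow> \<bar>\<xi>\<bar> \<le> 1 \<Longrightarrow>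
    (norm (mat_exp (t *\<^sub>R A \<xi>) *v v))\<^sup>2 \<le> C * exp (- (c * t * \<bar>\<xi>\<bar> ^ (4 + 2 * \<epsilon>0))) * (norm v)\<^sup>2"
    using low_frequency_decay by blast
  obtain c1 D where high: "0 < c1" "0 < D" "\<And>t \<xi> v. 0 \<le> t \<Longrightarrow> 1 \<le> \<bar>\<xi>\<bar> \<Longrightarrow>
    (norm (mat_exp (t *\<^sub>R A \<xi>) *v v))\<^sup>2 \<le> D * (high_rate l c1 t)\<^sup>2 * \<bar>\<xi>\<bar> ^ (2 * l) * (norm v)\<^sup>2"
    using high_frequency_rate[of l] by blast
  have rate0: "0 \<le> high_rate l c1 t" for t by (simp add: high_rate_def)
  have a0: "0 < 4 + 2 * \<epsilon>0" by simp
  obtain K where K: "0 < K" "\<And>N k U0 U t. k + l \<le> N \<Longrightarrow> U0 \<in> sobolev_H N \<Longrightarrow> integrable lborel U0 \<Longrightarrow>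
    beam_solution k1 k2 k3 k4 k5 \<gamma> 0 1 0 \<epsilon>0 U0 U \<Longrightarrow> 0 \<le> t \<Longrightarrow>
    (\<exists>g. has_weak_deriv k (\<lambda>x. U x t) g \<and> square_integrable g) \<and>
    (k = j \<longrightarrow> L2_norm (weak_deriv j (\<lambda>x. U x t))
      \<le> K * (1 + t) powr (- (2 * real j + 1) / (2 * real (4 + 2 * \<epsilon>0))) * L1_norm U0
        + K * high_rate l c1 t * L2_norm (weak_deriv (j + l) U0))"
    by (rule propagated_estimate[where C = C and c = c and a = "4 + 2 * \<epsilon>0" and D = D and \<rho> = "high_rate l c1" and l = l and j = j];
      (rule low a0 high rate0; assumption)?) blast
  show ?thesis
  proof (rule exI[of _ K], rule conjI[OF K(1)], rule exI[of _ c1], rule conjI[OF high(1)], intro allI impI, elim conjE)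
    fix U0 :: "real \<Rightarrow> complex ^ 8" and U :: "real \<Rightarrow> real \<Rightarrow> complex ^ 8" and t :: real
    assume U0: "U0 \<in> sobolev_H N" "integrable lborel U0" and t: "0 \<le> t"
      and "beam_solution k1 k2 k3 k4 k5 \<gamma> \<tau>1 \<tau>2 \<tau>3 \<epsilon>0 U0 U"
    then have U: "beam_solution k1 k2 k3 k4 k5 \<gamma> 0 1 0 \<epsilon>0 U0 U" by (simp add: \<tau>)
    have le: "k + l \<le> N" if "k \<le> j" for k using that assms by auto
    have sq: "square_integrable (\<lambda>x. U x t)"
      using U t by (auto simp: beam_solution_def has_fourier_L2_def)
    \<comment> \<open>Here the existence part of the estimate is used at every order
      \<open>k\<close> up to \<open>j\<close>.\<close>
    have sob: "(\<lambda>x. U x t) \<in> sobolev_H j"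
      unfolding sobolev_H_def using sq K(2)[OF le U0 U t] by blast
    have est: "L2_norm (weak_deriv j (\<lambda>x. U x t))
      \<le> K * (1 + t) powr (- (2 * real j + 1) / (2 * real (4 + 2 * \<epsilon>0))) * L1_norm U0
        + K * high_rate l c1 t * L2_norm (weak_deriv (j + l) U0)"
      using K(2)[OF le[OF order_refl] U0 U t] by blast
    \<comment> \<open>The exponent (2 j + 1) / (2 a) with a = 6, and in \<open>e0\<close> with a =
      4.\<close>
    have e1: "- (2 * real j + 1) / (2 * real (4 + 2 * \<epsilon>0)) = - 1 / 12 - real j / 6" if "\<epsilon>0 = 1"
      using that by (simp add: field_simps)
    have e0: "- (2 * real j + 1) / (2 * real (4 + 2 * \<epsilon>0)) = - 1 / 8 - real j / 4" if "\<epsilon>0 = 0"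
      using that by (simp add: field_simps)
    show "(\<lambda>x. U x t) \<in> sobolev_H j \<and>
        (\<epsilon>0 = 1 \<longrightarrow>
          (if k1 = k2 \<and> k2 = k3 then
            L2_norm (weak_deriv j (\<lambda>x. U x t)) \<le>
              K * (1 + t) powr (- 1 / 12 - real j / 6) * L1_norm U0
              + K * exp (- c1 * t) * L2_norm (weak_deriv (j + l) U0)
          else
            L2_norm (weak_deriv j (\<lambda>x. U x t)) \<le>
              K * (1 + t) powr (- 1 / 12 - real j / 6) * L1_norm U0
              + K * (1 + t) powr (- real l / 4) * L2_norm (weak_deriv (j + l) U0))) \<and>
        (\<epsilon>0 = 0 \<longrightarrow>
          (if k1 = k2 \<and> k2 = k3 then
            L2_norm (weak_deriv j (\<lambda>x. U x t)) \<le>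
              K * (1 + t) powr (- 1 / 8 - real j / 4) * L1_norm U0
              + K * (1 + t) powr (- real l / 2) * L2_norm (weak_deriv (j + l) U0)
          else
            L2_norm (weak_deriv j (\<lambda>x. U x t)) \<le>
              K * (1 + t) powr (- 1 / 8 - real j / 4) * L1_norm U0
              + K * (1 + t) powr (- real l / 4) * L2_norm (weak_deriv (j + l) U0)))"
    proof (intro conjI sob impI, goal_cases)
      case 1
      show ?case
        using est 1 unfolding e1[OF 1] high_rate_def by (cases "k1 = k2 \<and> k2 = k3") auto
    next
      case 2
      show ?case
        using est 2 unfolding e0[OF 2] high_rate_def by (cases "k1 = k2 \<and> k2 = k3") auto
    qed
  qed
qed

end
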